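(* Assume the Riemann Hypothesis, that all non-trivial zeros of $\zeta(s)$ are simple, the Linear Independence conjecture, and that for every $\epsilon>0$, $\sum_{|\gamma_m|\le T}\frac{1}{|\zeta'(\rho_m)|}\ll_\epsilon T^{1+\epsilon}$ as $T\to\infty$. Then there exists an absolute constant $c>0$ such that for all sufficiently small $\delta>0$, \[\limsup_{y\to\infty}\frac{1}{\sqrt y}\sum_{n\le y}\mu(n)\Big(1-\frac ny\Big)^\delta\ge\frac{c}{\delta}\quad\text{and}\quad\liminf_{y\to\infty}\frac{1}{\sqrt y}\sum_{n\le y}\mu(n)\Big(1-\frac ny\Big)^\delta\le-\frac{c}{\delta}.\]
   Context: $\mu$ is the Möbius function. Non-trivial zeros of $\zeta$ are $\rho_m=\beta_m+i\gamma_m$. The Linear Independence conjecture asserts that the positive imaginary parts $\gamma_m>0$ of the non-trivial zeros of $\zeta(s)$ are linearly independent over $\mathbb{Q}$. *)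

theory Defs
  imports "HOL-Complex_Analysis.Complex_Analysis" "HOL-Library.Landau_Symbols"
    "HOL-Computational_Algebra.Computational_Algebra"
begin

section \<open>The Riemann zeta function\<close>

text \<open>The zeta function is defined by analytic continuation of its Dirichlet series. The choice
  is unique except for the value at the pole \<open>1\<close>, which is left unspecified. Existence of the
  continuation is proved below (lemmas \<open>zeta_holomorphic\<close>, \<open>zeta_sums\<close>).\<close>

definition zeta :: "complex \<Rightarrow> complex" where
  "zeta = (SOME f. f holomorphic_on - {1} \<and>
     (\<forall>s. Re s > 1 \<longrightarrow> (\<lambda>n. 1 / of_nat (Suc n) powr s) sums f s))"

definition nontrivial_zeros :: "complex set" where
  "nontrivial_zeros = {\<rho>. 0 < Re \<rho> \<and> Re \<rho> < 1 \<and> zeta \<rho> = 0}"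

definition Riemann_Hypothesis :: bool where
  "Riemann_Hypothesis \<longleftrightarrow> (\<forall>\<rho>\<in>nontrivial_zeros. Re \<rho> = 1 / 2)"

definition Simple_Zeros :: bool where
  "Simple_Zeros \<longleftrightarrow> (\<forall>\<rho>\<in>nontrivial_zeros. zorder zeta \<rho> = 1)"

lemma vector_space_real_over_rat: "vector_space (\<lambda>(q::rat) (x::real). of_rat q * x)"
  by unfold_locales (auto simp: algebra_simps of_rat_add of_rat_mult)

text \<open>The ordinates are taken as a set. Under the Riemann Hypothesis and the simplicity of the
  zeros, this agrees with the family of ordinates listed with multiplicity.\<close>

definition Linear_Independence_Conjecture :: bool where
  "Linear_Independence_Conjecture \<longleftrightarrow>
     module.independent (\<lambda>(q::rat) (x::real). of_rat q * x) (Im ` nontrivial_zeros \<inter> {0<..})"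


section \<open>The Moebius function\<close>

definition moebius_mu :: "nat \<Rightarrow> real" where
  "moebius_mu n = (if squarefree n then (- 1) ^ card (prime_factors n) else 0)"


section \<open>Existence of the analytic continuation\<close>

definition zeta0 :: "complex \<Rightarrow> complex" where
  "zeta0 s = (\<Sum>n. of_nat (Suc n) powr (- s))"

lemma holomorphic_series:
  fixes f :: "nat \<Rightarrow> complex \<Rightarrow> complex"
  assumes S: "open S" and h: "\<And>n. f n holomorphic_on S"
    and M: "\<And>x. x \<in> S \<Longrightarrow> \<exists>d>0. \<exists>M. cball x d \<subseteq> S \<and> summable M \<and> (\<forall>n. \<forall>z\<in>cball x d. norm (f n z) \<le> M n)"
  shows "(\<lambda>z. \<Sum>n. f n z) holomorphic_on S" "\<And>z. z \<in> S \<Longrightarrow> summable (\<lambda>n. f n z)"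
proof -
  show "(\<lambda>z. \<Sum>n. f n z) holomorphic_on S"
  proof (rule holomorphic_uniform_sequence[OF S, where f = "\<lambda>n z. \<Sum>i<n. f i z"])
    show "(\<lambda>z. \<Sum>i<n. f i z) holomorphic_on S" for n
      by (intro holomorphic_intros h)
    fix x assume "x \<in> S"
    then obtain d M' where "d > 0" "cball x d \<subseteq> S" "summable M'" "\<And>n z. z \<in> cball x d \<Longrightarrow> norm (f n z) \<le> M' n"
      using M by metis
    then show "\<exists>d>0. cball x d \<subseteq> S \<and> uniform_limit (cball x d) (\<lambda>n z. \<Sum>i<n. f i z) (\<lambda>z. \<Sum>n. f n z) sequentially"
      using Weierstrass_m_test by blast
  qed
  fix z assume "z \<in> S"
  then obtain d M' where d: "d > 0" "summable M'" "\<And>n z'. z' \<in> cball z d \<Longrightarrow> norm (f n z') \<le> M' n"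
    using M by metis
  then have "\<And>n. norm (f n z) \<le> M' n" by simp
  then show "summable (\<lambda>n. f n z)"
    using d(2) by (meson summable_comparison_test')
qed
definition zeta_coeff :: "nat \<Rightarrow> complex \<Rightarrow> complex" where
  "zeta_coeff j s = (\<Prod>i<j. 1 - s - of_nat i)"
definition zeta_rem :: "nat \<Rightarrow> nat \<Rightarrow> complex \<Rightarrow> complex" where
  "zeta_rem K n s = of_nat (Suc (Suc n)) powr (1 - s) - (\<Sum>j\<le>K. zeta_coeff j s * of_nat (Suc n) powr (1 - s - of_nat j) / fact j)"
lemma zeta_rem_bound:
  assumes "Re s + K \<ge> 0"
  shows "norm (zeta_rem K n s) \<le> norm (zeta_coeff (Suc K) s) / fact K * real (Suc n) powr (- Re s - K)"
proof -
  let ?N = "of_nat (Suc n) :: complex"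
  let ?S = "closed_segment ?N (of_nat (Suc (Suc n)))"
  let ?f = "\<lambda>j z. zeta_coeff j s * z powr (1 - s - of_nat j)"
  have pos: "\<exists>x. z = of_real x \<and> x \<ge> real (Suc n)" if "z \<in> ?S" for z
  proof -
    from that obtain u where u: "0 \<le> u" "u \<le> 1" "z = (1-u) *\<^sub>R ?N + u *\<^sub>R of_nat (Suc (Suc n))"
      by (auto simp: closed_segment_def)
    then have "z = of_real (real (Suc n) + u)"
      by (simp add: scaleR_conv_of_real algebra_simps)
    with u show ?thesis by (metis le_add_same_cancel1)
  qed
  have "norm (?f 0 (of_nat (Suc (Suc n))) - (\<Sum>j\<le>K. ?f j ?N * (of_nat (Suc (Suc n)) - ?N) ^ j / fact j))
     \<le> (norm (zeta_coeff (Suc K) s) * real (Suc n) powr (- Re s - K)) * norm (of_nat (Suc (Suc n)) - ?N) ^ Suc K / fact K"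
  proof (rule complex_Taylor[where S = ?S])
    fix i z assume "z \<in> ?S"
    then obtain x where x: "z = of_real x" "x \<ge> real (Suc n)" using pos by blast
    then have z: "z \<notin> \<real>\<^sub>\<le>\<^sub>0" by auto
    have e: "1 - s - of_nat i - 1 = 1 - s - of_nat (Suc i)" by simp
    have "((\<lambda>z. zeta_coeff i s * z powr (1 - s - of_nat i)) has_field_derivative 
          zeta_coeff i s * ((1 - s - of_nat i) * z powr (1 - s - of_nat i - 1))) (at z within ?S)"
      by (intro DERIV_cmult has_field_derivative_at_within[OF has_field_derivative_powr[OF z]])
    then show "(?f i has_field_derivative ?f (Suc i) z) (at z within ?S)"
      unfolding e zeta_coeff_def by (simp add: algebra_simps)
  next
    fix z assume "z \<in> ?S"
    then obtain x where x: "z = of_real x" "x \<ge> real (Suc n)" using pos by blast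
    then have "x > 0" by linarith
    then have "norm (z powr (1 - s - of_nat (Suc K))) = x powr (- Re s - K)"
      by (simp add: x norm_powr_real_powr)
    also have "\<dots> \<le> real (Suc n) powr (- Re s - K)"
      using assms x by (intro powr_mono2') auto
    finally show "norm (?f (Suc K) z) \<le> norm (zeta_coeff (Suc K) s) * real (Suc n) powr (- Re s - K)"
      by (simp add: norm_mult mult_left_mono)
  qed auto
  then show ?thesis by (simp add: zeta_rem_def zeta_coeff_def)
qed

lemma summable_shift_powr: "a < -1 \<Longrightarrow> summable (\<lambda>n. real (Suc n) powr a)"
  using summable_Suc_iff[of "\<lambda>n. real n powr a"] by (simp add: summable_real_powr_iff)

lemma norm_Suc_powr: "norm (of_nat (Suc n) powr s :: complex) = real (Suc n) powr Re s"
  using norm_powr_real_powr[of "of_nat (Suc n)" s] by simp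

lemma zeta_summable:
  assumes "Re s > 1"
  shows "summable (\<lambda>n. of_nat (Suc n) powr (- s) :: complex)"
  by (rule summable_norm_cancel, unfold norm_Suc_powr, rule summable_shift_powr) (use assms in simp)

lemma cball_Re: "z \<in> cball x d \<Longrightarrow> Re z \<ge> Re x - d" for x z :: complex
  using abs_Re_le_cmod[of "x - z"] by (auto simp: dist_norm)

lemma zeta_base_holo: "(\<lambda>s. \<Sum>n. of_nat (Suc n) powr (- s) :: complex) holomorphic_on {s. Re s > 1}"
proof (rule holomorphic_series)
  fix x :: complex assume "x \<in> {s. Re s > 1}"
  then have x: "Re x > 1" by simp
  define d where "d = (Re x - 1) / 2"
  show "\<exists>d>0. \<exists>M. cball x d \<subseteq> {s. Re s > 1} \<and> summable M \<and>
      (\<forall>n. \<forall>z\<in>cball x d. norm (of_nat (Suc n) powr (- z) :: complex) \<le> M n)"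
  proof (intro exI conjI allI ballI)
    show "d > 0" using x by (simp add: d_def)
    show "cball x d \<subseteq> {s. Re s > 1}"
      using cball_Re[of _ x d] x by (force simp: d_def field_simps)
    show "summable (\<lambda>n. real (Suc n) powr (d - Re x))"
      by (rule summable_shift_powr) (use x in \<open>simp add: d_def field_simps\<close>)
    fix n z assume "z \<in> cball x d"
    then have "- Re z \<le> d - Re x" using cball_Re[of z x d] by simp
    then show "norm (of_nat (Suc n) powr (- z) :: complex) \<le> real (Suc n) powr (d - Re x)"
      unfolding norm_Suc_powr by (intro powr_mono) auto
  qed
qed (auto intro!: holomorphic_intros open_halfspace_Re_gt)

lemma zeta_coeff_holo [holomorphic_intros]: "zeta_coeff j holomorphic_on A"
  unfolding zeta_coeff_def by (intro holomorphic_intros)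

lemma zeta_rem_holo: "zeta_rem K n holomorphic_on A"
  unfolding zeta_rem_def by (intro holomorphic_intros) auto

lemma zeta_rem_series:
  assumes "K \<ge> 1"
  shows "(\<lambda>s. \<Sum>n. zeta_rem K n s) holomorphic_on {s. Re s > 1 - real K}"
    and "\<And>s. Re s > 1 - real K \<Longrightarrow> summable (\<lambda>n. zeta_rem K n s)"
proof -
  have M: "\<exists>d>0. \<exists>M. cball x d \<subseteq> {s. Re s > 1 - real K} \<and> summable M \<and>
      (\<forall>n. \<forall>z\<in>cball x d. norm (zeta_rem K n z) \<le> M n)"
    if "x \<in> {s. Re s > 1 - real K}" for x
  proof -
    from that have x: "Re x > 1 - real K" by simp
    define d where "d = (Re x - 1 + K) / 2"
    have "compact (zeta_coeff (Suc K) ` cball x d)"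
      by (intro compact_continuous_image holomorphic_on_imp_continuous_on holomorphic_intros) auto
    then obtain C where C: "\<And>z. z \<in> cball x d \<Longrightarrow> norm (zeta_coeff (Suc K) z) \<le> C"
      by (meson compact_imp_bounded bounded_iff imageI)
    show ?thesis
    proof (intro exI conjI allI ballI)
      show d: "d > 0" using x by (simp add: d_def)
      show "cball x d \<subseteq> {s. Re s > 1 - real K}"
        using cball_Re[of _ x d] x by (force simp: d_def field_simps)
      show "summable (\<lambda>n. C / fact K * real (Suc n) powr (d - Re x - K))"
        by (intro summable_mult summable_shift_powr) (use x in \<open>simp add: d_def field_simps\<close>)
      fix n z assume z: "z \<in> cball x d"
      then have z': "Re z \<ge> Re x - d" by (rule cball_Re)
      then have "Re z + K \<ge> 0" using x by (simp add: d_def field_simps)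
      then have "norm (zeta_rem K n z) \<le> norm (zeta_coeff (Suc K) z) / fact K * real (Suc n) powr (- Re z - K)"
        by (rule zeta_rem_bound)
      also have "\<dots> \<le> C / fact K * real (Suc n) powr (d - Re x - K)"
        using C[OF z] z' order_trans[OF norm_ge_zero C[OF z]]
        by (intro mult_mono divide_right_mono powr_mono) auto
      finally show "norm (zeta_rem K n z) \<le> C / fact K * real (Suc n) powr (d - Re x - K)" .
    qed
  qed
  note * = holomorphic_series[OF open_halfspace_Re_gt zeta_rem_holo M]
  show "(\<lambda>s. \<Sum>n. zeta_rem K n s) holomorphic_on {s. Re s > 1 - real K}"
    by (rule *)
  show "summable (\<lambda>n. zeta_rem K n s)" if "Re s > 1 - real K" for s
    using *(2) that by auto
qed

lemma zeta0_rec: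
  assumes "Re s > 1" "K \<ge> 1"
  shows "(s - 1) * zeta0 s = 1 + (\<Sum>n. zeta_rem K n s)
     - (\<Sum>j\<in>{2..K}. zeta_coeff (j - 1) s / fact j * ((s + of_nat (j - 1) - 1) * zeta0 (s + of_nat (j - 1))))"
proof -
  have z: "(\<lambda>n. of_nat (Suc n) powr (- w)) sums zeta0 w" if "Re w > 1" for w :: complex
    unfolding zeta0_def by (intro summable_sums zeta_summable that)
  have "(\<lambda>n. of_nat (Suc n) powr (1 - s) :: complex) \<longlonglongrightarrow> 0"
  proof (rule tendsto_norm_zero_cancel)
    have "(\<lambda>n. real n powr (1 - Re s)) \<longlonglongrightarrow> 0"
      by (rule tendsto_neg_powr[OF _ filterlim_real_sequentially]) (use assms in simp)
    then have "(\<lambda>n. real (Suc n) powr (1 - Re s)) \<longlonglongrightarrow> 0"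
      by (rule LIMSEQ_Suc)
    then show "(\<lambda>n. norm (of_nat (Suc n) powr (1 - s) :: complex)) \<longlonglongrightarrow> 0"
      unfolding norm_Suc_powr by simp
  qed
  from telescope_sums[OF this]
  have tel: "(\<lambda>n. of_nat (Suc (Suc n)) powr (1 - s) - of_nat (Suc n) powr (1 - s) :: complex) sums (-1)"
    by simp
  have rem: "zeta_rem K n s = (of_nat (Suc (Suc n)) powr (1 - s) - of_nat (Suc n) powr (1 - s))
      - (\<Sum>j\<in>{1..K}. zeta_coeff j s / fact j * of_nat (Suc n) powr (- (s + of_nat (j - 1))))" for n
  proof -
    have "{..K} = insert 0 {1..K}" by auto
    moreover have "(\<Sum>j\<in>{1..K}. zeta_coeff j s * of_nat (Suc n) powr (1 - s - of_nat j) / fact j)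
       = (\<Sum>j\<in>{1..K}. zeta_coeff j s / fact j * of_nat (Suc n) powr (- (s + of_nat (j - 1))))"
      by (intro sum.cong refl) (auto simp: of_nat_diff algebra_simps)
    ultimately show ?thesis
      by (simp add: zeta_rem_def zeta_coeff_def)
  qed
  have "(\<lambda>n. zeta_rem K n s) sums (- 1 - (\<Sum>j\<in>{1..K}. zeta_coeff j s / fact j * zeta0 (s + of_nat (j - 1))))"
    unfolding rem by (intro sums_diff tel sums_sum sums_mult z) (use assms in auto)
  then have "(\<Sum>n. zeta_rem K n s) = - 1 - (\<Sum>j\<in>{1..K}. zeta_coeff j s / fact j * zeta0 (s + of_nat (j - 1)))"
    by (simp add: sums_iff)
  also have "{1..K} = insert 1 {2..K}" using assms by auto
  also have "(\<Sum>j\<in>\<dots>. zeta_coeff j s / fact j * zeta0 (s + of_nat (j - 1)))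
     = (1 - s) * zeta0 s + (\<Sum>j\<in>{2..K}. zeta_coeff j s / fact j * zeta0 (s + of_nat (j - 1)))"
    by (simp add: zeta_coeff_def)
  also have "(\<Sum>j\<in>{2..K}. zeta_coeff j s / fact j * zeta0 (s + of_nat (j - 1)))
     = - (\<Sum>j\<in>{2..K}. zeta_coeff (j - 1) s / fact j * ((s + of_nat (j - 1) - 1) * zeta0 (s + of_nat (j - 1))))"
    unfolding sum_negf[symmetric]
  proof (intro sum.cong refl)
    fix j assume "j \<in> {2..K}"
    then obtain i where j: "j = Suc i" by (cases j) auto
    have c: "zeta_coeff j s = - (zeta_coeff i s * (s + of_nat i - 1))"
      unfolding j zeta_coeff_def by (simp add: algebra_simps)
    show "zeta_coeff j s / fact j * zeta0 (s + of_nat (j - 1)) =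
      - (zeta_coeff (j - 1) s / fact j * ((s + of_nat (j - 1) - 1) * zeta0 (s + of_nat (j - 1))))"
      unfolding c using j by simp
  qed
  finally show ?thesis by (simp add: algebra_simps)
qed

lemma zeta_extend:
  "\<exists>G. G holomorphic_on {s. Re s > 1 - real k} \<and> (\<forall>s. Re s > 1 \<longrightarrow> G s = (s - 1) * zeta0 s)"
proof (induction k)
  case 0
  have "(\<lambda>s. (s - 1) * zeta0 s) holomorphic_on {s. Re s > 1}"
    unfolding zeta0_def by (intro holomorphic_intros zeta_base_holo)
  then show ?case by auto
next
  case (Suc k)
  then obtain G where G: "G holomorphic_on {s. Re s > 1 - real k}"
      "\<And>s. Re s > 1 \<Longrightarrow> G s = (s - 1) * zeta0 s" by blast
  let ?K = "Suc k"
  let ?G = "\<lambda>s. 1 + (\<Sum>n. zeta_rem ?K n s)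
     - (\<Sum>j\<in>{2..?K}. zeta_coeff (j - 1) s / fact j * G (s + of_nat (j - 1)))"
  have "(\<lambda>s. G (s + of_nat (j - 1))) holomorphic_on {s. Re s > 1 - real ?K}" if "j \<in> {2..?K}" for j
  proof -
    have "(G \<circ> (\<lambda>s. s + of_nat (j - 1))) holomorphic_on {s. Re s > 1 - real ?K}"
      by (rule holomorphic_on_compose_gen[OF _ G(1)]) (use that in \<open>auto intro!: holomorphic_intros\<close>)
    then show ?thesis by (simp add: o_def)
  qed
  then have "?G holomorphic_on {s. Re s > 1 - real ?K}"
    by (intro holomorphic_intros zeta_rem_series) auto
  moreover have "?G s = (s - 1) * zeta0 s" if "Re s > 1" for s
  proof -
    have "G (s + of_nat (j - 1)) = (s + of_nat (j - 1) - 1) * zeta0 (s + of_nat (j - 1))" for j :: nat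
      using that by (intro G(2)) (simp add: add_pos_nonneg)
    then show ?thesis using zeta0_rec[OF that, of ?K] by (simp only:)
  qed
  ultimately show ?case by blast
qed

lemma zeta_entire:
  obtains G where "G holomorphic_on UNIV" "\<And>s. Re s > 1 \<Longrightarrow> G s = (s - 1) * zeta0 s"
proof -
  obtain G where G: "\<And>k. G k holomorphic_on {s. Re s > 1 - real k}"
      "\<And>k s. Re s > 1 \<Longrightarrow> G k s = (s - 1) * zeta0 s"
    using zeta_extend by metis
  have eq: "G k s = G l s" if "k \<le> l" "Re s > 1 - real k" for k l s
  proof (rule analytic_continuation_open[of "{s. Re s > 1}" "{s. Re s > 1 - real k}" "G k" "G l"])
    show "{s. Re s > 1} \<noteq> {}" by (auto intro!: exI[of _ "2 :: complex"])
    show "connected {s. Re s > 1 - real k}"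
      by (intro convex_connected convex_halfspace_Re_gt)
    show "G l holomorphic_on {s. Re s > 1 - real k}"
      by (rule holomorphic_on_subset[OF G(1)]) (use that in auto)
  qed (use G that in \<open>auto intro: open_halfspace_Re_gt\<close>)
  define F where "F s = G (nat \<lceil>2 - Re s\<rceil>) s" for s
  have F: "F s = G k s" if "Re s > 1 - real k" for k s
  proof -
    have "Re s > 1 - real (nat \<lceil>2 - Re s\<rceil>)" by linarith
    then show ?thesis unfolding F_def using eq that by (metis linear)
  qed
  have "F field_differentiable (at s)" for s
  proof -
    obtain k :: nat where k: "real k > 1 - Re s" using reals_Archimedean2 by blast
    have "F holomorphic_on {s. Re s > 1 - real k}"
      using G(1)[of k] by (rule holomorphic_transform) (simp add: F)
    then show ?thesis
      by (rule holomorphic_on_imp_differentiable_at) (use k in \<open>auto intro: open_halfspace_Re_gt\<close>)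
  qed
  then have "F holomorphic_on UNIV"
    by (simp add: holomorphic_on_def field_differentiable_at_within)
  moreover have "F s = (s - 1) * zeta0 s" if "Re s > 1" for s
    using F[of 0 s] G(2)[of s 0] that by simp
  ultimately show ?thesis using that by blast
qed

lemma zeta_exists:
  "\<exists>f. f holomorphic_on - {1} \<and> (\<forall>s. Re s > 1 \<longrightarrow> (\<lambda>n. 1 / of_nat (Suc n) powr s) sums f s)"
proof -
  obtain G where G: "G holomorphic_on UNIV" "\<And>s. Re s > 1 \<Longrightarrow> G s = (s - 1) * zeta0 s"
    using zeta_entire by blast
  have "(\<lambda>s. G s / (s - 1)) holomorphic_on - {1}"
    by (intro holomorphic_intros holomorphic_on_subset[OF G(1)]) auto
  moreover have "(\<lambda>n. 1 / of_nat (Suc n) powr s) sums (G s / (s - 1))" if "Re s > 1" for s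
  proof -
    have "s \<noteq> 1" using that by auto
    then have "G s / (s - 1) = zeta0 s" using G(2)[OF that] by simp
    moreover have "(\<lambda>n. of_nat (Suc n) powr (- s)) sums zeta0 s"
      unfolding zeta0_def by (intro summable_sums zeta_summable that)
    ultimately show ?thesis by (simp add: powr_minus_divide)
  qed
  ultimately show ?thesis by blast
qed

lemma zeta_holomorphic: "zeta holomorphic_on - {1}"
  and zeta_sums: "Re s > 1 \<Longrightarrow> (\<lambda>n. 1 / of_nat (Suc n) powr s) sums zeta s"
  using someI_ex[OF zeta_exists] unfolding zeta_def by blast+

lemma zeta_unique:
  assumes "f holomorphic_on - {1}" "\<And>s. Re s > 1 \<Longrightarrow> (\<lambda>n. 1 / of_nat (Suc n) powr s) sums f s"
    and "s \<noteq> 1"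
  shows "zeta s = f s"
proof (rule analytic_continuation_open[of "{s. Re s > 1}" "- {1}" zeta f])
  show "{s. Re s > 1} \<noteq> {}" by (auto intro!: exI[of _ "2 :: complex"])
  show "connected (- {1 :: complex})"
    by (rule connected_punctured_universe) simp
  show "zeta z = f z" if "z \<in> {s. Re s > 1}" for z
    using zeta_sums[of z] assms(2)[of z] that by (auto intro: sums_unique2)
qed (use assms in \<open>auto intro: zeta_holomorphic open_halfspace_Re_gt\<close>)

text \<open>In particular, sums over the non-trivial zeros up to height \<open>T\<close> are genuine finite sums.\<close>

lemma finite_nontrivial_zeros: "finite {\<rho> \<in> nontrivial_zeros. \<bar>Im \<rho>\<bar> \<le> T}"
proof -
  obtain G where G: "G holomorphic_on UNIV" "\<And>s. Re s > 1 \<Longrightarrow> G s = (s - 1) * zeta0 s"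
    using zeta_entire by blast
  have zG: "zeta s = G s / (s - 1)" if "s \<noteq> 1" for s
  proof (rule analytic_continuation_open[of "{s. Re s > 1}" "- {1}" zeta "\<lambda>s. G s / (s - 1)"])
    show "{s. Re s > 1} \<noteq> {}" by (auto intro!: exI[of _ "2 :: complex"])
    show "connected (- {1 :: complex})"
      by (rule connected_punctured_universe) simp
    show "(\<lambda>s. G s / (s - 1)) holomorphic_on - {1}"
      by (intro holomorphic_intros holomorphic_on_subset[OF G(1)]) auto
    show "zeta z = G z / (z - 1)" if "z \<in> {s. Re s > 1}" for z
    proof -
      have "zeta z = zeta0 z"
        using sums_unique[OF zeta_sums[of z]] that by (simp add: zeta0_def powr_minus_divide)
      then show ?thesis using G(2)[of z] that by auto
    qed
  qed (use that in \<open>auto intro: zeta_holomorphic open_halfspace_Re_gt\<close>)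
  have sub: "{\<rho> \<in> nontrivial_zeros. \<bar>Im \<rho>\<bar> \<le> T} \<subseteq> {s \<in> cbox (Complex 0 (- T)) (Complex 1 T). G s = 0}"
  proof
    fix \<rho> assume \<rho>: "\<rho> \<in> {\<rho> \<in> nontrivial_zeros. \<bar>Im \<rho>\<bar> \<le> T}"
    then have "\<rho> \<noteq> 1" "zeta \<rho> = 0" by (auto simp: nontrivial_zeros_def)
    then have "G \<rho> = 0" using zG by simp
    then show "\<rho> \<in> {s \<in> cbox (Complex 0 (- T)) (Complex 1 T). G s = 0}"
      using \<rho> by (auto simp: nontrivial_zeros_def in_cbox_complex_iff)
  qed
  have ne: "zeta 2 \<noteq> 0"
  proof
    assume "zeta 2 = 0"
    then have "(\<lambda>n. 1 / of_nat (Suc n) powr 2 :: complex) sums 0" using zeta_sums[of 2] by simp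
    from sums_Re[OF this] have "(\<lambda>n. Re (1 / of_nat (Suc n) powr 2)) sums 0" by simp
    moreover have "Re (1 / of_nat (Suc n) powr 2) = 1 / (real (Suc n))\<^sup>2" for n
    proof -
      have "(1 / of_nat (Suc n) powr 2 :: complex) = of_real (1 / (real (Suc n))\<^sup>2)"
        using powr_nat'[of "of_nat (Suc n) :: complex" 2] by simp
      then show ?thesis by (simp only: Re_complex_of_real)
    qed
    ultimately have "(\<lambda>n. 1 / (real (Suc n))\<^sup>2) sums 0" by simp
    moreover have "(\<lambda>n. 1 / (real (Suc n))\<^sup>2) sums (pi\<^sup>2 / 6)"
      using inverse_squares_sums by simp
    ultimately have "pi\<^sup>2 / 6 = 0" by (rule sums_unique2[symmetric])
    then show False by simp
  qed
  show ?thesis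
  proof (cases "G constant_on UNIV")
    case True
    then obtain c where c: "\<And>s. G s = c" by (auto simp: constant_on_def)
    have "c \<noteq> 0" using ne zG[of 2] c[of 2] by auto
    then have "{s \<in> cbox (Complex 0 (- T)) (Complex 1 T). G s = 0} = {}" using c by auto
    then show ?thesis using sub by (metis finite.emptyI finite_subset)
  next
    case False
    have "finite {s \<in> cbox (Complex 0 (- T)) (Complex 1 T). G s = 0}"
      by (rule holomorphic_compact_finite_zeros[OF G(1)]) (use False in auto)
    then show ?thesis by (rule finite_subset[OF sub])
  qed
qed

end

theory Submission
  imports Defs "HOL-Real_Asymp.Real_Asymp"
begin

text \<open>
  Suppose that \<open>M(y) = \<Sum>n\<le>y. \<mu>(n) (1 - n/y)\<^sup>\<delta>\<close> (or its negative) is eventually at most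
  \<open>C \<surd>y\<close>. Its Mellin transform is \<open>B(w, 1 + \<delta>) / \<zeta>(w)\<close>, so Landau's theorem makes the transform
  converge for \<open>Re w > 1/2\<close>. Testing it against the nonnegative Riesz products
  \<open>\<Prod>(1 + cos (\<gamma> log y + \<phi>))\<close> over finitely many ordinates \<open>\<gamma> > 0\<close>, whose frequencies do not
  interfere because of linear independence, yields
  \<open>C \<ge> \<Sum>\<^sub>\<gamma> \<bar>B(\<rho>, 1 + \<delta>) / \<zeta>'(\<rho>)\<bar> - O(1)\<close>, where \<open>\<bar>B(\<rho>, 1 + \<delta>)\<bar>\<close> is of size \<open>\<gamma>\<close> to the power \<open>- 1 - \<delta>\<close>.

  The one-sided bound also gives polynomial growth of \<open>1/\<zeta>\<close> on both sides of the critical line.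
  This suffices to integrate \<open>exp (\<i>\<epsilon>s) / \<zeta>(s)\<close> over the boundary of the half-strip
  \<open>-1/2 \<le> Re s \<le> 4\<close>, \<open>Im s \<ge> t\<^sub>0\<close>: on the right \<open>1/\<zeta>\<close> is close to \<open>1\<close>, on the left it is small by the
  functional equation. Hence \<open>\<Sum>\<^sub>\<gamma> exp (- \<epsilon>\<gamma>) / \<bar>\<zeta>'(\<rho>)\<bar> \<ge> c/\<epsilon>\<close>, and summing over dyadic \<open>\<epsilon>\<close>
  with weights \<open>\<epsilon>\<close> to the power \<open>1 + \<delta>\<close> shows that the sum above is at least of order \<open>1/\<delta>\<close>.
\<close>


section \<open>Laplace transforms and Landau's theorem\<close>

text \<open>The contour crosses the critical line, so some control of 1/\<zeta> near that line is
  required; the assumed one-sided bound supplies it. Positivity bounds the transform on a vertical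
  line by its value at the real point of that line, where a simple pole at 1/2 is the worst that can
  occur. The resulting constant depends on C and \<delta>, which would ruin an absolute constant in
  the theorem. However, it enters only through the top edge of the contour, with a factor T exp (-
  \<epsilon>T), and disappears as T tends to infinity with \<epsilon> fixed. All surviving constants
  come from \<zeta> alone, at a height fixed in advance.

  The dyadic points are \<epsilon> = \<open>\<epsilon>\<^sub>0\<close> / 2^j with j \<le>
  1/\<delta>: in this range the \<delta>-th power of \<epsilon> stays bounded below, so about
  1/\<delta> scales contribute a fixed amount each. Finitely many scales need only one T, hence one
  finite Riesz product. The O(1) is the residue at 1/2 itself, bounded uniformly for small
  \<delta>.\<close>

lemma exp_abs_le_sum: "exp (r * \<bar>x\<bar>) \<le> exp (r * x) + exp (- r * x)" for r x :: real
  by (cases "x \<ge> 0") (auto simp: abs_if)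

text \<open>Expand exp ((w - a) l) and integrate termwise. By \<open>exp_abs_le_sum\<close> all
  partial sums of absolute values are dominated by the sum of the two given integrands at the
  abscissae Re a + r and Re a - r, so the whole closed disc of radius r is covered.\<close>

lemma laplace_power_series:
  fixes f :: "'a \<Rightarrow> complex" and l :: "'a \<Rightarrow> real" and a w :: complex
  assumes [measurable]: "f \<in> borel_measurable M" "l \<in> borel_measurable M"
    and i1: "integrable M (\<lambda>x. norm (f x) * exp ((Re a + r) * l x))"
    and i2: "integrable M (\<lambda>x. norm (f x) * exp ((Re a - r) * l x))"
    and w: "norm (w - a) \<le> r" and r0: "r > 0"
  shows "(\<lambda>n. (\<integral>x. f x * exp (a * l x) * of_real (l x) ^ n / fact n \<partial>M) * (w - a) ^ n)
           sums (\<integral>x. f x * exp (w * l x) \<partial>M)"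
    and "integrable M (\<lambda>x. f x * exp (a * l x) * of_real (l x) ^ n / fact n)"
    and "integrable M (\<lambda>x. f x * exp (w * l x))"
proof -
  define g where "g = (\<lambda>v n x. f x * exp (a * l x) * (v * of_real (l x)) ^ n / fact n)"
  define B where "B = (\<lambda>x. norm (f x) * exp ((Re a + r) * l x) + norm (f x) * exp ((Re a - r) * l x))"
  have B: "integrable M B" unfolding B_def by (intro Bochner_Integration.integrable_add i1 i2)
  have ng: "norm (g v n x) = norm (f x) * exp (Re a * l x) * ((norm v * \<bar>l x\<bar>) ^ n / fact n)" for v n x
    by (simp add: g_def norm_mult norm_divide norm_power)
  have sm: "(\<lambda>n. norm (g v n x)) sums (norm (f x) * exp (Re a * l x) * exp (norm v * \<bar>l x\<bar>))" for v :: complex and x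
    unfolding ng by (intro sums_mult) (use exp_converges[of "norm v * \<bar>l x\<bar>"] in \<open>simp add: scaleR_conv_of_real field_simps\<close>)
  have leB: "norm (f x) * exp (Re a * l x) * exp (norm v * \<bar>l x\<bar>) \<le> B x" if "norm v \<le> r" for v :: complex and x
  proof -
    have "exp (norm v * \<bar>l x\<bar>) \<le> exp (r * \<bar>l x\<bar>)" using that by (simp add: mult_right_mono)
    also have "\<dots> \<le> exp (r * l x) + exp (- r * l x)" by (rule exp_abs_le_sum)
    finally have "norm (f x) * exp (Re a * l x) * exp (norm v * \<bar>l x\<bar>)
        \<le> norm (f x) * exp (Re a * l x) * (exp (r * l x) + exp (- r * l x))"
      by (intro mult_left_mono) auto
    also have "\<dots> = B x" by (simp add: B_def algebra_simps exp_add exp_diff exp_minus divide_inverse)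
    finally show ?thesis .
  qed
  have meas [measurable]: "g v n \<in> borel_measurable M" for v n unfolding g_def by measurable
  have psum: "(\<Sum>i\<in>I. norm (g v i x)) \<le> B x" if "finite I" "norm v \<le> r" for v :: complex and I x
  proof -
    have "(\<Sum>i\<in>I. norm (g v i x)) \<le> (\<Sum>n. norm (g v n x))"
      by (intro sum_le_suminf) (use sm that sums_summable in auto)
    also have "\<dots> = norm (f x) * exp (Re a * l x) * exp (norm v * \<bar>l x\<bar>)" using sm sums_unique by metis
    finally show ?thesis using leB[OF that(2)] order_trans by blast
  qed
  have int: "integrable M (g v n)" if "norm v \<le> r" for v n
    by (rule Bochner_Integration.integrable_bound[OF B]) (use psum[of "{n}" v] that in \<open>auto intro!: order_trans[OF _ abs_ge_self]\<close>)
  have summ: "summable (\<lambda>n. \<integral>x. norm (g v n x) \<partial>M)" if "norm v \<le> r" for v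
  proof (rule summableI_nonneg_bounded)
    fix N
    have "(\<Sum>n<N. \<integral>x. norm (g v n x) \<partial>M) = (\<integral>x. (\<Sum>n<N. norm (g v n x)) \<partial>M)"
      by (rule Bochner_Integration.integral_sum[symmetric]) (use int that in auto)
    also have "\<dots> \<le> (\<integral>x. B x \<partial>M)"
      by (intro integral_mono B Bochner_Integration.integrable_sum integrable_norm int psum that) auto
    finally show "(\<Sum>n<N. \<integral>x. norm (g v n x) \<partial>M) \<le> (\<integral>x. B x \<partial>M)" .
  qed auto
  have tot: "(\<Sum>n. g (w - a) n x) = f x * exp (w * l x)" for x
  proof -
    have "(\<lambda>n. f x * exp (a * l x) * (((w - a) * l x) ^ n / fact n)) sums (f x * exp (a * l x) * exp ((w - a) * l x))"
      by (intro sums_mult) (use exp_converges[of "(w - a) * l x"] in \<open>simp add: scaleR_conv_of_real field_simps\<close>)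
    then have "(\<lambda>n. g (w - a) n x) sums (f x * exp (a * l x) * exp ((w - a) * l x))"
      unfolding g_def times_divide_eq_right .
    then show ?thesis by (simp add: sums_unique[symmetric] mult.assoc exp_add[symmetric] algebra_simps flip: sums_unique)
  qed
  have AEs: "AE x in M. summable (\<lambda>n. norm (g v n x))" for v
    using sm sums_summable by blast
  have "(\<lambda>n. \<integral>x. g (w - a) n x \<partial>M) sums (\<integral>x. (\<Sum>n. g (w - a) n x) \<partial>M)"
    by (rule sums_integral[OF int[OF w] AEs summ[OF w]])
  moreover have "(\<integral>x. g (w - a) n x \<partial>M) = (\<integral>x. f x * exp (a * l x) * of_real (l x) ^ n / fact n \<partial>M) * (w - a) ^ n" for n
    unfolding g_def by (subst integral_mult_left_zero[symmetric]) (simp add: power_mult_distrib mult_ac)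
  ultimately show "(\<lambda>n. (\<integral>x. f x * exp (a * l x) * of_real (l x) ^ n / fact n \<partial>M) * (w - a) ^ n)
           sums (\<integral>x. f x * exp (w * l x) \<partial>M)"
    by (simp add: tot)
  show "integrable M (\<lambda>x. f x * exp (w * l x))"
    using integrable_suminf[OF int[OF w] AEs summ[OF w]] by (simp add: tot)
  show "integrable M (\<lambda>x. f x * exp (a * l x) * of_real (l x) ^ n / fact n)"
  proof -
    have "integrable M (\<lambda>x. g (of_real r) n x / of_real r ^ n)"
      using int[of "of_real r" n] r0 by auto
    then show ?thesis using r0 by (simp add: g_def power_mult_distrib mult.assoc)
  qed
qed


lemma power_series_coeffs_unique:
  fixes a b :: "nat \<Rightarrow> complex"
  assumes "r > 0" and "\<And>w. w \<in> ball z r \<Longrightarrow> (\<lambda>n. a n * (w - z) ^ n) sums f w"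
    and "\<And>w. w \<in> ball z r \<Longrightarrow> (\<lambda>n. b n * (w - z) ^ n) sums f w"
  shows "a = b"
proof -
  have ev: "\<forall>\<^sub>F u in nhds 0. z + u \<in> ball z r"
    using assms(1) by (auto simp: eventually_nhds_metric dist_norm intro!: exI[of _ r])
  have s2: "(\<lambda>n. a n * u ^ n) sums f (z + u)" and s3: "(\<lambda>n. b n * u ^ n) sums f (z + u)" if "z + u \<in> ball z r" for u
    using assms(2,3)[OF that] by simp_all
  have 1: "(\<lambda>u. f (z + u)) has_fps_expansion (Abs_fps a)"
    using ev by (intro has_fps_expansionI) (rule eventually_mono[OF ev], simp add: s2)
  have 2: "(\<lambda>u. f (z + u)) has_fps_expansion (Abs_fps b)"
    using ev by (intro has_fps_expansionI) (rule eventually_mono[OF ev], simp add: s3)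
  from arg_cong[OF fps_expansion_unique_complex[OF 1 2], of fps_nth] show ?thesis
    by (simp add: fun_eq_iff)
qed

lemma laplace_holomorphic:
  fixes f :: "'a \<Rightarrow> complex" and l :: "'a \<Rightarrow> real" and I :: "real set"
  assumes [measurable]: "f \<in> borel_measurable M" "l \<in> borel_measurable M"
    and I: "open I" and int: "\<And>\<sigma>. \<sigma> \<in> I \<Longrightarrow> integrable M (\<lambda>x. norm (f x) * exp (\<sigma> * l x))"
  shows "(\<lambda>s. \<integral>x. f x * exp (s * l x) \<partial>M) holomorphic_on {s. Re s \<in> I}"
proof -
  let ?L = "\<lambda>s::complex. \<integral>x. f x * exp (s * l x) \<partial>M"
  have "?L field_differentiable (at a)" if "Re a \<in> I" for a
  proof -
    obtain r where r: "r > 0" "cball (Re a) r \<subseteq> I"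
      using open_contains_cball[THEN iffD1, OF I, rule_format, OF \<open>Re a \<in> I\<close>] by blast
    have rI: "Re a + r \<in> I" "Re a - r \<in> I" using r by (auto simp: subset_iff dist_norm)
    have "?L holomorphic_on ball a r"
    proof (rule power_series_holomorphic)
      fix w assume "w \<in> ball a r"
      then show "(\<lambda>n. (\<integral>x. f x * exp (a * l x) * of_real (l x) ^ n / fact n \<partial>M) * (w - a) ^ n) sums ?L w"
        by (intro laplace_power_series(1)[where r = r] int rI) (use r in \<open>auto simp: dist_norm norm_minus_commute\<close>)
    qed
    then show ?thesis using r
      by (intro holomorphic_on_imp_differentiable_at[of _ "ball a r"]) auto
  qed
  then show ?thesis by (simp add: holomorphic_on_def field_differentiable_at_within)
qed

text \<open>With the identity stated as L D = N rather than L = N / D, only the real zeros of D have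
  to be excluded. If the abscissa of convergence c exceeded \<open>\<sigma>\<^sub>0\<close>, then N
  / D would be holomorphic near c, and its Taylor series at a point a right of c would converge at
  some real x left of c. Since l \<le> 0, the Taylor terms at x < a are integrals of nonnegative
  functions, so convergence of the series forces integrability at x.\<close>

theorem landau_laplace:
  fixes f l :: "'a \<Rightarrow> real" and D N :: "complex \<Rightarrow> complex" and \<sigma>\<^sub>0 \<sigma>\<^sub>1 :: real
  assumes [measurable]: "f \<in> borel_measurable M" "l \<in> borel_measurable M"
    and f: "\<And>x. f x \<ge> 0" and l: "\<And>x. l x \<le> 0"
    and int: "\<And>\<sigma>. \<sigma> > \<sigma>\<^sub>1 \<Longrightarrow> integrable M (\<lambda>x. f x * exp (\<sigma> * l x))"
    and D: "D holomorphic_on {s. Re s > \<sigma>\<^sub>0}" and N: "N holomorphic_on {s. Re s > \<sigma>\<^sub>0}"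
    and D0: "\<And>x::real. x > \<sigma>\<^sub>0 \<Longrightarrow> D (of_real x) \<noteq> 0"
    and eq: "\<And>s. Re s > \<sigma>\<^sub>1 \<Longrightarrow> (\<integral>x. of_real (f x) * exp (s * l x) \<partial>M) * D s = N s"
  shows "\<And>\<sigma>. \<sigma> > \<sigma>\<^sub>0 \<Longrightarrow> integrable M (\<lambda>x. f x * exp (\<sigma> * l x))"
    and "\<And>s. Re s > \<sigma>\<^sub>0 \<Longrightarrow> (\<integral>x. of_real (f x) * exp (s * l x) \<partial>M) * D s = N s"
proof -
  define L where "L = (\<lambda>s::complex. \<integral>x. of_real (f x) * exp (s * l x) \<partial>M)"
  define S where "S = {\<sigma>. \<sigma> > \<sigma>\<^sub>0 \<and> integrable M (\<lambda>x. f x * exp (\<sigma> * l x))}"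
  have up: "b \<in> S" if "a \<in> S" "a \<le> b" for a b
  proof -
    have "norm (f x * exp (b * l x)) \<le> norm (f x * exp (a * l x))" for x
      using f[of x] mult_right_mono_neg[OF that(2) l[of x]] by (simp add: mult_left_mono)
    then show ?thesis using that unfolding S_def
      by (auto intro!: Bochner_Integration.integrable_bound[where g = "\<lambda>x. f x * exp (b * l x)" and f = "\<lambda>x. f x * exp (a * l x)"])
  qed
  have fi: "integrable M (\<lambda>x. norm (of_real (f x) :: complex) * exp (\<sigma> * l x))" if "\<sigma> \<in> S" for \<sigma>
    using that f by (simp add: S_def)
  have hol: "L holomorphic_on {s. Re s \<in> {c<..}}" if "\<And>\<sigma>. \<sigma> > c \<Longrightarrow> \<sigma> \<in> S" for c
    unfolding L_def by (rule laplace_holomorphic) (use that fi in auto)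
  have LD: "L s * D s = N s" if c: "\<And>\<sigma>. \<sigma> > c \<Longrightarrow> \<sigma> \<in> S" "Re s > c" "c \<ge> \<sigma>\<^sub>0" for c s
  proof (rule analytic_continuation_open[of "{s. Re s > max c \<sigma>\<^sub>1}" "{s. Re s > c}" "\<lambda>s. L s * D s" N])
    show "{s. Re s > max c \<sigma>\<^sub>1} \<noteq> {}"
      using gt_ex[of "max c \<sigma>\<^sub>1"] by (metis Re_complex_of_real empty_iff mem_Collect_eq)
    show "connected {s. Re s > c}" by (intro convex_connected convex_halfspace_Re_gt)
    show "(\<lambda>s. L s * D s) holomorphic_on {s. Re s > c}"
      using hol[OF c(1)] by (intro holomorphic_intros holomorphic_on_subset[OF D]) (use c in auto)
    show "N holomorphic_on {s. Re s > c}"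
      by (rule holomorphic_on_subset[OF N]) (use c in auto)
    show "L z * D z = N z" if "z \<in> {s. Re s > max c \<sigma>\<^sub>1}" for z
      using eq[of z] that by (simp add: L_def)
  qed (use c in \<open>auto intro: open_halfspace_Re_gt open_Collect_conj\<close>)
  have all: "\<sigma> \<in> S" if "\<sigma> > \<sigma>\<^sub>0" for \<sigma>
  proof (rule ccontr)
    assume nS: "\<sigma> \<notin> S"
    define c where "c = Inf S"
    have ne: "S \<noteq> {}" using int[of "max \<sigma>\<^sub>0 \<sigma>\<^sub>1 + 1"] by (auto simp: S_def intro!: exI[of _ "max \<sigma>\<^sub>0 \<sigma>\<^sub>1 + 1"])
    have lb: "\<sigma> \<le> a" if "a \<in> S" for a using up[OF that, of \<sigma>] nS by linarith
    then have "\<sigma> \<le> c" unfolding c_def using ne cInf_greatest by blast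
    with that have c: "c > \<sigma>\<^sub>0" by simp
    have bb: "bdd_below S" using lb by (auto simp: bdd_below_def)
    have inS: "a \<in> S" if "a > c" for a
      using that up cInf_less_iff[OF ne bb, of a] unfolding c_def by (meson less_imp_le)
    have "continuous (at (of_real c)) D"
      using D c holomorphic_on_imp_continuous_on[of D] continuous_on_eq_continuous_at[OF open_halfspace_Re_gt]
      by (metis Re_complex_of_real mem_Collect_eq)
    then obtain e0 where e0: "e0 > 0" "\<And>y. dist (of_real c) y < e0 \<Longrightarrow> D y \<noteq> 0"
      using continuous_at_avoid[of "of_real c" D 0] D0[OF c] by blast
    define e where "e = min e0 (c - \<sigma>\<^sub>0)"
    have e: "e > 0" "e \<le> c - \<sigma>\<^sub>0" "e \<le> e0" using e0 c by (auto simp: e_def)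
    define h where "h = (\<lambda>s. N s / D s)"
    have sub: "Re s > \<sigma>\<^sub>0" "D s \<noteq> 0" if "s \<in> ball (of_real c) e" for s
    proof -
      have "\<bar>Re (of_real c - s)\<bar> < e"
        using that abs_Re_le_cmod[of "of_real c - s"] by (simp add: dist_norm)
      then show "Re s > \<sigma>\<^sub>0" using e by (simp add: abs_if split: if_splits)
      show "D s \<noteq> 0" using that e by (intro e0) simp
    qed
    have h: "h holomorphic_on ball (of_real c) e" unfolding h_def
      by (intro holomorphic_intros holomorphic_on_subset[OF N] holomorphic_on_subset[OF D]) (use sub in auto)
    \<comment> \<open>The disc of radius 2e/3 about a lies in the disc of radius e about c and
      contains the later point x = c - e/4, since 7e/12 < 2e/3. The choice r = e/6 keeps a - r above
      c.\<close>
    define a where "a = c + e / 3"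
    define r where "r = e / 6"
    have ball_sub: "ball (of_real a) (2 * e / 3) \<subseteq> ball (of_real c :: complex) e"
      unfolding a_def using e by (intro ball_subset_ball_iff[THEN iffD2] disjI1) (unfold dist_of_real, simp add: dist_real_def)
    have ha: "h holomorphic_on ball (of_real a) (2 * e / 3)"
      using h ball_sub holomorphic_on_subset by blast
    have r: "r > 0" "a + r \<in> S" "a - r \<in> S" using e by (auto simp: r_def a_def intro!: inS)
    define m where "m = (\<lambda>n. \<integral>x. complex_of_real (f x) * exp (complex_of_real a * l x) * complex_of_real (l x) ^ n / fact n \<partial>M)"
    have sums1: "(\<lambda>n. m n * (w - of_real a) ^ n) sums L w" if "w \<in> ball (of_real a) r" for w
      unfolding m_def L_def
      by (rule laplace_power_series(1)[where r = r]) (use r that fi in \<open>auto simp: dist_norm norm_minus_commute\<close>)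
    have sums2: "(\<lambda>n. (deriv ^^ n) h (of_real a) / fact n * (w - of_real a) ^ n) sums h w" if "w \<in> ball (of_real a) (2 * e / 3)" for w
      by (rule holomorphic_power_series[OF ha that])
    have "L w = h w" if "w \<in> ball (of_real a) r" for w
    proof -
      have "w \<in> ball (of_real a) (2 * e / 3)" using that e by (simp add: r_def)
      then have w: "w \<in> ball (of_real c) e" using ball_sub by blast
      have "\<bar>Re (of_real a - w)\<bar> < r"
        using that abs_Re_le_cmod[of "of_real a - w"] by (simp add: dist_norm)
      then have "Re w > c" using e by (simp add: a_def r_def abs_if split: if_splits)
      then have "L w * D w = N w" using LD[of c w] inS c by simp
      then show ?thesis using sub[OF w] by (simp add: h_def field_simps)
    qed
    then have m_eq: "m = (\<lambda>n. (deriv ^^ n) h (of_real a) / fact n)"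
      by (intro power_series_coeffs_unique[of r "of_real a" _ L])
         (use sums1 sums2 r e in \<open>force simp: r_def\<close>)+
    define x where "x = c - e / 4"
    have "complex_of_real x \<in> ball (of_real a) (2 * e / 3)"
      using e by (unfold mem_ball dist_of_real, simp add: x_def a_def dist_real_def)
    from sums2[OF this] have sm: "summable (\<lambda>n. m n * (of_real x - of_real a) ^ n)"
      unfolding m_eq by (rule sums_summable)
    define g where "g = (\<lambda>n y. f y * exp (a * l y) * ((x - a) * l y) ^ n / fact n)"
    have xa: "x \<le> a" using e by (simp add: x_def a_def)
    have "(x - a) * l y \<ge> 0" for y
      by (rule mult_nonpos_nonpos) (use xa l in auto)
    then have g0: "g n y \<ge> 0" for n y
      unfolding g_def
      by (rule divide_nonneg_nonneg[OF mult_nonneg_nonneg[OF mult_nonneg_nonneg[OF f exp_ge_zero] zero_le_power]]) auto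
    have gm: "of_real (g n y) = (of_real x - of_real a) ^ n * (complex_of_real (f y) * exp (complex_of_real a * l y) * complex_of_real (l y) ^ n / fact n)" for n y
      by (simp add: g_def power_mult_distrib exp_of_real[symmetric])
    have ci: "complex_integrable M (\<lambda>y. complex_of_real (f y) * exp (complex_of_real a * l y) * complex_of_real (l y) ^ n / fact n)" for n
      by (rule laplace_power_series(2)[where r = r and w = "of_real a"]) (use r fi in auto)
    have gi: "integrable M (g n)" for n
      unfolding complex_of_real_integrable_eq[symmetric] gm by (intro integrable_mult_right ci)
    have "of_real (\<integral>y. g n y \<partial>M) = m n * (of_real x - of_real a) ^ n" for n
      unfolding integral_complex_of_real[symmetric] gm m_def by (subst integral_mult_right_zero) simp
    then have "summable (\<lambda>n. complex_of_real (\<integral>y. g n y \<partial>M))" using sm by simp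
    then have sm': "summable (\<lambda>n. \<integral>y. norm (g n y) \<partial>M)"
      using g0 by (simp add: summable_of_real_iff)
    have tot: "(\<lambda>n. g n y) sums (f y * exp (x * l y))" for y
    proof -
      have "(\<lambda>n. f y * exp (a * l y) * (((x - a) * l y) ^ n / fact n)) sums (f y * exp (a * l y) * exp ((x - a) * l y))"
        by (intro sums_mult) (use exp_converges[of "(x - a) * l y"] in \<open>simp add: scaleR_conv_of_real field_simps\<close>)
      then show ?thesis unfolding g_def by (simp add: mult.assoc algebra_simps flip: exp_add)
    qed
    have "integrable M (\<lambda>y. \<Sum>n. g n y)"
      by (rule integrable_suminf[OF gi _ sm']) (simp add: g0 sums_summable[OF tot])
    then have "x \<in> S" using e sums_unique[OF tot] by (simp add: S_def x_def)
    then have "c \<le> x" unfolding c_def using bb cInf_lower by blast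
    then show False using e by (simp add: x_def)
  qed
  then show "\<And>\<sigma>. \<sigma> > \<sigma>\<^sub>0 \<Longrightarrow> integrable M (\<lambda>x. f x * exp (\<sigma> * l x))" by (simp add: S_def)
  show "\<And>s. Re s > \<sigma>\<^sub>0 \<Longrightarrow> (\<integral>x. of_real (f x) * exp (s * l x) \<partial>M) * D s = N s"
    using LD[of \<sigma>\<^sub>0] all unfolding L_def by blast
qed


section \<open>The Moebius function and the zeta function to the right of 1\<close>

lemma moebius_mu_mult_prime:
  assumes "prime p" "\<not> p dvd e"
  shows "moebius_mu (p * e) = - moebius_mu e"
proof -
  have e0: "e \<noteq> 0" using assms by (metis dvd_0_right)
  have p0: "p \<noteq> 0" using assms by auto
  have cop: "coprime p e" using assms by (simp add: prime_imp_coprime)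
  have sq: "squarefree (p * e) \<longleftrightarrow> squarefree e"
    using squarefree_mult_coprime[OF cop] squarefree_prime[OF assms(1)] squarefree_multD(2) by blast
  have "prime_factors (p * e) = insert p (prime_factors e)"
    using e0 p0 assms by (auto simp: prime_factors_product prime_prime_factors)
  moreover have "p \<notin> prime_factors e" using assms by auto
  ultimately have "card (prime_factors (p * e)) = Suc (card (prime_factors e))" by simp
  then show ?thesis by (simp add: moebius_mu_def sq)
qed

lemma moebius_mu_nonzero_dvd:
  assumes "moebius_mu (p * e) \<noteq> 0" "prime p"
  shows "\<not> p dvd e"
proof
  assume "p dvd e"
  then have "p\<^sup>2 dvd p * e" by (simp add: power2_eq_square)
  moreover have "squarefree (p * e)" using assms by (auto simp: moebius_mu_def split: if_splits)
  ultimately have "p dvd 1" using squarefreeD by blast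
  then show False using assms by simp
qed

text \<open>For k > 1 fix a prime p dividing k. Divisors d prime to p cancel against p d, and every
  remaining divisor is divisible by the square of p, where \<mu> vanishes.\<close>

lemma sum_moebius_mu_divisors:
  assumes "k > 0"
  shows "(\<Sum>d | d dvd k. moebius_mu d) = (if k = 1 then 1 else 0)"
proof (cases "k = 1")
  case True
  then have "{d. d dvd k} = {1}" by auto
  then show ?thesis using True by (simp add: moebius_mu_def)
next
  case False
  then obtain p where p: "prime p" "p dvd k" using prime_factor_nat by blast
  define A where "A = {d. d dvd k \<and> \<not> p dvd d}"
  have fin: "finite {d. d dvd k}" using assms by simp
  have "(\<Sum>d | d dvd k. moebius_mu d) = sum moebius_mu (A \<union> (\<lambda>e. p * e) ` A)"
  proof (rule sum.mono_neutral_right[OF fin])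
    have "p * e dvd k" if "e \<in> A" for e
      using that p by (auto simp: A_def intro!: divides_mult prime_imp_coprime)
    then show "A \<union> (\<lambda>e. p * e) ` A \<subseteq> {d. d dvd k}" by (auto simp: A_def)
    show "\<forall>i\<in>{d. d dvd k} - (A \<union> (\<lambda>e. p * e) ` A). moebius_mu i = 0"
    proof (rule ballI, rule ccontr)
      fix i assume i: "i \<in> {d. d dvd k} - (A \<union> (\<lambda>e. p * e) ` A)" and m: "moebius_mu i \<noteq> 0"
      then obtain e where e: "i = p * e" by (auto simp: A_def)
      then have "\<not> p dvd e" using moebius_mu_nonzero_dvd m p by blast
      moreover have "e dvd k" using i e dvd_mult_right by blast
      ultimately show False using i e by (auto simp: A_def)
    qed
  qed
  also have "\<dots> = sum moebius_mu A + sum moebius_mu ((\<lambda>e. p * e) ` A)"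
    by (rule sum.union_disjoint) (use fin in \<open>auto simp: A_def\<close>)
  also have "sum moebius_mu ((\<lambda>e. p * e) ` A) = (\<Sum>e\<in>A. moebius_mu (p * e))"
    by (subst sum.reindex) (use p in \<open>auto simp: inj_on_def\<close>)
  also have "\<dots> = - sum moebius_mu A"
    unfolding sum_negf[symmetric] by (intro sum.cong refl moebius_mu_mult_prime p) (simp add: A_def)
  finally show ?thesis using False by simp
qed

lemma abs_moebius_mu_le: "\<bar>moebius_mu n\<bar> \<le> 1"
  by (simp add: moebius_mu_def)

lemma has_sum_Suc: "(f has_sum S) {0<..} \<longleftrightarrow> ((\<lambda>n. f (Suc n)) has_sum S) UNIV"
proof -
  have "{0<..} = range Suc" using gr0_implies_Suc by (auto simp: image_iff)
  then show ?thesis using has_sum_reindex[of Suc UNIV f S] by (simp add: o_def)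
qed

lemma summable_Suc_powr: "Re s > 1 \<Longrightarrow> summable (\<lambda>n. norm (of_nat (Suc n) powr (- s) :: complex))"
  unfolding norm_Suc_powr by (rule summable_shift_powr) simp

lemma zeta_has_sum:
  assumes "Re s > 1"
  shows "((\<lambda>n. of_nat n powr (- s)) has_sum zeta s) {0<..}"
  unfolding has_sum_Suc using zeta_sums[OF assms] summable_Suc_powr[OF assms]
  by (intro norm_summable_imp_has_sum) (simp_all add: powr_minus_divide)

lemma moebius_series_abs_summable:
  assumes "Re s > 1"
  shows "summable (\<lambda>n. norm (of_real (moebius_mu (Suc n)) * of_nat (Suc n) powr (- s) :: complex))"
  by (rule summable_comparison_test'[OF summable_Suc_powr[OF assms]])
     (use abs_moebius_mu_le in \<open>simp add: norm_mult mult_left_le_one_le\<close>)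

definition moebius_series :: "complex \<Rightarrow> complex" where
  "moebius_series s = (\<Sum>n. of_real (moebius_mu (Suc n)) * of_nat (Suc n) powr (- s))"

text \<open>The double series over (n, m) converges absolutely and is regrouped along k = n m. The
  power of k is constant on each group, so the inner sum is the divisor sum of \<mu>, which leaves
  just k = 1.\<close>

lemma moebius_series_mult_zeta:
  assumes s: "Re s > 1"
  shows "moebius_series s * zeta s = 1"
proof -
  define a where "a = (\<lambda>n. of_real (moebius_mu n) * of_nat n powr (- s) :: complex)"
  define b where "b = (\<lambda>n. of_nat n powr (- s) :: complex)"
  have sa: "(a has_sum moebius_series s) {0<..}"
    unfolding has_sum_Suc a_def moebius_series_def
    by (intro norm_summable_imp_has_sum moebius_series_abs_summable s summable_sums
          summable_norm_cancel[OF moebius_series_abs_summable[OF s]])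
  have sb: "(b has_sum zeta s) {0<..}" unfolding b_def by (rule zeta_has_sum[OF s])
  have na: "(\<lambda>n. norm (a n)) summable_on {0<..}" and nb: "(\<lambda>n. norm (b n)) summable_on {0<..}"
    using sa sb summable_on_iff_abs_summable_on_complex summable_on_def by blast+
  have sum2: "(\<lambda>(n, m). a n * b m) summable_on {0<..} \<times> {0<..}"
  proof -
    have "(\<lambda>p. norm (case p of (n, m) \<Rightarrow> a n * b m)) summable_on ({0<..} \<times> {0<..})"
      unfolding Infinite_Sum.abs_summable_on_Sigma_iff
      using na nb by (auto simp: norm_mult abs_mult infsum_cmult_right' intro!: summable_on_cmult_right summable_on_cmult_left)
    then show ?thesis by (rule abs_summable_summable)
  qed
  have 1: "((\<lambda>(n, m). a n * b m) has_sum moebius_series s * zeta s) ({0<..} \<times> {0<..})"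
    by (rule has_sum_SigmaI[where g = "\<lambda>n. a n * zeta s", OF _ _ sum2])
       (use sa sb in \<open>auto intro: has_sum_cmult_left has_sum_cmult_right\<close>)
  have bij: "bij_betw (\<lambda>(k, d). (d, k div d)) (Sigma {0<..} (\<lambda>k. {d. d dvd k})) ({0<..} \<times> {0::nat<..})"
    by (rule bij_betwI[where g = "\<lambda>(n, m). (n * m, n)"]) (auto intro: Nat.gr0I elim!: dvdE)
  have "((\<lambda>(k, d). of_real (moebius_mu d) * of_nat k powr (- s)) has_sum moebius_series s * zeta s)
          (Sigma {0<..} (\<lambda>k. {d. d dvd k}))"
  proof (rule has_sum_cong[THEN iffD2, OF _ has_sum_reindex_bij_betw[OF bij, THEN iffD2, OF 1]])
    fix x :: "nat \<times> nat" assume x: "x \<in> Sigma {0<..} (\<lambda>k. {d. d dvd k})"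
    obtain k d where kd: "x = (k, d)" by (cases x)
    then obtain m where "k = d * m" "k > 0" using x by auto
    then have m: "k = d * m" "d > 0" "m > 0" by (auto intro: Nat.gr0I)
    have "of_nat d powr (- s) * of_nat m powr (- s) = (of_nat k powr (- s) :: complex)"
      unfolding m(1) of_nat_mult using m by (subst powr_times_real) auto
    then show "(case x of (k, d) \<Rightarrow> complex_of_real (moebius_mu d) * of_nat k powr - s)
      = (case case x of (k, d) \<Rightarrow> (d, k div d) of (n, m) \<Rightarrow> a n * b m)"
      using m by (simp add: kd a_def b_def)
  qed
  then have "((\<lambda>k::nat. if k = 1 then 1 else 0) has_sum moebius_series s * zeta s) {0<..}"
  proof (rule has_sum_SigmaD)
    fix k :: nat assume "k \<in> {0<..}"
    then have k: "k > 0" "finite {d. d dvd k}" by auto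
    have "(\<Sum>d | d dvd k. complex_of_real (moebius_mu d) * of_nat k powr (- s))
        = of_real (\<Sum>d | d dvd k. moebius_mu d) * of_nat k powr (- s)"
      by (simp add: sum_distrib_right)
    also have "\<dots> = (if k = 1 then 1 else 0 :: complex)" unfolding sum_moebius_mu_divisors[OF k(1)] by simp
    finally have tot: "(\<Sum>d | d dvd k. complex_of_real (moebius_mu d) * of_nat k powr (- s)) = (if k = 1 then 1 else 0)" .
    show "((\<lambda>y. case (k, y) of (k, d) \<Rightarrow> complex_of_real (moebius_mu d) * of_nat k powr - s) has_sum
          (if k = 1 then 1 else 0)) {d. d dvd k}"
      by (intro has_sum_finiteI k(2)) (simp add: tot)
  qed
  moreover have "((\<lambda>k. if k = 1 then 1 else 0 :: complex) has_sum 1) {0::nat<..}"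
    by (rule has_sum_finite_neutralI[of "{1}"]) auto
  ultimately show ?thesis by (rule has_sum_unique)
qed

lemma zeta_nonzero: "Re s > 1 \<Longrightarrow> zeta s \<noteq> 0"
  using moebius_series_mult_zeta[of s] by auto

lemma moebius_series_eq: "Re s > 1 \<Longrightarrow> moebius_series s = 1 / zeta s"
  using moebius_series_mult_zeta[of s] zeta_nonzero[of s] by (simp add: field_simps)

lemma norm_inverse_zeta_le:
  assumes "b > 1"
  obtains B where "B > 0" "\<And>s. Re s \<ge> b \<Longrightarrow> norm (1 / zeta s) \<le> B"
proof
  show "(\<Sum>n. real (Suc n) powr (- b)) + 1 > 0"
    by (intro add_nonneg_pos suminf_nonneg summable_shift_powr) (use assms in auto)
  fix s assume s: "Re s \<ge> b"
  then have s1: "Re s > 1" using assms by simp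
  have "norm (moebius_series s) \<le> (\<Sum>n. real (Suc n) powr (- b))"
    unfolding moebius_series_def
  proof (rule norm_suminf_le)
    fix n
    have "norm (of_real (moebius_mu (Suc n)) * of_nat (Suc n) powr (- s) :: complex) \<le> 1 * real (Suc n) powr (- Re s)"
      unfolding norm_mult norm_Suc_powr using abs_moebius_mu_le by (intro mult_mono) auto
    also have "\<dots> \<le> real (Suc n) powr (- b)" using s by (simp add: powr_mono)
    finally show "norm (of_real (moebius_mu (Suc n)) * of_nat (Suc n) powr (- s) :: complex) \<le> real (Suc n) powr (- b)" .
  qed (use assms in \<open>intro summable_shift_powr, simp\<close>)
  then show "norm (1 / zeta s) \<le> (\<Sum>n. real (Suc n) powr (- b)) + 1"
    by (simp only: moebius_series_eq[OF s1])
qed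

text \<open>For n \<ge> 2, n^(-4) \<le> n^(-2) / 4, so the distance of \<zeta> from 1 is at most
  (pi^2/6 - 1) / 4 \<le> 1/5, and (1/5) / (4/5) = 1/4. Hence 1/\<zeta> has real part at least 3/4 on
  the right edge of the contour.\<close>

lemma zeta_Re_4:
  assumes "Re s = 4" shows "norm (1 / zeta s - 1) \<le> 1 / 4"
proof -
  have "(\<lambda>n. of_nat (Suc n) powr (- s) :: complex) sums zeta s"
    using zeta_sums[of s] assms by (simp add: powr_minus_divide)
  then have s1: "(\<lambda>n. of_nat (Suc (Suc n)) powr (- s) :: complex) sums (zeta s - 1)"
    using sums_Suc_iff[of "\<lambda>n. of_nat (Suc n) powr (- s) :: complex" "zeta s - 1"] by simp
  have "(\<lambda>n. 1 / (real (Suc n))\<^sup>2) sums (pi\<^sup>2 / 6)" using inverse_squares_sums by simp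
  then have "(\<lambda>n. 1 / (real (Suc (Suc n)))\<^sup>2) sums (pi\<^sup>2 / 6 - 1)"
    using sums_Suc_iff[of "\<lambda>n. 1 / (real (Suc n))\<^sup>2" "pi\<^sup>2 / 6 - 1"] by simp
  then have s2: "(\<lambda>n. (1/4) * (1 / (real (Suc (Suc n)))\<^sup>2)) sums ((1/4) * (pi\<^sup>2 / 6 - 1))"
    by (rule sums_mult)
  have "norm (zeta s - 1) = norm (\<Sum>n. of_nat (Suc (Suc n)) powr (- s) :: complex)"
    using s1 sums_unique by metis
  also have "\<dots> \<le> (\<Sum>n. (1/4) * (1 / (real (Suc (Suc n)))\<^sup>2))"
  proof (rule norm_suminf_le)
    fix n
    have "norm (of_nat (Suc (Suc n)) powr (- s) :: complex) = 1 / real (Suc (Suc n)) ^ 4"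
      unfolding norm_Suc_powr using assms by (simp add: powr_minus_divide powr_numeral del: of_nat_Suc)
    also have "\<dots> = 1 / (real (Suc (Suc n)))\<^sup>2 * (1 / (real (Suc (Suc n)))\<^sup>2)"
      by (simp add: power2_eq_square power4_eq_xxxx del: of_nat_Suc)
    also have "\<dots> \<le> (1/4) * (1 / (real (Suc (Suc n)))\<^sup>2)"
    proof (rule mult_right_mono)
      have "(2::real)\<^sup>2 \<le> (real (Suc (Suc n)))\<^sup>2" by (intro power_mono) auto
      then show "1 / (real (Suc (Suc n)))\<^sup>2 \<le> 1 / 4" by (simp add: field_simps)
    qed simp
    finally show "norm (of_nat (Suc (Suc n)) powr (- s) :: complex) \<le> (1/4) * (1 / (real (Suc (Suc n)))\<^sup>2)" .
  qed (use s2 sums_summable in blast)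
  also have "\<dots> = (1/4) * (pi\<^sup>2 / 6 - 1)" using s2 sums_unique by metis
  also have "\<dots> \<le> 1 / 5"
  proof -
    have "pi * pi \<le> (16/5) * (16/5)"
      using pi_approx by (intro mult_mono) auto
    then show ?thesis by (simp add: power2_eq_square)
  qed
  finally have z: "norm (zeta s - 1) \<le> 1 / 5" .
  have "1 - 1/5 \<le> norm (zeta s)"
    using norm_triangle_ineq2[of 1 "1 - zeta s"] z by (simp add: norm_minus_commute)
  moreover have "zeta s \<noteq> 0" using zeta_nonzero[of s] assms by simp
  moreover from this have "norm (1 / zeta s - 1) = norm (zeta s - 1) / norm (zeta s)"
    by (simp add: norm_divide[symmetric] norm_minus_commute diff_divide_distrib)
  moreover have "norm (zeta s - 1) / norm (zeta s) \<le> (1/5) / (1 - 1/5)"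
    using z calculation(1) by (intro frac_le) auto
  ultimately show ?thesis by simp
qed

text \<open>\<open>zeta\<close> has an unspecified value at its pole. This entire function carries
  the same information and has a definite value, the residue, at 1.\<close>

definition zeta_reg :: "complex \<Rightarrow> complex" where
  "zeta_reg s = (if s = 1 then 1 else (s - 1) * zeta s)"

lemma zeta_reg_holomorphic: "zeta_reg holomorphic_on A"
proof -
  obtain G where G: "G holomorphic_on UNIV" "\<And>s. Re s > 1 \<Longrightarrow> G s = (s - 1) * zeta0 s"
    using zeta_entire by blast
  have z0: "(\<lambda>n. 1 / of_nat (Suc n) powr s) sums zeta0 s" if "Re s > 1" for s :: complex
    using summable_sums[OF zeta_summable[OF that]] by (simp add: zeta0_def powr_minus_divide)
  have "zeta s = G s / (s - 1)" if "s \<noteq> 1" for s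
  proof (rule zeta_unique)
    show "(\<lambda>s. G s / (s - 1)) holomorphic_on - {1}"
      by (intro holomorphic_intros holomorphic_on_subset[OF G(1)]) auto
    show "(\<lambda>n. 1 / of_nat (Suc n) powr s) sums (G s / (s - 1))" if "Re s > 1" for s
    proof -
      have "s \<noteq> 1" using that by auto
      then show ?thesis using z0[OF that] G(2)[OF that] by simp
    qed
  qed (use that in auto)
  moreover have "G 1 = 1"
  proof -
    \<comment> \<open>The recursion \<open>zeta0_rec\<close> with K = 1 has an empty correction sum,
      so it represents (s - 1) \<zeta>(s) for Re s > 0. At s = 1 each remainder vanishes: both
      leading powers have exponent 0, and the coefficient 1 - s is 0. This gives the residue
      1.\<close>
    define H where "H = (\<lambda>s. 1 + (\<Sum>n. zeta_rem 1 n s))"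
    have "G 1 = H 1"
    proof (rule analytic_continuation_open[of "{s. Re s > 1}" "{s. Re s > 0}" G H])
      show "{s. Re s > 1} \<noteq> {}" by (auto intro!: exI[of _ "2 :: complex"])
      show "connected {s. 0 < Re s}" by (intro convex_connected convex_halfspace_Re_gt)
      show "H holomorphic_on {s. Re s > 0}"
        unfolding H_def using zeta_rem_series(1)[of 1] by (intro holomorphic_intros) auto
      show "G z = H z" if "z \<in> {s. Re s > 1}" for z
        using that G(2)[of z] zeta0_rec[of z 1] by (simp add: H_def)
    qed (auto intro: open_halfspace_Re_gt holomorphic_on_subset[OF G(1)])
    moreover have "zeta_rem 1 n 1 = 0" for n
      using of_nat_neq_0[of n] of_nat_neq_0[of "Suc n"] by (simp add: zeta_rem_def zeta_coeff_def del: of_nat_Suc)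
    ultimately show ?thesis by (simp add: H_def)
  qed
  ultimately have "zeta_reg = G" by (auto simp: zeta_reg_def fun_eq_iff)
  then show ?thesis using G(1) holomorphic_on_subset by blast
qed


section \<open>Estimates for the Gamma function\<close>

text \<open>On this line conjugation is z \<mapsto> 1 - z, so the squared modulus is \<Gamma>(z)
  \<Gamma>(1 - z) and the reflection formula applies.\<close>

lemma cmod_Gamma_half: "(cmod (Gamma (Complex (1/2) y)))\<^sup>2 = pi / cosh (pi * y)"
proof -
  let ?z = "Complex (1/2) y"
  have "cnj ?z = 1 - ?z" by (simp add: complex_eq_iff)
  then have "Gamma (1 - ?z) = cnj (Gamma ?z)" using cnj_Gamma by metis
  then have "of_real ((cmod (Gamma ?z))\<^sup>2) = Gamma ?z * Gamma (1 - ?z)"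
    by (simp only: complex_norm_square)
  also have "\<dots> = of_real pi / sin (of_real pi * ?z)" by (rule Gamma_reflection_complex)
  also have "sin (of_real pi * ?z) = cos (\<i> * of_real (pi * y))"
  proof -
    have "of_real pi * ?z = of_real pi / 2 + \<i> * of_real (pi * y)"
      by (simp add: complex_eq_iff)
    then show ?thesis by (simp add: sin_add)
  qed
  also have "\<dots> = of_real (cosh (pi * y))"
  proof -
    have "\<i> * (\<i> * of_real (pi * y)) = of_real (- (pi * y))" "- (\<i> * (\<i> * of_real (pi * y))) = of_real (pi * y)"
      by (simp_all add: mult.assoc[symmetric])
    then show ?thesis unfolding cos_exp_eq by (simp only: exp_of_real cosh_def) simp
  qed
  finally have "complex_of_real ((cmod (Gamma ?z))\<^sup>2) = of_real (pi / cosh (pi * y))" by simp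
  then show ?thesis by (simp only: of_real_eq_iff)
qed

lemma Gamma_quotient_LIMSEQ:
  fixes z w :: complex
  assumes "w \<notin> \<int>\<^sub>\<le>\<^sub>0"
  shows "(\<lambda>n. exp ((z - w) * of_real (ln (real n))) * (\<Prod>k\<le>n. (w + of_nat k) / (z + of_nat k))) \<longlonglongrightarrow> Gamma z / Gamma w"
proof -
  have "(\<lambda>n. Gamma_series z n / Gamma_series w n) \<longlonglongrightarrow> Gamma z / Gamma w"
    by (intro tendsto_intros) (use assms in \<open>auto simp: Gamma_eq_zero_iff\<close>)
  moreover have "Gamma_series z n / Gamma_series w n =
      exp ((z - w) * of_real (ln (real n))) * (\<Prod>k\<le>n. (w + of_nat k) / (z + of_nat k))" for n
    by (simp add: Gamma_series_def pochhammer_Suc_prod atLeast0AtMost prod_dividef exp_diff left_diff_distrib field_simps)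
  ultimately show ?thesis by simp
qed

lemma not_nonpos_Int_Re_pos: "Re z > 0 \<Longrightarrow> z \<notin> \<int>\<^sub>\<le>\<^sub>0"
  by (auto simp: nonpos_Ints_def)

lemma cmod_Gamma_quotient_LIMSEQ:
  fixes z w :: complex
  assumes "Re w > 0"
  shows "(\<lambda>n. exp (Re (z - w) * ln (real n)) * (\<Prod>k\<le>n. cmod (w + of_nat k) / cmod (z + of_nat k)))
           \<longlonglongrightarrow> cmod (Gamma z) / cmod (Gamma w)"
  using tendsto_norm[OF Gamma_quotient_LIMSEQ[OF not_nonpos_Int_Re_pos[OF assms], of z]]
  by (simp add: norm_mult norm_divide prod_norm[symmetric])

text \<open>Each factor \<open>\<bar>x + k\<bar> / \<bar>x + k + \<i>y\<bar>\<close> of the Euler product for \<open>\<bar>\<Gamma>(x + \<i>y)\<bar> / \<Gamma>(x)\<close> increases with \<open>x\<close>.\<close>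

lemma cmod_Gamma_quotient_mono:
  assumes "0 < x" "x \<le> x'"
  shows "cmod (Gamma (Complex x y)) / Gamma x \<le> cmod (Gamma (Complex x' y)) / Gamma x'"
proof (rule LIMSEQ_le)
  let ?F = "\<lambda>x n. exp (0 * ln (real n)) * (\<Prod>k\<le>n. cmod (of_real x + of_nat k) / cmod (Complex x y + of_nat k))"
  have lim: "?F x \<longlonglongrightarrow> cmod (Gamma (Complex x y)) / Gamma x" if "x > 0" for x
    using cmod_Gamma_quotient_LIMSEQ[of "of_real x" "Complex x y"] that
    by (simp add: Gamma_complex_of_real Gamma_real_pos)
  show "?F x \<longlonglongrightarrow> cmod (Gamma (Complex x y)) / Gamma x" by (rule lim) fact
  show "?F x' \<longlonglongrightarrow> cmod (Gamma (Complex x' y)) / Gamma x'" by (rule lim) (use assms in simp)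
  have "cmod (of_real x + of_nat k) / cmod (Complex x y + of_nat k)
      \<le> cmod (of_real x' + of_nat k) / cmod (Complex x' y + of_nat k)" for k
  proof -
    have e: "cmod (of_real x + of_nat k) / cmod (Complex x y + of_nat k) = 1 / sqrt (1 + (y / (x + k))\<^sup>2)"
      if "x > 0" for x
    proof -
      have 1: "cmod (of_real x + of_nat k) = x + k"
        using that norm_of_real[of "x + real k", where ?'a = complex] by simp
      have 2: "cmod (Complex x y + of_nat k) = (x + k) * sqrt (1 + (y / (x + k))\<^sup>2)"
      proof -
        have "cmod (Complex x y + of_nat k) = sqrt ((x + k)\<^sup>2 * (1 + (y / (x + k))\<^sup>2))"
          using that by (simp add: cmod_def field_simps)
        then show ?thesis using that by (simp add: real_sqrt_mult)
      qed
      show ?thesis unfolding 1 2 using that by simp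
    qed
    have "(y / (x' + k))\<^sup>2 \<le> (y / (x + k))\<^sup>2"
      unfolding power_divide using assms by (intro divide_left_mono power_mono) auto
    then show ?thesis using assms by (simp add: e frac_le add_pos_nonneg)
  qed
  then show "\<exists>N. \<forall>n\<ge>N. ?F x n \<le> ?F x' n"
    by (auto intro!: prod_mono)
qed

text \<open>At b = 3/2 the factors are (1/2 + k) (5/2 + k) / (3/2 + k)^2 and telescope, with limit
  1/3; each factor increases with b.\<close>

lemma prod_one_minus_inverse_square_ge:
  assumes "b \<ge> 3/2"
  shows "1/3 \<le> (\<Prod>k\<le>n. 1 - 1 / (b + real k)\<^sup>2)"
proof -
  have eq: "(\<Prod>k\<le>n. 1 - 1 / (3/2 + real k)\<^sup>2) = (1/3) * ((5/2 + real n) / (3/2 + real n))" for n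
  proof (induction n)
    case (Suc n)
    show ?case unfolding prod.atMost_Suc Suc by (simp add: divide_simps power2_eq_square) (simp add: algebra_simps)
  qed (simp add: power2_eq_square)
  have "1/3 \<le> (1/3) * ((5/2 + real n) / (3/2 + real n))" by (simp add: field_simps)
  also have "\<dots> = (\<Prod>k\<le>n. 1 - 1 / (3/2 + real k)\<^sup>2)" by (rule eq[symmetric])
  also have "\<dots> \<le> (\<Prod>k\<le>n. 1 - 1 / (b + real k)\<^sup>2)"
  proof (intro prod_mono conjI)
    fix k
    have "1 \<le> (3/2 + real k)\<^sup>2" using power_mono[of 1 "3/2 + real k" 2] by simp
    then show "0 \<le> 1 - 1 / (3/2 + real k)\<^sup>2" by (simp add: field_simps)
    show "1 - 1 / (3/2 + real k)\<^sup>2 \<le> 1 - 1 / (b + real k)\<^sup>2"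
      using assms by (intro diff_left_mono divide_left_mono power_mono) auto
  qed
  finally show ?thesis .
qed

text \<open>Up to the factor 1 - 1 / (Re w)^2, the squared norm at w + \<delta> dominates the
  geometric interpolation between those at w and w + 1. Young's inequality gives (1 + X)^\<delta>
  \<le> 1 + \<delta>X, and the factor 1 - \<delta>/A reduces the linear term \<delta>(2R + 1) to
  2\<delta>R.\<close>

lemma shift_norm_bound:
  fixes w :: complex
  assumes "0 \<le> \<delta>" "\<delta> \<le> 1" "Re w \<ge> 3/2"
  shows "(cmod w)\<^sup>2 * (1 - 1 / (Re w)\<^sup>2) * ((cmod (w + 1))\<^sup>2 / (cmod w)\<^sup>2) powr \<delta> \<le> (cmod (w + of_real \<delta>))\<^sup>2"
proof -
  define A where "A = (cmod w)\<^sup>2"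
  define R where "R = Re w"
  have R: "R \<ge> 3/2" using assms by (simp add: R_def)
  have A: "A \<ge> R\<^sup>2" by (simp add: A_def R_def cmod_power2)
  have R2: "R\<^sup>2 \<ge> 1" using R by (simp add: one_le_power)
  have A0: "A > 0" using A R2 by linarith
  have e: "(cmod (w + of_real t))\<^sup>2 = A + 2 * t * R + t\<^sup>2" for t
    unfolding A_def R_def cmod_power2 by (simp add: power2_eq_square algebra_simps)
  define X where "X = (2 * R + 1) / A"
  have X: "X \<ge> 0" using R A0 by (simp add: X_def)
  have "(cmod (w + 1))\<^sup>2 / A = 1 + X"
    using e[of 1] A0 by (simp add: X_def field_simps)
  moreover have "(1 + X) powr \<delta> \<le> 1 + \<delta> * X"
  proof -
    have "(1 + X) powr \<delta> * 1 powr (1 - \<delta>) \<le> \<delta> * (1 + X) + (1 - \<delta>) * 1"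
      using assms X by (intro Youngs_inequality_0) auto
    then show ?thesis by (simp add: algebra_simps)
  qed
  moreover have "1 - 1 / R\<^sup>2 \<ge> 0" using R2 by (auto simp: divide_le_eq_1)
  ultimately have "A * (1 - 1 / R\<^sup>2) * ((cmod (w + 1))\<^sup>2 / A) powr \<delta> \<le> A * (1 - 1 / R\<^sup>2) * (1 + \<delta> * X)"
    using A0 by (intro mult_left_mono) auto
  also have "\<dots> \<le> A * (1 - \<delta> / A) * (1 + \<delta> * X)"
  proof (intro mult_right_mono mult_left_mono)
    have "\<delta> / A \<le> 1 / R\<^sup>2" using assms A R2 by (intro frac_le) auto
    then show "1 - 1 / R\<^sup>2 \<le> 1 - \<delta> / A" by simp
  qed (use A0 X assms in auto)
  also have "\<dots> = A + 2 * \<delta> * R - \<delta>\<^sup>2 * X"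
    using A0 by (simp add: X_def field_simps power2_eq_square)
  also have "\<dots> \<le> A + 2 * \<delta> * R + \<delta>\<^sup>2" using X by (simp add: add_increasing2 mult_nonneg_nonneg)
  finally show ?thesis unfolding e by (simp add: A_def R_def)
qed

text \<open>This replaces Stirling's formula, with a constant independent of \<delta> and z.
  \<open>shift_norm_bound\<close> is applied to every factor of the Euler product for \<Gamma>(z +
  \<delta>) / \<Gamma>(z); the ratios of consecutive norms telescope, and 3 is the reciprocal of the
  bound in \<open>prod_one_minus_inverse_square_ge\<close>.\<close>

lemma cmod_Gamma_shift_le:
  fixes z :: complex
  assumes "0 \<le> \<delta>" "\<delta> \<le> 1" "Re z \<ge> 3/2"
  shows "(cmod (Gamma (z + of_real \<delta>)))\<^sup>2 \<le> 3 * ((cmod z)\<^sup>2) powr \<delta> * (cmod (Gamma z))\<^sup>2"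
proof -
  let ?B = "\<lambda>n. 3 * ((cmod z)\<^sup>2) powr \<delta> * (real n ^ 2 / (cmod (z + of_nat (Suc n)))\<^sup>2) powr \<delta>"
  let ?P = "\<lambda>n. exp (Re (z + of_real \<delta> - z) * ln (real n)) * (\<Prod>k\<le>n. cmod (z + of_nat k) / cmod (z + of_real \<delta> + of_nat k))"
  have z0: "cmod (z + of_nat k) > 0" "cmod (z + of_real \<delta> + of_nat k) > 0" for k
    using assms complex_Re_le_cmod[of "z + of_nat k"] complex_Re_le_cmod[of "z + of_real \<delta> + of_nat k"] by auto
  have P: "(?P n)\<^sup>2 \<le> ?B n" if n: "n \<ge> 1" for n
  proof -
    define r where "r = (\<lambda>k. (cmod (z + of_nat k))\<^sup>2)"
    have r0: "r k > 0" for k using z0 by (simp add: r_def)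
    have tel: "(\<Prod>k\<le>n. (r (Suc k) / r k) powr \<delta>) = (r (Suc n) / r 0) powr \<delta>" for n
      using r0 by (induction n) (simp_all add: powr_mult[symmetric] less_imp_le less_imp_neq[OF r0, symmetric])
    have "(\<Prod>k\<le>n. (1 - 1 / (Re z + k)\<^sup>2)) * (\<Prod>k\<le>n. (r (Suc k) / r k) powr \<delta>)
        = (\<Prod>k\<le>n. (1 - 1 / (Re z + k)\<^sup>2) * (r (Suc k) / r k) powr \<delta>)"
      by (simp add: prod.distrib)
    also have "\<dots> \<le> (\<Prod>k\<le>n. (cmod (z + of_real \<delta> + of_nat k))\<^sup>2 / r k)"
    proof (intro prod_mono conjI)
      fix k
      have "1 \<le> (Re z + real k)\<^sup>2" using assms by (intro one_le_power) auto
      then show "0 \<le> (1 - 1 / (Re z + k)\<^sup>2) * (r (Suc k) / r k) powr \<delta>"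
        by (intro mult_nonneg_nonneg) (auto simp: divide_le_eq_1)
      show "(1 - 1 / (Re z + k)\<^sup>2) * (r (Suc k) / r k) powr \<delta> \<le> (cmod (z + of_real \<delta> + of_nat k))\<^sup>2 / r k"
        using shift_norm_bound[of \<delta> "z + of_nat k"] assms r0[of k]
        by (simp add: r_def field_simps add_ac)
    qed
    finally have *: "(\<Prod>k\<le>n. (1 - 1 / (Re z + k)\<^sup>2)) * (r (Suc n) / r 0) powr \<delta>
        \<le> (\<Prod>k\<le>n. (cmod (z + of_real \<delta> + of_nat k))\<^sup>2 / r k)" unfolding tel .
    have "(1/3) * (r (Suc n) / r 0) powr \<delta> \<le> (\<Prod>k\<le>n. (1 - 1 / (Re z + k)\<^sup>2)) * (r (Suc n) / r 0) powr \<delta>"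
      using prod_one_minus_inverse_square_ge[of "Re z" n] assms by (intro mult_right_mono) auto
    with * have 3: "(1/3) * (r (Suc n) / r 0) powr \<delta> \<le> (\<Prod>k\<le>n. (cmod (z + of_real \<delta> + of_nat k))\<^sup>2 / r k)" (is "_ \<le> ?Q")
      by linarith
    have Q: "?Q > 0" using r0 z0 by (intro prod_pos) (auto intro!: divide_pos_pos)
    have "(?P n)\<^sup>2 = (real n ^ 2) powr \<delta> / ?Q"
    proof -
      have "(\<Prod>k\<le>n. cmod (z + of_nat k) / cmod (z + of_real \<delta> + of_nat k))\<^sup>2 = 1 / ?Q"
        by (simp add: prod_dividef r_def power_divide prod_power_distrib)
      moreover have "(exp (Re (z + of_real \<delta> - z) * ln (real n)))\<^sup>2 = (real n ^ 2) powr \<delta>"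
        using n by (simp add: powr_def ln_realpow exp_double[symmetric] mult_ac)
      ultimately show ?thesis by (simp add: power_mult_distrib)
    qed
    also have "\<dots> \<le> (real n ^ 2) powr \<delta> / ((1/3) * (r (Suc n) / r 0) powr \<delta>)"
      using 3 r0[of "Suc n"] r0[of 0] Q by (intro divide_left_mono mult_pos_pos) auto
    also have "\<dots> = ?B n"
      using r0[of "Suc n"] r0[of 0] by (simp add: powr_divide r_def less_imp_le)
    finally show ?thesis .
  qed
  have lim1: "(\<lambda>n. (?P n)\<^sup>2) \<longlonglongrightarrow> (cmod (Gamma (z + of_real \<delta>)) / cmod (Gamma z))\<^sup>2"
    by (intro tendsto_power cmod_Gamma_quotient_LIMSEQ) (use assms in simp)
  have lim2: "?B \<longlonglongrightarrow> 3 * ((cmod z)\<^sup>2) powr \<delta> * 1 powr \<delta>"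
  proof (intro tendsto_intros)
    have "(\<lambda>n. cmod (z + of_nat (Suc n)) / real n) \<longlonglongrightarrow> 1"
    proof -
      have "(\<lambda>n. (z + 1) / of_nat n + 1) \<longlonglongrightarrow> 0 + 1"
        by (intro tendsto_intros lim_const_over_n)
      then have "(\<lambda>n. cmod ((z + 1) / of_nat n + 1)) \<longlonglongrightarrow> cmod 1" by (intro tendsto_norm) simp
      moreover have "\<forall>\<^sub>F n in sequentially. cmod ((z + 1) / of_nat n + 1) = cmod (z + of_nat (Suc n)) / real n"
        using eventually_gt_at_top[of 0]
      proof eventually_elim
        case (elim n)
        have "(z + 1) / of_nat n + 1 = (z + of_nat (Suc n)) / of_nat n" using elim by (simp add: field_simps)
        then show ?case by (simp add: norm_divide)
      qed
      ultimately show ?thesis by (subst (asm) tendsto_cong) auto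
    qed
    from tendsto_power[OF tendsto_inverse[OF this], of 2]
    show "(\<lambda>n. real n ^ 2 / (cmod (z + of_nat (Suc n)))\<^sup>2) \<longlonglongrightarrow> 1"
      by (simp add: power_divide)
  qed auto
  have "(cmod (Gamma (z + of_real \<delta>)) / cmod (Gamma z))\<^sup>2 \<le> 3 * ((cmod z)\<^sup>2) powr \<delta> * 1 powr \<delta>"
    by (rule LIMSEQ_le[OF lim1 lim2]) (use P in blast)
  moreover have "cmod (Gamma z) > 0"
    using not_nonpos_Int_Re_pos[of z] assms by (simp add: Gamma_eq_zero_iff)
  ultimately show ?thesis by (simp add: power_divide field_simps)
qed


section \<open>The functional equation\<close>

lemma has_bochner_integral_nonneg_has_integral:
  fixes f :: "real \<Rightarrow> real"
  assumes "f \<in> borel_measurable borel" "\<Omega> \<in> sets borel" "\<And>x. 0 \<le> f x" "(f has_integral I) \<Omega>"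
  shows "has_bochner_integral lborel (\<lambda>x. indicator \<Omega> x * f x) I"
proof (rule has_bochner_integral_nn_integral)
  have "0 \<le> I" using assms(3,4) has_integral_nonneg by blast
  then show "0 \<le> I" .
  show "(\<integral>\<^sup>+ x. ennreal (indicator \<Omega> x * f x) \<partial>lborel) = ennreal I"
    using nn_integral_has_integral_lebesgue[OF assms(3,4)] .
qed (use assms in auto)

lemma bochner_powr_0_1:
  assumes "a > 0"
  shows "has_bochner_integral lborel (\<lambda>x::real. indicator {0<..<1} x * (x powr (a - 1))) (1 / a)"
proof -
  have "((\<lambda>x::real. x powr (a - 1)) has_integral (1 powr (a - 1 + 1) / (a - 1 + 1))) {0..1}"
    by (rule has_integral_powr_from_0) (use assms in auto)
  then have "((\<lambda>x::real. x powr (a - 1)) has_integral (1 / a)) {0<..<1}"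
    by (simp add: has_integral_Icc_iff_Ioo)
  then show ?thesis by (intro has_bochner_integral_nonneg_has_integral) auto
qed

lemma bochner_powr_1_inf:
  assumes "a < 0"
  shows "has_bochner_integral lborel (\<lambda>x::real. indicator {1..} x * (x powr (a - 1))) (- 1 / a)"
proof -
  have "((\<lambda>x::real. x powr (a - 1)) has_integral (- (1 powr (a - 1 + 1)) / (a - 1 + 1))) {1..}"
    by (rule has_integral_powr_to_inf) (use assms in auto)
  then show ?thesis by (intro has_bochner_integral_nonneg_has_integral) auto
qed

lemma nn_integral_Gamma_scaled:
  assumes "\<sigma> > 0" "a > (0::real)"
  shows "(\<integral>\<^sup>+x. ennreal (indicator {0<..} x * (x powr (\<sigma> - 1) * exp (- a * x))) \<partial>lborel) = ennreal (Gamma \<sigma> * a powr (- \<sigma>))"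
proof -
  let ?f = "\<lambda>x::real. ennreal (indicator {0..} x * x powr (\<sigma> - 1) / exp x)"
  have "ennreal (Gamma \<sigma>) = (\<integral>\<^sup>+x. ?f x \<partial>lborel)" by (rule Gamma_conv_nn_integral_real[OF assms(1)])
  also have "\<dots> = ennreal \<bar>a\<bar> * (\<integral>\<^sup>+x. ?f (0 + a * x) \<partial>lborel)"
    by (rule nn_integral_real_affine) (use assms in auto)
  also have "(\<integral>\<^sup>+x. ?f (0 + a * x) \<partial>lborel)
      = (\<integral>\<^sup>+x. ennreal (a powr (\<sigma> - 1)) * ennreal (indicator {0<..} x * (x powr (\<sigma> - 1) * exp (- a * x))) \<partial>lborel)"
  proof (rule nn_integral_cong)
    fix x :: real
    show "?f (0 + a * x) = ennreal (a powr (\<sigma> - 1)) * ennreal (indicator {0<..} x * (x powr (\<sigma> - 1) * exp (- a * x)))"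
      using assms
      by (cases x "0 :: real" rule: linorder_cases)
         (auto simp: indicator_def powr_mult exp_minus divide_inverse mult_ac zero_le_mult_iff simp flip: ennreal_mult)
  qed
  also have "\<dots> = ennreal (a powr (\<sigma> - 1)) * (\<integral>\<^sup>+x. ennreal (indicator {0<..} x * (x powr (\<sigma> - 1) * exp (- a * x))) \<partial>lborel)"
    by (rule nn_integral_cmult) auto
  finally have "ennreal (Gamma \<sigma>) = ennreal (a powr \<sigma>) * (\<integral>\<^sup>+x. ennreal (indicator {0<..} x * (x powr (\<sigma> - 1) * exp (- a * x))) \<partial>lborel)"
    (is "_ = _ * ?I")
    using assms by (simp add: mult.assoc[symmetric] powr_mult_base flip: ennreal_mult)
  then have "ennreal (a powr (- \<sigma>)) * ennreal (Gamma \<sigma>) = ennreal (a powr (- \<sigma>)) * ennreal (a powr \<sigma>) * ?I"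
    by (simp add: mult.assoc)
  moreover have "ennreal (a powr (- \<sigma>)) * ennreal (a powr \<sigma>) = 1"
    using assms by (simp add: powr_add[symmetric] flip: ennreal_mult)
  ultimately show ?thesis using assms by (simp add: ennreal_mult mult.commute Gamma_real_pos less_imp_le)
qed

definition rzeta :: "real \<Rightarrow> real" where
  "rzeta \<sigma> = (\<Sum>n. real (Suc n) powr (- \<sigma>))"

lemma rzeta: assumes "\<sigma> > 1"
  shows "(\<lambda>n. real (Suc n) powr (- \<sigma>)) sums rzeta \<sigma>" "zeta (of_real \<sigma>) = of_real (rzeta \<sigma>)"
proof -
  show 1: "(\<lambda>n. real (Suc n) powr (- \<sigma>)) sums rzeta \<sigma>"
    unfolding rzeta_def by (intro summable_sums summable_shift_powr) (use assms in simp)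
  have "(\<lambda>n. complex_of_real (real (Suc n) powr (- \<sigma>))) sums of_real (rzeta \<sigma>)"
    using 1 by (simp only: sums_of_real_iff)
  moreover have "complex_of_real (real (Suc n) powr (- \<sigma>)) = 1 / of_nat (Suc n) powr of_real \<sigma>" for n
    using powr_of_real[of "real (Suc n)" "- \<sigma>"] by (simp add: powr_minus_divide)
  ultimately show "zeta (of_real \<sigma>) = of_real (rzeta \<sigma>)"
    using zeta_sums[of "of_real \<sigma>"] assms sums_unique2 by force
qed

lemma ennreal_suminf_sums:
  assumes "f sums S" "\<And>n. f n \<ge> (0::real)"
  shows "(\<Sum>n. ennreal (f n)) = ennreal S"
  by (rule suminf_ennreal_eq[OF assms(2,1)])

text \<open>Expand 1 / (exp x - 1) as the geometric series of exp (- (n + 1) x); all terms are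
  nonnegative, so they may be integrated one by one.\<close>

lemma bose_integral:
  assumes "\<sigma> > 1"
  shows "has_bochner_integral lborel (\<lambda>x. indicator {0<..} x * (x powr (\<sigma> - 1) / (exp x - 1))) (Gamma \<sigma> * rzeta \<sigma>)"
proof (rule has_bochner_integral_nn_integral)
  have G: "Gamma \<sigma> > 0" using assms by (simp add: Gamma_real_pos)
  have sm: "(\<lambda>n. Gamma \<sigma> * real (Suc n) powr (- \<sigma>)) sums (Gamma \<sigma> * rzeta \<sigma>)"
    by (intro sums_mult rzeta assms)
  show "0 \<le> Gamma \<sigma> * rzeta \<sigma>" by (rule sums_le[OF _ sums_zero sm]) (use G in auto)
  have "(\<integral>\<^sup>+x. ennreal (indicator {0<..} x * (x powr (\<sigma> - 1) / (exp x - 1))) \<partial>lborel)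
      = (\<integral>\<^sup>+x. (\<Sum>n. ennreal (indicator {0<..} x * (x powr (\<sigma> - 1) * exp (- real (Suc n) * x)))) \<partial>lborel)"
  proof (rule nn_integral_cong)
    fix x :: real
    have "(\<lambda>n. x powr (\<sigma> - 1) * exp (- real (Suc n) * x)) sums (x powr (\<sigma> - 1) / (exp x - 1))" if "x > 0"
    proof -
      have "(\<lambda>n. exp (- x) * exp (- x) ^ n) sums (exp (- x) * (1 / (1 - exp (- x))))"
        by (intro sums_mult geometric_sums) (use that in simp)
      moreover have "exp (- x) * exp (- x) ^ n = exp (- real (Suc n) * x)" for n
        by (simp only: exp_of_nat_mult[symmetric] exp_add[symmetric]) (simp add: algebra_simps)
      moreover have "exp (- x) * (1 / (1 - exp (- x))) = 1 / (exp x - 1)"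
        using that by (simp add: exp_minus field_simps)
      ultimately have "(\<lambda>n. exp (- real (Suc n) * x)) sums (1 / (exp x - 1))" by simp
      from sums_mult[OF this, of "x powr (\<sigma> - 1)"] show ?thesis by simp
    qed
    then show "ennreal (indicator {0<..} x * (x powr (\<sigma> - 1) / (exp x - 1)))
      = (\<Sum>n. ennreal (indicator {0<..} x * (x powr (\<sigma> - 1) * exp (- real (Suc n) * x))))"
      by (cases "x > 0") (auto intro!: ennreal_suminf_sums[symmetric])
  qed
  also have "\<dots> = (\<Sum>n. \<integral>\<^sup>+x. ennreal (indicator {0<..} x * (x powr (\<sigma> - 1) * exp (- real (Suc n) * x))) \<partial>lborel)"
    by (rule nn_integral_suminf) auto
  also have "\<dots> = (\<Sum>n. ennreal (Gamma \<sigma> * real (Suc n) powr (- \<sigma>)))"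
    by (subst nn_integral_Gamma_scaled) (use assms in auto)
  also have "\<dots> = ennreal (Gamma \<sigma> * rzeta \<sigma>)"
    by (rule ennreal_suminf_sums[OF sm]) (use G in auto)
  finally show "(\<integral>\<^sup>+x. ennreal (indicator {0<..} x * (x powr (\<sigma> - 1) / (exp x - 1))) \<partial>lborel) = ennreal (Gamma \<sigma> * rzeta \<sigma>)" .
qed (auto simp: indicator_def)

text \<open>The substitution t = x^2 / (1 + x^2) turns the Beta integral with parameters a and 1 -
  a, where a = (s + 1) / 2, into twice this integral. The reflection formula evaluates it as pi /
  sin (pi a) = pi / cos (pi s / 2).\<close>

lemma integral_powr_over_one_plus_square:
  assumes "-1 < s" "s < (1::real)"
  shows "((\<lambda>x. x powr s / (1 + x\<^sup>2)) has_integral (pi / (2 * cos (pi * s / 2)))) {0<..}"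
    and "cos (pi * s / 2) > 0"
proof -
  define a where "a = (s + 1) / 2"
  have a: "0 < a" "a < 1" using assms by (auto simp: a_def)
  let ?f = "\<lambda>t::real. t powr (a - 1) * (1 - t) powr (1 - a - 1)"
  let ?g = "\<lambda>x::real. x\<^sup>2 / (1 + x\<^sup>2)"
  let ?g' = "\<lambda>x::real. 2 * x / (1 + x\<^sup>2)\<^sup>2"
  have pos: "1 + x\<^sup>2 > (0::real)" for x by (simp add: add_pos_nonneg)
  have ne: "1 + x\<^sup>2 \<noteq> (0::real)" for x using pos[of x] by linarith
  have B: "(?f has_integral Beta a (1 - a)) {0<..<1}"
    using has_integral_Beta_real[of a "1 - a"] a by (simp add: has_integral_Icc_iff_Ioo)
  have inj: "inj_on ?g {0<..}"
  proof (rule inj_onI)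
    fix x y :: real assume xy: "x \<in> {0<..}" "y \<in> {0<..}" "?g x = ?g y"
    then have "x\<^sup>2 = y\<^sup>2" using ne by (simp add: field_simps)
    then show "x = y" using xy by (simp add: power2_eq_iff_nonneg)
  qed
  have img: "?g ` {0<..} = {0<..<1}"
  proof safe
    fix t :: real assume t: "t \<in> {0<..<1}"
    have "?g (sqrt (t / (1 - t))) = t" using t by (simp add: field_simps)
    then show "t \<in> ?g ` {0<..}" using t by (intro image_eqI[of _ _ "sqrt (t / (1 - t))"]) auto
  qed (use pos in \<open>auto simp: divide_simps\<close>)
  have "?f absolutely_integrable_on {0<..<1}"
    by (rule nonnegative_absolutely_integrable_1) (use B in auto)
  then have fi: "?f absolutely_integrable_on ?g ` {0<..} \<and> integral (?g ` {0<..}) ?f = Beta a (1 - a)"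
    unfolding img using integral_unique[OF B] by blast
  have der: "(?g has_field_derivative ?g' x) (at x within {0<..})" for x
    using ne[of x] by (auto intro!: derivative_eq_intros simp: power2_eq_square field_simps)
  have "(\<lambda>x. \<bar>?g' x\<bar> * ?f (?g x)) absolutely_integrable_on {0<..} \<and>
      integral {0<..} (\<lambda>x. \<bar>?g' x\<bar> * ?f (?g x)) = Beta a (1 - a)"
    by (rule has_absolute_integral_change_of_variables_1'[THEN iffD2, OF _ der inj fi]) auto
  then have 1: "((\<lambda>x. \<bar>?g' x\<bar> * ?f (?g x)) has_integral Beta a (1 - a)) {0<..}"
    by (simp add: has_integral_iff absolutely_integrable_on_def)
  have eq: "\<bar>?g' x\<bar> * ?f (?g x) = 2 * (x powr s / (1 + x\<^sup>2))" if "x \<in> {0<..}" for x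
  proof -
    have x: "x > 0" using that by simp
    have "1 - ?g x = 1 / (1 + x\<^sup>2)" using ne[of x] by (simp add: field_simps)
    moreover have "?g x powr (a - 1) = x powr (s - 1) * (1 + x\<^sup>2) powr (1 - a)"
    proof -
      have "?g x powr (a - 1) = (x\<^sup>2) powr (a - 1) / (1 + x\<^sup>2) powr (a - 1)"
        by (rule powr_divide)
      also have "(x\<^sup>2) powr (a - 1) = x powr (s - 1)"
      proof -
        have "(x\<^sup>2) powr (a - 1) = x powr (2 * (a - 1))"
          using x by (simp add: powr_powr flip: powr_numeral)
        also have "2 * (a - 1) = s - 1" by (simp add: a_def)
        finally show ?thesis .
      qed
      also have "\<dots> / (1 + x\<^sup>2) powr (a - 1) = x powr (s - 1) * (1 + x\<^sup>2) powr (- (a - 1))"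
        by (simp only: powr_minus divide_inverse)
      finally show ?thesis by simp
    qed
    moreover have "(1 / (1 + x\<^sup>2)) powr (1 - a - 1) = (1 + x\<^sup>2) powr a"
      using pos[of x] by (simp add: powr_divide powr_minus_divide)
    ultimately have "?f (?g x) = x powr (s - 1) * ((1 + x\<^sup>2) powr (1 - a) * (1 + x\<^sup>2) powr a)" by simp
    also have "\<dots> = x powr (s - 1) * (1 + x\<^sup>2)" using pos[of x] by (simp add: powr_add[symmetric])
    finally have "\<bar>?g' x\<bar> * ?f (?g x) = 2 * (x * x powr (s - 1)) * ((1 + x\<^sup>2) / (1 + x\<^sup>2)\<^sup>2)"
      using x by simp
    also have "x * x powr (s - 1) = x powr s" using x by (simp add: powr_mult_base)
    also have "(1 + x\<^sup>2) / (1 + x\<^sup>2)\<^sup>2 = 1 / (1 + x\<^sup>2)" using ne[of x] by (simp add: power2_eq_square)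
    finally show ?thesis by simp
  qed
  have 2: "((\<lambda>x. 2 * (x powr s / (1 + x\<^sup>2))) has_integral Beta a (1 - a)) {0<..}"
    by (rule has_integral_eq[OF eq 1])
  have "pi * a = pi / 2 + pi * s / 2" by (simp add: a_def field_simps)
  then have sina: "sin (pi * a) = cos (pi * s / 2)" by (simp add: sin_add)
  have "of_real (Beta a (1 - a)) = Gamma (of_real a) * Gamma (1 - of_real a :: complex)"
    using Gamma_complex_of_real[of "1 - a"] by (simp add: Beta_def Gamma_complex_of_real)
  also have "\<dots> = of_real (pi / sin (pi * a))"
    unfolding Gamma_reflection_complex by (simp add: sin_of_real flip: of_real_mult)
  finally have "Beta a (1 - a) = pi / cos (pi * s / 2)" by (simp only: of_real_eq_iff sina)
  from has_integral_mult_right[OF 2, of "1/2"] this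
  show "((\<lambda>x. x powr s / (1 + x\<^sup>2)) has_integral (pi / (2 * cos (pi * s / 2)))) {0<..}"
    by simp
  show "cos (pi * s / 2) > 0"
    using assms mult_strict_left_mono[of "-1" s pi] by (intro cos_gt_zero_pi) auto
qed

text \<open>Differentiating \<Gamma>(z) \<Gamma>(1 - z) = pi / sin (pi z) identifies
  \<open>Digamma (1 - z) - Digamma z\<close> with pi cot (pi z). In the difference of the two limit
  formulas for Digamma the logarithms cancel.\<close>

lemma LIMSEQ_pi_cot:
  fixes z :: complex
  assumes z: "z \<notin> \<int>"
  shows "(\<lambda>m. 1 / z + (\<Sum>n<m. 2 * z / (z\<^sup>2 - (of_nat (Suc n))\<^sup>2))) \<longlonglongrightarrow> of_real pi * cos (of_real pi * z) / sin (of_real pi * z)"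
proof -
  have nz: "z + of_nat n \<noteq> 0" "1 - z + of_nat n \<noteq> 0" "z - of_nat n \<noteq> 0" for n
  proof -
    have "z \<noteq> - of_nat n" "z \<noteq> of_nat n" "z \<noteq> 1 + of_nat n"
      using z by (auto intro: Ints_minus Ints_add)
    then show "z + of_nat n \<noteq> 0" "1 - z + of_nat n \<noteq> 0" "z - of_nat n \<noteq> 0"
      by (auto simp: add_eq_0_iff algebra_simps)
  qed
  have sin0: "sin (of_real pi * z) \<noteq> 0"
  proof
    assume "sin (of_real pi * z) = 0"
    then obtain n :: int where "of_real pi * z = of_real (of_int n * pi)" using sin_eq_0 by blast
    then have "z = of_int n" by (simp add: mult.commute)
    then show False using z by auto
  qed
  have np: "z \<notin> \<int>\<^sub>\<le>\<^sub>0" "1 - z \<notin> \<int>\<^sub>\<le>\<^sub>0"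
    using z nonpos_Ints_subset_Ints by (auto dest: Ints_diff[OF Ints_1])
  let ?L = "Gamma z * Digamma z * Gamma (1 - z) - Gamma z * (Gamma (1 - z) * Digamma (1 - z))"
  have d1: "((\<lambda>z. Gamma z * Gamma (1 - z)) has_field_derivative ?L) (at z)"
    using np by (auto intro!: derivative_eq_intros)
  have d2: "((\<lambda>z. of_real pi / sin (of_real pi * z)) has_field_derivative
      - (of_real pi * (cos (of_real pi * z) * of_real pi)) / (sin (of_real pi * z))\<^sup>2) (at z)"
    using sin0 by (auto intro!: derivative_eq_intros simp: power2_eq_square)
  have "?L = - (of_real pi * (cos (of_real pi * z) * of_real pi)) / (sin (of_real pi * z))\<^sup>2"
    using DERIV_unique[OF d1] d2 unfolding Gamma_reflection_complex by blast
  moreover have "?L = (Gamma z * Gamma (1 - z)) * (Digamma z - Digamma (1 - z))" by (simp add: algebra_simps)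
  ultimately have *: "of_real pi / sin (of_real pi * z) * (Digamma z - Digamma (1 - z))
      = - (of_real pi * (cos (of_real pi * z) * of_real pi)) / (sin (of_real pi * z))\<^sup>2"
    unfolding Gamma_reflection_complex by simp
  have "Digamma (1 - z) - Digamma z
      = - (sin (of_real pi * z) / of_real pi) * (of_real pi / sin (of_real pi * z) * (Digamma z - Digamma (1 - z)))"
    using sin0 by (simp add: divide_simps)
  also have "\<dots> = of_real pi * cos (of_real pi * z) / sin (of_real pi * z)"
    unfolding * using sin0 by (simp add: power2_eq_square divide_simps)
  finally have "Digamma (1 - z) - Digamma z = of_real pi * cos (of_real pi * z) / sin (of_real pi * z)" .
  moreover have "(\<lambda>m. (of_real (ln (real m)) - (\<Sum>n<m. inverse (1 - z + of_nat n)))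
       - (of_real (ln (real m)) - (\<Sum>n<m. inverse (z + of_nat n)))) \<longlonglongrightarrow> Digamma (1 - z) - Digamma z"
    using z nz[of 0] by (intro tendsto_diff Digamma_LIMSEQ) auto
  ultimately have lim: "(\<lambda>m. (\<Sum>n<m. inverse (z + of_nat n)) - (\<Sum>n<m. inverse (1 - z + of_nat n)))
      \<longlonglongrightarrow> of_real pi * cos (of_real pi * z) / sin (of_real pi * z)" by simp
  \<comment> \<open>The symmetric partial sum reaches one term further, to z + m, than the
    difference of the two Digamma sums; the surplus 1 / (z + m) tends to 0.\<close>
  have eq: "1 / z + (\<Sum>n<m. 2 * z / (z\<^sup>2 - (of_nat (Suc n))\<^sup>2))
      = ((\<Sum>n<m. inverse (z + of_nat n)) - (\<Sum>n<m. inverse (1 - z + of_nat n))) + inverse (z + of_nat m)" for m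
  proof (induction m)
    case 0
    then show ?case by (simp add: inverse_eq_divide)
  next
    case (Suc m)
    have "z\<^sup>2 - (of_nat (Suc m))\<^sup>2 = (z + of_nat (Suc m)) * (z - of_nat (Suc m))"
      by (simp add: power2_eq_square algebra_simps)
    moreover have "z - of_nat (Suc m) \<noteq> 0" "z + of_nat (Suc m) \<noteq> 0" using nz by blast+
    ultimately have "2 * z / (z\<^sup>2 - (of_nat (Suc m))\<^sup>2) = inverse (z + of_nat (Suc m)) + inverse (z - of_nat (Suc m))"
      by (simp add: divide_simps)
    moreover have "inverse (1 - z + of_nat m) = - inverse (z - of_nat (Suc m))"
      by (subst inverse_minus_eq[symmetric]) simp
    ultimately show ?case using Suc by simp
  qed
  have "(\<lambda>m. inverse (z + of_nat m)) \<longlonglongrightarrow> 0"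
    by (rule filterlim_compose[OF tendsto_inverse_0 tendsto_add_filterlim_at_infinity[OF tendsto_const tendsto_of_nat]])
  from tendsto_add[OF lim this] show ?thesis unfolding eq by simp
qed

text \<open>Equal to coth (x/2) / 2 - 1/x: the Bose kernel without its polar part at 0, a function
  of order x there.\<close>

definition hbose :: "real \<Rightarrow> real" where
  "hbose x = 1 / (exp x - 1) - 1 / x + 1 / 2"

text \<open>These are the partial fractions of the cotangent at z = \<i> x / (2 pi), where the
  cotangent becomes a hyperbolic one.\<close>

lemma hbose_sums:
  assumes x: "x > 0"
  shows "(\<lambda>n. 2 * x / (x\<^sup>2 + (2 * pi * real (Suc n))\<^sup>2)) sums hbose x"
proof -
  define t where "t = x / (2 * pi)"
  have t: "t > 0" "pi * t = x / 2" using x by (auto simp: t_def)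
  define z where "z = \<i> * complex_of_real t"
  have "z \<notin> \<int>" using t by (auto simp: z_def Ints_def complex_eq_iff)
  from tendsto_mult[OF tendsto_const[of \<i>] LIMSEQ_pi_cot[OF this]]
  have lim: "(\<lambda>m. \<i> * (1 / z + (\<Sum>n<m. 2 * z / (z\<^sup>2 - (of_nat (Suc n))\<^sup>2)))) \<longlonglongrightarrow>
      \<i> * (of_real pi * cos (of_real pi * z) / sin (of_real pi * z))" .
  have l: "\<i> * (1 / z + (\<Sum>n<m. 2 * z / (z\<^sup>2 - (of_nat (Suc n))\<^sup>2)))
      = of_real (1 / t + (\<Sum>n<m. 2 * t / (t\<^sup>2 + (real (Suc n))\<^sup>2)))" for m
  proof -
    have "\<i> * (2 * z / (z\<^sup>2 - (of_nat (Suc n))\<^sup>2)) = of_real (2 * t / (t\<^sup>2 + (real (Suc n))\<^sup>2))" for n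
    proof -
      have "z\<^sup>2 - (of_nat (Suc n))\<^sup>2 = of_real (- (t\<^sup>2 + (real (Suc n))\<^sup>2))"
        by (simp add: z_def power_mult_distrib)
      moreover have "\<i> * (2 * z) = of_real (- (2 * t))" by (simp add: z_def)
      ultimately have "\<i> * (2 * z / (z\<^sup>2 - (of_nat (Suc n))\<^sup>2)) = of_real (- (2 * t)) / of_real (- (t\<^sup>2 + (real (Suc n))\<^sup>2))"
        by (simp only: times_divide_eq_right)
      then show ?thesis by (simp only: of_real_divide[symmetric] minus_divide_divide)
    qed
    then show ?thesis using t by (simp add: distrib_left sum_distrib_left z_def)
  qed
  have r: "\<i> * (of_real pi * cos (of_real pi * z) / sin (of_real pi * z)) = of_real (pi * (1 + 2 / (exp x - 1)))"
  proof -
    have i1: "\<i> * (of_real pi * z) = of_real (- (x / 2))" "- complex_of_real (- (x / 2)) = of_real (x / 2)"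
      unfolding t(2)[symmetric] by (simp_all add: z_def algebra_simps)
    have "cos (of_real pi * z) = of_real ((exp (- (x/2)) + exp (x/2)) / 2)"
      unfolding cos_exp_eq i1 exp_of_real by (simp only: of_real_add of_real_divide of_real_numeral)
    moreover have "sin (of_real pi * z) = of_real (exp (- (x/2)) - exp (x/2)) / (2 * \<i>)"
      unfolding sin_exp_eq i1 exp_of_real by (simp only: of_real_diff)
    moreover have "\<i> * (of_real pi * of_real (a / 2) / (of_real b / (2 * \<i>))) = of_real (- (pi * a / b))" for a b :: real
      by (cases "b = 0") (auto simp: field_simps)
    ultimately have "\<i> * (of_real pi * cos (of_real pi * z) / sin (of_real pi * z))
        = of_real (- (pi * (exp (- (x/2)) + exp (x/2)) / (exp (- (x/2)) - exp (x/2))))"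
      by (simp only:)
    also have "- (pi * (exp (- (x/2)) + exp (x/2)) / (exp (- (x/2)) - exp (x/2))) = pi * (1 + 2 / (exp x - 1))"
    proof -
      define e where "e = exp (x/2)"
      have e: "e > 1" "exp x = e * e" "exp (- (x/2)) = 1 / e"
        using x by (auto simp: e_def exp_minus inverse_eq_divide simp flip: exp_add)
      have "e * e > 1" using e(1) by (simp add: less_1_mult)
      then have "1 / e - e \<noteq> 0" "e * e - 1 \<noteq> 0" using e by (auto simp: field_simps)
      then show ?thesis unfolding e(2,3) e_def[symmetric] using e(1) by (simp add: field_simps)
    qed
    finally show ?thesis .
  qed
  have "(\<lambda>m. 1 / t + (\<Sum>n<m. 2 * t / (t\<^sup>2 + (real (Suc n))\<^sup>2))) \<longlonglongrightarrow> pi * (1 + 2 / (exp x - 1))"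
    using lim unfolding l r by (simp only: tendsto_of_real_iff)
  from tendsto_mult[OF tendsto_const[of "1 / (2 * pi)"] tendsto_diff[OF this tendsto_const[of "1 / t"]]]
  have "(\<lambda>m. 1 / (2 * pi) * (\<Sum>n<m. 2 * t / (t\<^sup>2 + (real (Suc n))\<^sup>2))) \<longlonglongrightarrow> 1 / (2 * pi) * (pi * (1 + 2 / (exp x - 1)) - 1 / t)"
    by simp
  moreover have "1 / (2 * pi) * (pi * (1 + 2 / (exp x - 1)) - 1 / t) = hbose x"
    using x by (simp add: hbose_def t_def field_simps)
  moreover have "1 / (2 * pi) * (\<Sum>n<m. 2 * t / (t\<^sup>2 + (real (Suc n))\<^sup>2))
      = (\<Sum>n<m. 2 * x / (x\<^sup>2 + (2 * pi * real (Suc n))\<^sup>2))" for m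
    unfolding sum_distrib_left
  proof (intro sum.cong refl)
    fix n
    have xt: "x = t * (2 * pi)" by (simp add: t_def)
    have ne: "t\<^sup>2 + (real (Suc n))\<^sup>2 \<noteq> 0" using t by (simp add: sum_power2_eq_zero_iff)
    have "x\<^sup>2 + (2 * pi * real (Suc n))\<^sup>2 = (2 * pi)\<^sup>2 * (t\<^sup>2 + (real (Suc n))\<^sup>2)"
      unfolding xt by (simp add: algebra_simps power_mult_distrib del: of_nat_Suc)
    then show "1 / (2 * pi) * (2 * t / (t\<^sup>2 + (real (Suc n))\<^sup>2)) = 2 * x / (x\<^sup>2 + (2 * pi * real (Suc n))\<^sup>2)"
      using ne unfolding xt by (simp add: power2_eq_square divide_simps)
  qed
  ultimately show ?thesis unfolding sums_def by simp
qed

text \<open>The Mellin integrals below are first evaluated at real arguments, where the integrands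
  are nonnegative. This identity principle carries the results to complex arguments.\<close>

lemma analytic_continuation_real:
  assumes "f holomorphic_on S" "g holomorphic_on S" "open S" "connected S" "a < b"
    and "\<And>x::real. a < x \<Longrightarrow> x < b \<Longrightarrow> of_real x \<in> S \<and> f (of_real x) = g (of_real x)" "w \<in> S"
  shows "f w = g w"
proof -
  let ?U = "complex_of_real ` {a<..<b}" and ?\<xi> = "complex_of_real ((a + b) / 2)"
  have "(\<lambda>z. f z - g z) w = 0"
  proof (rule analytic_continuation[of "\<lambda>z. f z - g z" S ?U ?\<xi> w])
    show "?\<xi> islimpt ?U" unfolding islimpt_approachable
    proof (intro allI impI)
      fix e :: real assume e: "e > 0"
      define x where "x = (a + b) / 2 + min e ((b - a) / 2) / 2"
      have "x \<in> {a<..<b}" "x \<noteq> (a + b) / 2" "\<bar>x - (a + b) / 2\<bar> < e"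
        using assms(5) e by (auto simp: x_def min_def field_simps)
      then show "\<exists>x'\<in>?U. x' \<noteq> ?\<xi> \<and> dist x' ?\<xi> < e"
        by (intro bexI[of _ "complex_of_real x"]) (unfold dist_of_real of_real_eq_iff, auto simp: dist_real_def)
    qed
    show "?\<xi> \<in> S" using assms(5) assms(6)[of "(a + b) / 2"] by (simp add: field_simps)
  qed (use assms in \<open>auto intro!: holomorphic_intros\<close>)
  then show ?thesis by simp
qed

section \<open>Mellin integrals of \<open>hbose\<close> and the two evaluations of
  \<open>RI\<close>\<close>

lemma hbose_bounds:
  assumes "x > 0" shows "0 \<le> hbose x" "hbose x \<le> x"
proof -
  show "0 \<le> hbose x"
    by (rule sums_le[OF _ sums_zero hbose_sums[OF assms]]) (use assms in \<open>auto intro!: divide_nonneg_nonneg\<close>)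
  have "(\<lambda>n. x / (2 * pi\<^sup>2) * (1 / (real (Suc n))\<^sup>2)) sums (x / (2 * pi\<^sup>2) * (pi\<^sup>2 / 6))"
    using inverse_squares_sums by (intro sums_mult) simp
  moreover have "2 * x / (x\<^sup>2 + (2 * pi * real (Suc n))\<^sup>2) \<le> x / (2 * pi\<^sup>2) * (1 / (real (Suc n))\<^sup>2)" for n
  proof -
    have "2 * x / (x\<^sup>2 + (2 * pi * real (Suc n))\<^sup>2) \<le> 2 * x / (2 * pi * real (Suc n))\<^sup>2"
      using assms by (intro divide_left_mono mult_pos_pos add_nonneg_pos) (auto simp del: of_nat_Suc)
    also have "\<dots> = x / (2 * pi\<^sup>2) * (1 / (real (Suc n))\<^sup>2)"
      by (simp add: power_mult_distrib del: of_nat_Suc)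
    finally show ?thesis .
  qed
  ultimately have "hbose x \<le> x / (2 * pi\<^sup>2) * (pi\<^sup>2 / 6)"
    by (intro sums_le[OF _ hbose_sums[OF assms]])
  also have "\<dots> \<le> x" using assms by simp
  finally show "hbose x \<le> x" .
qed

lemma hbose_measurable [measurable]: "hbose \<in> borel_measurable borel"
  unfolding hbose_def by measurable

lemma hbose_0_1_integrable:
  assumes "\<sigma> > -1"
  shows "integrable lborel (\<lambda>x. indicator {0<..<1} x * (hbose x * x powr (\<sigma> - 1)))"
proof (rule Bochner_Integration.integrable_bound)
  show "integrable lborel (\<lambda>x::real. indicator {0<..<1} x * (x powr ((\<sigma> + 1) - 1)))"
    using bochner_powr_0_1[of "\<sigma> + 1"] assms by (simp add: has_bochner_integral_iff)
  show "AE x in lborel. norm (indicator {0<..<1} x * (hbose x * x powr (\<sigma> - 1)))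
      \<le> norm (indicator {0<..<1} x * (x powr ((\<sigma> + 1) - 1)))"
  proof (rule AE_I2)
    fix x :: real
    have "hbose x * x powr (\<sigma> - 1) \<le> x powr \<sigma>" if "x > 0"
    proof -
      have "hbose x * x powr (\<sigma> - 1) \<le> x * x powr (\<sigma> - 1)"
        using hbose_bounds[OF that] by (intro mult_right_mono) auto
      also have "\<dots> = x powr \<sigma>" using that by (simp add: powr_mult_base)
      finally show ?thesis .
    qed
    then show "norm (indicator {0<..<1} x * (hbose x * x powr (\<sigma> - 1)))
      \<le> norm (indicator {0<..<1} x * (x powr ((\<sigma> + 1) - 1)))"
      using hbose_bounds(1)[of x] by (auto simp: indicator_def abs_mult)
  qed
qed auto

lemma bose_1_inf_integrable:
  "integrable lborel (\<lambda>x::real. indicator {1..} x * (x powr (\<sigma> - 1) / (exp x - 1)))"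
proof (rule Bochner_Integration.integrable_bound)
  define \<tau> where "\<tau> = max \<sigma> 2"
  show "integrable lborel (\<lambda>x::real. indicator {0<..} x * (x powr (\<tau> - 1) / (exp x - 1)))"
    using bose_integral[of \<tau>] by (simp add: has_bochner_integral_iff \<tau>_def)
  show "AE x in lborel. norm (indicator {1..} x * (x powr (\<sigma> - 1) / (exp x - 1)))
      \<le> norm (indicator {0<..} x * (x powr (\<tau> - 1) / (exp x - 1)))"
    by (rule AE_I2) (auto simp: indicator_def \<tau>_def intro!: divide_right_mono powr_mono)
qed auto

text \<open>With the polar part \<open>1/x - 1/2\<close> of \<open>1 / (exp x - 1)\<close> removed near \<open>0\<close>, the Mellin integral
  converges for \<open>\<sigma> > -1\<close>. Putting the polar part back gives \<open>\<Gamma>(\<sigma>) \<zeta>(\<sigma>)\<close> for \<open>\<sigma> > 1\<close>, whereas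
  removing it near infinity as well gives the Mellin transform of \<open>hbose\<close> for \<open>-1 < \<sigma> < 0\<close>; both
  corrections are the same rational function of \<open>\<sigma>\<close>.\<close>

definition RI :: "real \<Rightarrow> real" where
  "RI \<sigma> = (\<integral>x. indicator {0<..<1} x * (hbose x * x powr (\<sigma> - 1)) \<partial>lborel)
      + (\<integral>x. indicator {1..} x * (x powr (\<sigma> - 1) / (exp x - 1)) \<partial>lborel)"

lemma RI_gt_1:
  assumes "\<sigma> > 1"
  shows "Gamma \<sigma> * rzeta \<sigma> = RI \<sigma> + 1 / (\<sigma> - 1) - 1 / (2 * \<sigma>)"
proof -
  have 1: "has_bochner_integral lborel (\<lambda>x. indicator {0<..<1} x * (hbose x * x powr (\<sigma> - 1))
      + indicator {1..} x * (x powr (\<sigma> - 1) / (exp x - 1))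
      + indicator {0<..<1} x * (x powr ((\<sigma> - 1) - 1)) - (1/2) * (indicator {0<..<1} x * (x powr (\<sigma> - 1))))
    (RI \<sigma> + 1 / (\<sigma> - 1) - (1/2) * (1 / \<sigma>))"
    unfolding RI_def
    by (intro has_bochner_integral_add has_bochner_integral_diff has_bochner_integral_mult_right
          has_bochner_integral_integrable bochner_powr_0_1 hbose_0_1_integrable bose_1_inf_integrable)
       (use assms in auto)
  moreover have "indicator {0<..<1} x * (hbose x * x powr (\<sigma> - 1))
      + indicator {1..} x * (x powr (\<sigma> - 1) / (exp x - 1))
      + indicator {0<..<1} x * (x powr ((\<sigma> - 1) - 1)) - (1/2) * (indicator {0<..<1} x * (x powr (\<sigma> - 1)))
      = indicator {0<..} x * (x powr (\<sigma> - 1) / (exp x - 1))" for x :: real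
  proof -
    have "x powr (\<sigma> - 1 - 1) = x powr (\<sigma> - 1) / x" if "x > 0"
      using that by (subst powr_diff) simp
    then show ?thesis by (auto simp: indicator_def hbose_def algebra_simps)
  qed
  ultimately show ?thesis
    using bose_integral[OF assms] has_bochner_integral_eq by fastforce
qed

lemma RI_lt_0:
  assumes "-1 < \<sigma>" "\<sigma> < 0"
  shows "has_bochner_integral lborel (\<lambda>x. indicator {0<..} x * (hbose x * x powr (\<sigma> - 1)))
           (RI \<sigma> + 1 / (\<sigma> - 1) - 1 / (2 * \<sigma>))"
proof -
  have 1: "has_bochner_integral lborel (\<lambda>x. indicator {0<..<1} x * (hbose x * x powr (\<sigma> - 1))
      + indicator {1..} x * (x powr (\<sigma> - 1) / (exp x - 1))
      - indicator {1..} x * (x powr ((\<sigma> - 1) - 1)) + (1/2) * (indicator {1..} x * (x powr (\<sigma> - 1))))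
    (RI \<sigma> - (- 1 / (\<sigma> - 1)) + (1/2) * (- 1 / \<sigma>))"
    unfolding RI_def
    by (intro has_bochner_integral_add has_bochner_integral_diff has_bochner_integral_mult_right
          has_bochner_integral_integrable bochner_powr_1_inf hbose_0_1_integrable bose_1_inf_integrable)
       (use assms in auto)
  moreover have "indicator {0<..<1} x * (hbose x * x powr (\<sigma> - 1))
      + indicator {1..} x * (x powr (\<sigma> - 1) / (exp x - 1))
      - indicator {1..} x * (x powr ((\<sigma> - 1) - 1)) + (1/2) * (indicator {1..} x * (x powr (\<sigma> - 1)))
      = indicator {0<..} x * (hbose x * x powr (\<sigma> - 1))" for x :: real
  proof -
    have "x powr (\<sigma> - 1 - 1) = x powr (\<sigma> - 1) / x" if "x > 0"
      using that by (subst powr_diff) simp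
    then show ?thesis by (auto simp: indicator_def hbose_def algebra_simps)
  qed
  ultimately show ?thesis by simp
qed

lemma nn_integral_scaled_kernel:
  assumes "-1 < \<sigma>" "\<sigma> < 0" "a > (0::real)"
  shows "(\<integral>\<^sup>+x. ennreal (indicator {0<..} x * (2 * x / (x\<^sup>2 + a\<^sup>2) * x powr (\<sigma> - 1))) \<partial>lborel)
    = ennreal (2 * a powr (\<sigma> - 1) * (pi / (2 * cos (pi * \<sigma> / 2))))"
proof -
  let ?J = "pi / (2 * cos (pi * \<sigma> / 2))"
  let ?f = "\<lambda>x::real. ennreal (indicator {0<..} x * (2 * x / (x\<^sup>2 + a\<^sup>2) * x powr (\<sigma> - 1)))"
  let ?j = "\<lambda>y::real. indicator {0<..} y * (y powr \<sigma> / (1 + y\<^sup>2))"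
  have c: "cos (pi * \<sigma> / 2) > 0" using integral_powr_over_one_plus_square(2)[of \<sigma>] assms by simp
  then have J: "?J > 0" by simp
  have "(\<integral>\<^sup>+x. ?f x \<partial>lborel) = ennreal \<bar>a\<bar> * (\<integral>\<^sup>+y. ?f (0 + a * y) \<partial>lborel)"
    by (rule nn_integral_real_affine) (use assms in auto)
  also have "(\<integral>\<^sup>+y. ?f (0 + a * y) \<partial>lborel) = (\<integral>\<^sup>+y. ennreal (2 * a powr (\<sigma> - 2)) * ennreal (?j y) \<partial>lborel)"
  proof (rule nn_integral_cong)
    fix y :: real
    show "?f (0 + a * y) = ennreal (2 * a powr (\<sigma> - 2)) * ennreal (?j y)"
    proof (cases "y > 0")
      case True
      have "2 * (a * y) / ((a * y)\<^sup>2 + a\<^sup>2) * (a * y) powr (\<sigma> - 1) = 2 * a powr (\<sigma> - 2) * (y powr \<sigma> / (1 + y\<^sup>2))"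
      proof -
        have 1: "(a * y)\<^sup>2 + a\<^sup>2 = a\<^sup>2 * (1 + y\<^sup>2)" by (simp add: algebra_simps power_mult_distrib)
        have 2: "(a * y) powr (\<sigma> - 1) = a powr (\<sigma> - 1) * y powr (\<sigma> - 1)" by (simp add: powr_mult)
        have 3: "y * y powr (\<sigma> - 1) = y powr \<sigma>" using True by (simp add: powr_mult_base)
        have 4: "a powr (\<sigma> - 1) = a * a powr (\<sigma> - 2)" using assms by (simp add: powr_mult_base)
        have "1 + y\<^sup>2 \<noteq> 0" by (smt (verit) zero_le_power2)
        then show ?thesis unfolding 1 2 3[symmetric] 4 using assms by (simp add: power2_eq_square)
      qed
      then show ?thesis using True assms by (simp add: zero_less_mult_iff flip: ennreal_mult)
    qed (use assms in \<open>simp add: zero_less_mult_iff\<close>)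
  qed
  also have "\<dots> = ennreal (2 * a powr (\<sigma> - 2)) * (\<integral>\<^sup>+y. ennreal (?j y) \<partial>lborel)"
    by (rule nn_integral_cmult) auto
  also have "(\<integral>\<^sup>+y. ennreal (?j y) \<partial>lborel) = ennreal ?J"
    by (rule nn_integral_has_integral_lebesgue[OF _ integral_powr_over_one_plus_square(1)]) (use assms in auto)
  also have "ennreal (2 * a powr (\<sigma> - 2)) * ennreal ?J = ennreal (2 * a powr (\<sigma> - 2) * ?J)"
    by (rule ennreal_mult[symmetric]) (use c in auto)
  also have "ennreal \<bar>a\<bar> * ennreal (2 * a powr (\<sigma> - 2) * ?J) = ennreal (\<bar>a\<bar> * (2 * a powr (\<sigma> - 2) * ?J))"
    by (rule ennreal_mult[symmetric]) (use c in auto)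
  also have "\<bar>a\<bar> = a" using assms by simp
  also have "a * (2 * a powr (\<sigma> - 2) * ?J) = 2 * (a * a powr (\<sigma> - 2)) * ?J" by simp
  also have "a * a powr (\<sigma> - 2) = a powr (\<sigma> - 1)" using assms by (simp add: powr_mult_base)
  finally show ?thesis .
qed

text \<open>Insert the series of \<open>hbose_sums\<close> into the Mellin integral and integrate
  termwise. Scaling by a = 2 pi (n + 1) makes each term a multiple of
  \<open>a powr (\<sigma> - 1)\<close>, which is how the reflected argument 1 - \<sigma>
  arises.\<close>

lemma RI_eq_series:
  assumes "-1 < \<sigma>" "\<sigma> < 0"
  shows "RI \<sigma> + 1 / (\<sigma> - 1) - 1 / (2 * \<sigma>) = (2 * pi) powr \<sigma> / (2 * cos (pi * \<sigma> / 2)) * rzeta (1 - \<sigma>)"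
proof -
  let ?J = "pi / (2 * cos (pi * \<sigma> / 2))"
  have c: "cos (pi * \<sigma> / 2) > 0" using integral_powr_over_one_plus_square(2)[of \<sigma>] assms by simp
  then have J: "?J > 0" by simp
  have "(\<lambda>n. (2 * (2 * pi) powr (\<sigma> - 1) * ?J) * real (Suc n) powr (- (1 - \<sigma>))) sums ((2 * (2 * pi) powr (\<sigma> - 1) * ?J) * rzeta (1 - \<sigma>))"
    by (intro sums_mult rzeta) (use assms in simp)
  then have sm: "(\<lambda>n. 2 * (2 * pi * real (Suc n)) powr (\<sigma> - 1) * ?J) sums ((2 * (2 * pi) powr (\<sigma> - 1) * ?J) * rzeta (1 - \<sigma>))"
    by (simp add: powr_mult mult_ac del: of_nat_Suc)
  have "(\<integral>\<^sup>+x. ennreal (indicator {0<..} x * (hbose x * x powr (\<sigma> - 1))) \<partial>lborel)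
      = (\<integral>\<^sup>+x. (\<Sum>n. ennreal (indicator {0<..} x * (2 * x / (x\<^sup>2 + (2 * pi * real (Suc n))\<^sup>2) * x powr (\<sigma> - 1)))) \<partial>lborel)"
  proof (rule nn_integral_cong)
    fix x :: real
    have "(\<lambda>n. 2 * x / (x\<^sup>2 + (2 * pi * real (Suc n))\<^sup>2) * x powr (\<sigma> - 1)) sums (hbose x * x powr (\<sigma> - 1))" if "x > 0"
      by (intro sums_mult2 hbose_sums that)
    then show "ennreal (indicator {0<..} x * (hbose x * x powr (\<sigma> - 1)))
      = (\<Sum>n. ennreal (indicator {0<..} x * (2 * x / (x\<^sup>2 + (2 * pi * real (Suc n))\<^sup>2) * x powr (\<sigma> - 1))))"
      by (cases "x > 0") (auto intro!: ennreal_suminf_sums[symmetric] simp del: of_nat_Suc)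
  qed
  also have "\<dots> = (\<Sum>n. \<integral>\<^sup>+x. ennreal (indicator {0<..} x * (2 * x / (x\<^sup>2 + (2 * pi * real (Suc n))\<^sup>2) * x powr (\<sigma> - 1))) \<partial>lborel)"
    by (rule nn_integral_suminf) auto
  also have "\<dots> = (\<Sum>n. ennreal (2 * (2 * pi * real (Suc n)) powr (\<sigma> - 1) * ?J))"
    by (intro suminf_cong nn_integral_scaled_kernel assms) (simp del: of_nat_Suc)
  also have "\<dots> = ennreal ((2 * (2 * pi) powr (\<sigma> - 1) * ?J) * rzeta (1 - \<sigma>))"
    by (rule ennreal_suminf_sums[OF sm]) (use c in auto)
  finally have "has_bochner_integral lborel (\<lambda>x. indicator {0<..} x * (hbose x * x powr (\<sigma> - 1)))
      ((2 * (2 * pi) powr (\<sigma> - 1) * ?J) * rzeta (1 - \<sigma>))"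
  proof (rule has_bochner_integral_nn_integral[rotated 3])
    show "0 \<le> (2 * (2 * pi) powr (\<sigma> - 1) * ?J) * rzeta (1 - \<sigma>)"
      by (rule sums_le[OF _ sums_zero sm]) (use c in auto)
    show "AE x in lborel. 0 \<le> indicator {0<..} x * (hbose x * x powr (\<sigma> - 1))"
      using hbose_bounds(1) by (auto simp: indicator_def)
  qed auto
  from has_bochner_integral_eq[OF RI_lt_0[OF assms] this]
  have "RI \<sigma> + 1 / (\<sigma> - 1) - 1 / (2 * \<sigma>) = 2 * (2 * pi) powr (\<sigma> - 1) * ?J * rzeta (1 - \<sigma>)" .
  also have "2 * (2 * pi) powr (\<sigma> - 1) * ?J = (2 * pi * (2 * pi) powr (\<sigma> - 1)) / (2 * cos (pi * \<sigma> / 2))"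
    by simp
  also have "2 * pi * (2 * pi) powr (\<sigma> - 1) = (2 * pi) powr \<sigma>" by (subst powr_mult_base) auto
  finally show ?thesis .
qed

text \<open>The holomorphic extension of \<open>RI\<close>, in the form required by
  \<open>laplace_holomorphic\<close>: the factor \<open>x powr (s - 1)\<close> is split into exp (s
  ln x) and a weight 1/x.\<close>

definition CI :: "complex \<Rightarrow> complex" where
  "CI s = (\<integral>x. complex_of_real (indicator {0<..<1} x * hbose x / x) * exp (s * ln x) \<partial>lborel)
      + (\<integral>x. complex_of_real (indicator {1..} x / (exp x - 1) / x) * exp (s * ln x) \<partial>lborel)"

lemma CI_integrands:
  "norm (complex_of_real (indicator {0<..<1} x * hbose x / x)) * exp (\<sigma> * ln x) = indicator {0<..<1} x * (hbose x * x powr (\<sigma> - 1))"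
  "norm (complex_of_real (indicator {1..} x / (exp x - 1) / x)) * exp (\<sigma> * ln x) = indicator {1..} x * (x powr (\<sigma> - 1) / (exp x - 1))"
proof -
  have e: "exp (\<sigma> * ln x) = x * x powr (\<sigma> - 1)" if "x > 0"
    using that by (simp add: powr_mult_base) (simp add: powr_def)
  show "norm (complex_of_real (indicator {0<..<1} x * hbose x / x)) * exp (\<sigma> * ln x) = indicator {0<..<1} x * (hbose x * x powr (\<sigma> - 1))"
    using hbose_bounds(1)[of x] e by (auto simp: indicator_def norm_mult norm_divide)
  show "norm (complex_of_real (indicator {1..} x / (exp x - 1) / x)) * exp (\<sigma> * ln x) = indicator {1..} x * (x powr (\<sigma> - 1) / (exp x - 1))"
    using e by (auto simp: indicator_def norm_mult norm_divide simp flip: of_real_diff of_real_divide exp_of_real)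
qed

lemma CI_holomorphic: "CI holomorphic_on {s. Re s \<in> {-1<..}}"
  unfolding CI_def
proof (intro holomorphic_on_add laplace_holomorphic, unfold CI_integrands)
  fix \<sigma> :: real assume "\<sigma> \<in> {-1<..}"
  then show "integrable lborel (\<lambda>x. indicator {0<..<1} x * (hbose x * x powr (\<sigma> - 1)))"
    by (intro hbose_0_1_integrable) simp
  show "integrable lborel (\<lambda>x::real. indicator {1..} x * (x powr (\<sigma> - 1) / (exp x - 1)))"
    by (rule bose_1_inf_integrable)
qed auto

lemma CI_of_real: "CI (of_real \<sigma>) = of_real (RI \<sigma>)"
proof -
  have nn: "0 \<le> indicator {0<..<1} x * hbose x / x" "0 \<le> indicator {1..} x / (exp x - 1) / x" for x :: real
    using hbose_bounds(1)[of x] by (auto simp: indicator_def)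
  have e: "complex_of_real u * exp (complex_of_real \<sigma> * ln x) = of_real (norm (complex_of_real u) * exp (\<sigma> * ln x))" if "0 \<le> u" for u x :: real
    using that by (simp add: exp_of_real[symmetric])
  show ?thesis
    unfolding CI_def RI_def e[OF nn(1)] e[OF nn(2)] CI_integrands by (simp only: integral_complex_of_real of_real_add)
qed

text \<open>This is \<open>RI_gt_1\<close> multiplied by s (s - 1). With s \<Gamma>(s) = \<Gamma>(s
  + 1) both sides become holomorphic across 0 and 1, so the identity extends from the interval (1,
  2) to the half-plane.\<close>

lemma zeta_reg_eq_CI:
  assumes "Re s > -1"
  shows "Gamma (s + 1) * zeta_reg s = s * (s - 1) * CI s + s - (s - 1) / 2"
proof (rule analytic_continuation_real[where S = "{s. Re s > -1}" and a = 1 and b = 2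
      and f = "\<lambda>s. Gamma (s + 1) * zeta_reg s" and g = "\<lambda>s. s * (s - 1) * CI s + s - (s - 1) / 2"])
  show "(\<lambda>s. Gamma (s + 1) * zeta_reg s) holomorphic_on {s. Re s > -1}"
    by (intro holomorphic_intros zeta_reg_holomorphic) (auto intro!: not_nonpos_Int_Re_pos)
  show "(\<lambda>s. s * (s - 1) * CI s + s - (s - 1) / 2) holomorphic_on {s. Re s > -1}"
    using CI_holomorphic by (intro holomorphic_intros) auto
  show "connected {s. Re s > -1}" by (intro convex_connected convex_halfspace_Re_gt)
  fix x :: real assume x: "1 < x" "x < 2"
  have "Gamma (complex_of_real x + 1) * zeta_reg (of_real x) = of_real (x * (x - 1) * (Gamma x * rzeta x))"
    using x rzeta(2)[of x] by (simp add: zeta_reg_def Gamma_plus1[OF not_nonpos_Int_Re_pos] Gamma_complex_of_real)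
  also have "\<dots> = of_real (x * (x - 1) * RI x + x - (x - 1) / 2)"
    unfolding of_real_eq_iff RI_gt_1[OF x(1)] using x by (simp add: field_simps)
  finally show "complex_of_real x \<in> {s. -1 < Re s} \<and> Gamma (complex_of_real x + 1) * zeta_reg (complex_of_real x) =
         complex_of_real x * (complex_of_real x - 1) * CI (complex_of_real x) + complex_of_real x - (complex_of_real x - 1) / 2"
    using x by (simp add: CI_of_real)
qed (use assms in \<open>auto intro: open_halfspace_Re_gt\<close>)

section \<open>Comparison of the two evaluations and continuation\<close>

lemma holomorphic_zeta [holomorphic_intros]: "1 \<notin> A \<Longrightarrow> zeta holomorphic_on A"
  using zeta_holomorphic holomorphic_on_subset by blast

lemma holomorphic_zeta_reflect [holomorphic_intros]:
  assumes "0 \<notin> A" shows "(\<lambda>s. zeta (1 - s)) holomorphic_on A"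
proof -
  have "(zeta \<circ> (\<lambda>s. 1 - s)) holomorphic_on A"
    by (rule holomorphic_on_compose_gen[OF _ zeta_holomorphic]) (use assms in \<open>auto intro!: holomorphic_intros\<close>)
  then show ?thesis by (simp add: o_def)
qed

text \<open>On the real segment from -1 to 0 the same quantity is known twice: as \<Gamma>\<zeta>
  through \<open>zeta_reg_eq_CI\<close>, and as a zeta series at 1 - x through
  \<open>RI_eq_series\<close>.\<close>

lemma zeta_functional_equation_strip:
  assumes "-1 < Re s" "Re s < 0"
  shows "2 * cos (of_real pi * s / 2) * Gamma s * zeta s = of_real (2 * pi) powr s * zeta (1 - s)"
proof (rule analytic_continuation_real[where S = "{s. -1 < Re s \<and> Re s < 0}" and a = "-1" and b = 0
      and f = "\<lambda>s. 2 * cos (of_real pi * s / 2) * Gamma s * zeta s" and g = "\<lambda>s. of_real (2 * pi) powr s * zeta (1 - s)"])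
  have nn: "s \<notin> \<int>\<^sub>\<le>\<^sub>0" if "-1 < Re s" "Re s < 0" for s
    using that by (auto elim!: nonpos_Ints_cases)
  have sub: "1 \<notin> {s. -1 < Re s \<and> Re s < 0}" "0 \<notin> {s. -1 < Re s \<and> Re s < 0}" by auto
  show "(\<lambda>s. 2 * cos (of_real pi * s / 2) * Gamma s * zeta s) holomorphic_on {s. -1 < Re s \<and> Re s < 0}"
    by (intro holomorphic_intros sub) (use nn in auto)
  show "(\<lambda>s. of_real (2 * pi) powr s * zeta (1 - s)) holomorphic_on {s. -1 < Re s \<and> Re s < 0}"
    by (intro holomorphic_intros sub)
  have "{s. -1 < Re s \<and> Re s < 0} = {s. Re s > -1} \<inter> {s. Re s < 0}" by auto
  then show "connected {s. -1 < Re s \<and> Re s < 0}" "open {s. -1 < Re s \<and> Re s < 0}"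
    by (auto intro!: convex_connected convex_Int convex_halfspace_Re_gt convex_halfspace_Re_lt open_Int
          open_halfspace_Re_gt open_halfspace_Re_lt)
  fix x :: real assume x: "-1 < x" "x < 0"
  let ?x = "complex_of_real x"
  have c: "cos (pi * x / 2) > 0" using integral_powr_over_one_plus_square(2)[of x] x by simp
  have G1: "Gamma (?x + 1) = ?x * Gamma ?x"
    by (rule Gamma_plus1) (use nn[of ?x] x in auto)
  have "?x * (?x - 1) * (Gamma ?x * zeta ?x) = Gamma (?x + 1) * zeta_reg ?x"
    using x by (simp add: G1 zeta_reg_def)
  also have "\<dots> = of_real (x * (x - 1) * (RI x + 1 / (x - 1) - 1 / (2 * x)))"
  proof -
    have "x * (x - 1) * (RI x + 1 / (x - 1) - 1 / (2 * x)) = x * (x - 1) * RI x + x - (x - 1) / 2"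
      using x by (simp add: field_simps)
    then show ?thesis using zeta_reg_eq_CI[of ?x] x by (simp add: CI_of_real)
  qed
  also have "\<dots> = ?x * (?x - 1) * of_real ((2 * pi) powr x / (2 * cos (pi * x / 2)) * rzeta (1 - x))"
    unfolding RI_eq_series[OF x] by simp
  finally have *: "?x * (?x - 1) * (Gamma ?x * zeta ?x)
      = ?x * (?x - 1) * of_real ((2 * pi) powr x / (2 * cos (pi * x / 2)) * rzeta (1 - x))" .
  have "?x * (?x - 1) \<noteq> 0" using x by auto
  from mult_left_cancel[OF this, THEN iffD1, OF *]
  have "Gamma ?x * zeta ?x = of_real ((2 * pi) powr x / (2 * cos (pi * x / 2)) * rzeta (1 - x))"
    .
  then have "2 * of_real (cos (pi * x / 2)) * (Gamma ?x * zeta ?x) = of_real ((2 * pi) powr x * rzeta (1 - x))"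
    using c by simp
  moreover have "complex_of_real (2 * pi) powr ?x = of_real ((2 * pi) powr x)"
    by (rule powr_of_real) simp
  moreover have "zeta (1 - ?x) = of_real (rzeta (1 - x))"
    using rzeta(2)[of "1 - x"] x by simp
  moreover have "cos (of_real pi * ?x / 2) = of_real (cos (pi * x / 2))"
    using cos_of_real[of "pi * x / 2", where 'a = complex] by simp
  ultimately show "?x \<in> {s. -1 < Re s \<and> Re s < 0} \<and>
      2 * cos (of_real pi * ?x / 2) * Gamma ?x * zeta ?x = of_real (2 * pi) powr ?x * zeta (1 - ?x)"
    using x by (simp add: mult.assoc)
qed (use assms in auto)

theorem zeta_functional_equation:
  assumes "Im s > 0"
  shows "2 * cos (of_real pi * s / 2) * Gamma s * zeta s = of_real (2 * pi) powr s * zeta (1 - s)"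
proof (rule analytic_continuation_open[where s = "{s. -1 < Re s \<and> Re s < 0 \<and> Im s > 0}" and s' = "{s. Im s > 0}"
      and f = "\<lambda>s. 2 * cos (of_real pi * s / 2) * Gamma s * zeta s" and g = "\<lambda>s. of_real (2 * pi) powr s * zeta (1 - s)"])
  have nn: "s \<notin> \<int>\<^sub>\<le>\<^sub>0" if "Im s > 0" for s
    using that by (auto elim!: nonpos_Ints_cases)
  have sub: "1 \<notin> {s. Im s > 0}" "0 \<notin> {s. Im s > 0}" by auto
  show "(\<lambda>s. 2 * cos (of_real pi * s / 2) * Gamma s * zeta s) holomorphic_on {s. Im s > 0}"
    by (intro holomorphic_intros sub) (use nn in auto)
  show "(\<lambda>s. of_real (2 * pi) powr s * zeta (1 - s)) holomorphic_on {s. Im s > 0}"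
    by (intro holomorphic_intros sub)
  have "Complex (-1/2) 1 \<in> {s. -1 < Re s \<and> Re s < 0 \<and> Im s > 0}" by simp
  then show "{s. -1 < Re s \<and> Re s < 0 \<and> Im s > 0} \<noteq> {}" by blast
  show "connected {s. Im s > 0}" by (intro convex_connected convex_halfspace_Im_gt)
  have "{s. -1 < Re s \<and> Re s < 0 \<and> Im s > 0} = {s. Re s > -1} \<inter> {s. Re s < 0} \<inter> {s. Im s > 0}" by auto
  then show "open {s. -1 < Re s \<and> Re s < 0 \<and> Im s > 0}"
    by (auto intro!: open_Int open_halfspace_Re_gt open_halfspace_Re_lt open_halfspace_Im_gt)
qed (use assms zeta_functional_equation_strip in \<open>auto intro: open_halfspace_Im_gt\<close>)


section \<open>Bounds left of the critical line\<close>

lemma cos_half_pi_nonzero: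
  assumes "Im s > 0"
  shows "cos (of_real pi * s / 2) \<noteq> 0"
proof
  assume "cos (of_real pi * s / 2) = 0"
  then obtain n :: int where "of_real pi * s / 2 = of_real (of_int n * pi) + of_real pi / 2"
    using cos_eq_0 by blast
  then have "Im (of_real pi * s / 2) = 0" by (simp add: of_real_divide[symmetric] del: of_real_divide)
  then show False using assms by simp
qed

lemma Im_pos_not_nonpos_Int: "Im s > 0 \<Longrightarrow> s \<notin> \<int>\<^sub>\<le>\<^sub>0"
  by (auto elim!: nonpos_Ints_cases)

lemma zeta_zero_reflect:
  assumes "Im s > 0"
  shows "zeta s = 0 \<longleftrightarrow> zeta (1 - s) = 0"
proof -
  have "cos (of_real pi * s / 2) * Gamma s \<noteq> 0"
    using cos_half_pi_nonzero[OF assms] Im_pos_not_nonpos_Int[OF assms] by (simp add: Gamma_eq_zero_iff)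
  moreover have "of_real (2 * pi) powr s \<noteq> 0" by simp
  ultimately show ?thesis using zeta_functional_equation[OF assms] by auto
qed

text \<open>Valid at zeros as well: they are reflected to zeros, and 1 / 0 = 0 on both
  sides.\<close>

lemma norm_inverse_zeta_reflect:
  assumes "Im s > 0"
  shows "norm (1 / zeta s) = norm (2 * cos (of_real pi * s / 2) * Gamma s) / (2 * pi) powr Re s * norm (1 / zeta (1 - s))"
proof (cases "zeta s = 0")
  case True
  then show ?thesis using zeta_zero_reflect[OF assms] by simp
next
  case False
  then have nz: "zeta (1 - s) \<noteq> 0" using zeta_zero_reflect[OF assms] by simp
  have p: "norm (of_real (2 * pi) powr s :: complex) = (2 * pi) powr Re s"
    using norm_powr_real_powr[of "of_real (2 * pi)" s] by simp
  have "norm (2 * cos (of_real pi * s / 2) * Gamma s) * norm (zeta s) = (2 * pi) powr Re s * norm (zeta (1 - s))"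
    unfolding p[symmetric] norm_mult[symmetric] using zeta_functional_equation[OF assms] by simp
  then show ?thesis using False nz by (simp add: norm_divide field_simps)
qed

lemma cos_times_Gamma_half_le:
  assumes "Im s \<ge> 0"
  shows "norm (cos (of_real pi * s / 2)) * norm (Gamma (Complex (1/2) (Im s))) \<le> sqrt (2 * pi)"
proof (rule real_le_rsqrt)
  have "norm (cos (of_real pi * s / 2)) \<le> (exp (- (pi * Im s / 2)) + exp (pi * Im s / 2)) / 2"
    unfolding cos_exp_eq norm_divide using norm_triangle_ineq[of "exp (\<i> * (of_real pi * s / 2))" "exp (- (\<i> * (of_real pi * s / 2)))"]
    by simp
  also have "\<dots> \<le> exp (pi * Im s / 2)" using assms by simp
  finally have "(norm (cos (of_real pi * s / 2)))\<^sup>2 \<le> (exp (pi * Im s / 2))\<^sup>2" by (intro power_mono) auto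
  also have "\<dots> = exp (pi * Im s)" by (simp add: power2_eq_square flip: exp_add)
  also have "\<dots> \<le> 2 * cosh (pi * Im s)" by (simp add: cosh_def)
  finally have 1: "(norm (cos (of_real pi * s / 2)))\<^sup>2 \<le> 2 * cosh (pi * Im s)" .
  have "(norm (cos (of_real pi * s / 2)) * norm (Gamma (Complex (1/2) (Im s))))\<^sup>2
      = (norm (cos (of_real pi * s / 2)))\<^sup>2 * (pi / cosh (pi * Im s))"
    by (simp add: power_mult_distrib cmod_Gamma_half)
  also have "\<dots> \<le> 2 * cosh (pi * Im s) * (pi / cosh (pi * Im s))"
    by (intro mult_right_mono 1) (simp add: cosh_real_nonneg)
  also have "\<dots> = 2 * pi" using cosh_real_pos[of "pi * Im s"] by simp
  finally show "(norm (cos (of_real pi * s / 2)) * norm (Gamma (Complex (1/2) (Im s))))\<^sup>2 \<le> 2 * pi" .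
qed

lemma inverse_zeta_left_line:
  obtains C where "C > 0" "\<And>y. y > 0 \<Longrightarrow> norm (1 / zeta (Complex (-1/2) y)) \<le> C / y"
proof -
  obtain B where B: "B > 0" "\<And>s. Re s \<ge> 3/2 \<Longrightarrow> norm (1 / zeta s) \<le> B"
    using norm_inverse_zeta_le[of "3/2"] by auto
  define C where "C = 2 * sqrt (2 * pi) / (2 * pi) powr (-1/2) * B"
  have "norm (1 / zeta (Complex (-1/2) y)) \<le> C / y" if y: "y > 0" for y
  proof -
    let ?s = "Complex (-1/2) y"
    have "Complex (1/2) y = ?s + 1" by (simp add: complex_eq_iff)
    then have "Gamma (Complex (1/2) y) = ?s * Gamma ?s"
      using Gamma_plus1[of ?s] Im_pos_not_nonpos_Int[of ?s] y by simp
    moreover have "norm ?s \<ge> y" using abs_Im_le_cmod[of ?s] y by simp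
    ultimately have "y * norm (Gamma ?s) \<le> norm (Gamma (Complex (1/2) y))"
      by (simp add: norm_mult mult_right_mono)
    then have G: "norm (Gamma ?s) \<le> norm (Gamma (Complex (1/2) y)) / y" using y by (simp add: field_simps)
    have "norm (cos (of_real pi * ?s / 2)) * norm (Gamma ?s)
        \<le> norm (cos (of_real pi * ?s / 2)) * (norm (Gamma (Complex (1/2) y)) / y)"
      by (intro mult_left_mono G) auto
    also have "\<dots> \<le> sqrt (2 * pi) / y"
      using cos_times_Gamma_half_le[of ?s] y by (simp add: divide_right_mono)
    finally have 1: "norm (2 * cos (of_real pi * ?s / 2) * Gamma ?s) \<le> 2 * sqrt (2 * pi) / y"
      by (simp add: norm_mult)
    have "norm (1 / zeta ?s) = norm (2 * cos (of_real pi * ?s / 2) * Gamma ?s) / (2 * pi) powr Re ?s * norm (1 / zeta (1 - ?s))"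
      by (rule norm_inverse_zeta_reflect) (use y in simp)
    also have "\<dots> \<le> (2 * sqrt (2 * pi) / y) / (2 * pi) powr Re ?s * B"
      by (rule mult_mono[OF divide_right_mono[OF 1]]) (use B y in auto)
    finally have "norm (1 / zeta ?s) \<le> (2 * sqrt (2 * pi) / y) / (2 * pi) powr Re ?s * B" .
    then show ?thesis by (simp add: C_def field_simps)
  qed
  moreover have "C > 0" using B by (simp add: C_def)
  ultimately show ?thesis using that by blast
qed

lemma inverse_zeta_reflect_bound:
  obtains C where "C > 0"
    "\<And>s. -1/2 \<le> Re s \<Longrightarrow> Re s \<le> 1/2 \<Longrightarrow> Im s \<ge> 1 \<Longrightarrow> norm (1 / zeta s) \<le> C * norm (1 / zeta (1 - s))"
proof -
  have "compact (Gamma ` {1/2..3/2::real})"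
    by (intro compact_continuous_image continuous_on_Gamma) (auto elim!: nonpos_Ints_cases)
  then obtain M where M: "\<And>x. x \<in> {1/2..3/2::real} \<Longrightarrow> norm (Gamma x) \<le> M"
    by (metis compact_imp_bounded bounded_iff imageI)
  have M0: "M > 0" using M[of 1] by simp
  define C where "C = 2 * (sqrt (2 * pi) * (2 * M / Gamma (3/2))) / (2 * pi) powr (-1/2)"
  have G32: "Gamma (3/2 :: real) > 0" by (intro Gamma_real_pos) auto
  have "norm (1 / zeta s) \<le> C * norm (1 / zeta (1 - s))" if s: "-1/2 \<le> Re s" "Re s \<le> 1/2" "Im s \<ge> 1" for s
  proof -
    define y where "y = Im s"
    have y: "y \<ge> 1" using s by (simp add: y_def)
    have "s + 1 = Complex (Re s + 1) y" by (simp add: complex_eq_iff y_def)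
    then have "Gamma (Complex (Re s + 1) y) = s * Gamma s"
      using Gamma_plus1[of s] Im_pos_not_nonpos_Int[of s] s by simp
    moreover have "norm s \<ge> y" using abs_Im_le_cmod[of s] by (simp add: y_def)
    ultimately have "y * norm (Gamma s) \<le> norm (Gamma (Complex (Re s + 1) y))"
      by (simp add: norm_mult mult_right_mono)
    also have "\<dots> \<le> Gamma (Re s + 1) * (norm (Gamma (Complex (3/2) y)) / Gamma (3/2))"
      using cmod_Gamma_quotient_mono[of "Re s + 1" "3/2" y] s Gamma_real_pos[of "Re s + 1"]
      by (simp add: field_simps)
    also have "\<dots> \<le> M * (norm (Gamma (Complex (3/2) y)) / Gamma (3/2))"
      using M[of "Re s + 1"] s G32 by (intro mult_right_mono) auto
    also have "norm (Gamma (Complex (3/2) y)) \<le> 2 * y * norm (Gamma (Complex (1/2) y))"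
    proof -
      let ?h = "Complex (1/2) y"
      have "Complex (3/2) y = ?h + 1" by (simp add: complex_eq_iff)
      then have "Gamma (Complex (3/2) y) = ?h * Gamma ?h"
        using Gamma_plus1[of ?h] Im_pos_not_nonpos_Int[of ?h] y by simp
      moreover have "norm ?h \<le> 2 * y" using cmod_le[of ?h] y by simp
      ultimately show ?thesis by (simp add: norm_mult mult_right_mono)
    qed
    finally have "y * norm (Gamma s) \<le> M * (2 * y * norm (Gamma (Complex (1/2) y)) / Gamma (3/2))"
      using M0 G32 by (simp add: divide_right_mono mult_left_mono)
    then have G: "norm (Gamma s) \<le> (2 * M / Gamma (3/2)) * norm (Gamma (Complex (1/2) y))"
      using y G32 by (simp add: field_simps)
    have "norm (cos (of_real pi * s / 2)) * norm (Gamma s)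
        \<le> norm (cos (of_real pi * s / 2)) * ((2 * M / Gamma (3/2)) * norm (Gamma (Complex (1/2) y)))"
      by (intro mult_left_mono G) auto
    also have "\<dots> = (norm (cos (of_real pi * s / 2)) * norm (Gamma (Complex (1/2) y))) * (2 * M / Gamma (3/2))" by simp
    also have "\<dots> \<le> sqrt (2 * pi) * (2 * M / Gamma (3/2))"
      using cos_times_Gamma_half_le[of s] y M0 G32 by (intro mult_right_mono) (auto simp: y_def)
    finally have 1: "norm (2 * cos (of_real pi * s / 2) * Gamma s) \<le> 2 * (sqrt (2 * pi) * (2 * M / Gamma (3/2)))"
      by (simp add: norm_mult)
    have "(2 * pi) powr (-1/2) \<le> (2 * pi) powr Re s"
      using s pi_gt3 by (intro powr_mono) auto
    then have "norm (2 * cos (of_real pi * s / 2) * Gamma s) / (2 * pi) powr Re s \<le> C"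
      unfolding C_def using 1 M0 G32 by (intro frac_le) auto
    from mult_right_mono[OF this norm_ge_zero[of "1 / zeta (1 - s)"]]
    have "norm (2 * cos (of_real pi * s / 2) * Gamma s) / (2 * pi) powr Re s * norm (1 / zeta (1 - s)) \<le> C * norm (1 / zeta (1 - s))" .
    moreover have "Im s > 0" using s by simp
    ultimately show ?thesis unfolding norm_inverse_zeta_reflect[OF \<open>Im s > 0\<close>] by blast
  qed
  moreover have "C > 0" using M0 G32 by (simp add: C_def)
  ultimately show ?thesis using that by blast
qed

text \<open>Apply \<open>cmod_Gamma_shift_le\<close> at z = s + 1, whose real part is at least 3/2;
  the constant 3 is rounded up to 4 before taking the square root. Uniformity in \<delta> matters,
  since \<delta> tends to 0 in the end.\<close>

lemma cmod_Beta_ge: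
  assumes "0 \<le> \<delta>" "\<delta> \<le> 1" "Re s \<ge> 1/2"
  shows "cmod (Beta s (of_real (1 + \<delta>))) \<ge> Gamma (1 + \<delta>) / (2 * cmod s * cmod (s + 1) powr \<delta>)"
proof -
  have "Re (s + 1) \<noteq> 0" using assms by simp
  then have s0: "s \<noteq> 0" "s + 1 \<noteq> 0" using assms by force+
  have G0: "Gamma s \<noteq> 0" "Gamma (s + 1 + of_real \<delta>) \<noteq> 0"
    using assms by (auto simp: Gamma_eq_zero_iff intro!: not_nonpos_Int_Re_pos)
  have Gd: "Gamma (1 + \<delta>) > 0" using assms by (intro Gamma_real_pos) auto
  have "(cmod (Gamma (s + 1 + of_real \<delta>)))\<^sup>2 \<le> 3 * ((cmod (s + 1))\<^sup>2) powr \<delta> * (cmod (Gamma (s + 1)))\<^sup>2"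
    by (rule cmod_Gamma_shift_le) (use assms in auto)
  also have "\<dots> \<le> 4 * ((cmod (s + 1))\<^sup>2) powr \<delta> * (cmod (Gamma (s + 1)))\<^sup>2"
    by (intro mult_right_mono) auto
  also have "\<dots> = (2 * cmod (s + 1) powr \<delta> * cmod (Gamma (s + 1)))\<^sup>2"
    using s0 by (simp add: power_mult_distrib power2_eq_square powr_mult)
  finally have "cmod (Gamma (s + 1 + of_real \<delta>)) \<le> 2 * cmod (s + 1) powr \<delta> * cmod (Gamma (s + 1))"
    by (rule power2_le_imp_le) simp
  also have "Gamma (s + 1) = s * Gamma s"
    using assms by (intro Gamma_plus1 not_nonpos_Int_Re_pos) auto
  finally have 1: "cmod (Gamma (s + 1 + of_real \<delta>)) \<le> 2 * cmod (s + 1) powr \<delta> * (cmod s * cmod (Gamma s))"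
    by (simp add: norm_mult)
  have "cmod (Beta s (of_real (1 + \<delta>))) = cmod (Gamma s) * Gamma (1 + \<delta>) / cmod (Gamma (s + 1 + of_real \<delta>))"
  proof -
    have "Gamma (complex_of_real (1 + \<delta>)) = of_real (Gamma (1 + \<delta>))" by (rule Gamma_complex_of_real)
    moreover have "s + complex_of_real (1 + \<delta>) = s + 1 + of_real \<delta>" by simp
    ultimately show ?thesis using Gd by (simp only: Beta_def norm_divide norm_mult norm_of_real abs_of_pos)
  qed
  also have "\<dots> \<ge> cmod (Gamma s) * Gamma (1 + \<delta>) / (2 * cmod (s + 1) powr \<delta> * (cmod s * cmod (Gamma s)))"
    using 1 G0 s0 Gd by (intro divide_left_mono) auto
  finally show ?thesis using G0 s0 by (simp add: field_simps)
qed


section \<open>The Mellin transform of the weighted Moebius sum\<close>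

text \<open>Writing \<open>y powr (- s)\<close> as \<open>exp (s * lg y)\<close> with \<open>lg \<le> 0\<close> everywhere puts Mellin transforms of
  functions supported on \<open>[1, \<infinity>)\<close> into the form required by \<open>landau_laplace\<close>.\<close>

definition lg :: "real \<Rightarrow> real" where
  "lg y = - ln (max 1 y)"

lemma lg_measurable [measurable]: "lg \<in> borel_measurable borel"
  unfolding lg_def by measurable

lemma lg_le_0: "lg y \<le> 0"
  by (simp add: lg_def)

lemma lg_eq: "y \<ge> 1 \<Longrightarrow> lg y = - ln y"
  by (simp add: lg_def)

lemma exp_lg: "y \<ge> 1 \<Longrightarrow> exp (\<sigma> * lg y) / y = y powr (- \<sigma> - 1)"
  by (simp add: lg_eq powr_diff) (simp add: powr_def)

section \<open>Mellin transforms of powers and of the Riesz kernels\<close>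

lemma integrable_powr_lg:
  assumes "\<sigma> > a"
  shows "has_bochner_integral lborel (\<lambda>y. indicator {1..} y * (y powr a / y) * exp (\<sigma> * lg y)) (1 / (\<sigma> - a))"
proof -
  have "has_bochner_integral lborel (\<lambda>y::real. indicator {1..} y * (y powr ((a - \<sigma>) - 1))) (- 1 / (a - \<sigma>))"
    by (rule bochner_powr_1_inf) (use assms in simp)
  moreover have "indicator {1..} y * (y powr ((a - \<sigma>) - 1)) = indicator {1..} y * (y powr a / y) * exp (\<sigma> * lg y)" for y :: real
  proof (cases "y \<ge> 1")
    case True
    have "y powr ((a - \<sigma>) - 1) = y powr (a + (- \<sigma> - 1))" by (simp add: algebra_simps)
    also have "\<dots> = y powr a * (exp (\<sigma> * lg y) / y)" unfolding exp_lg[OF True] by (rule powr_add)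
    finally show ?thesis by simp
  qed simp
  moreover have "- 1 / (a - \<sigma>) = 1 / (\<sigma> - a)" using assms by (simp add: field_simps)
  ultimately show ?thesis by simp
qed

lemma laplace_of_real:
  fixes u l :: "real \<Rightarrow> real"
  shows "(\<integral>x. complex_of_real (u x) * exp (complex_of_real \<sigma> * l x) \<partial>lborel) = of_real (\<integral>x. u x * exp (\<sigma> * l x) \<partial>lborel)"
proof -
  have e: "complex_of_real (u x) * exp (complex_of_real \<sigma> * l x) = of_real (u x * exp (\<sigma> * l x))" for x
    by (simp add: exp_of_real[symmetric])
  show ?thesis unfolding e by (rule integral_complex_of_real)
qed

lemma mellin_powr:
  assumes "Re w > a"
  shows "(\<integral>y. complex_of_real (indicator {1..} y * (y powr a / y)) * exp (w * lg y) \<partial>lborel) = 1 / (w - of_real a)"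
proof (rule analytic_continuation_real[where S = "{w. Re w > a}" and a = a and b = "a + 1"
      and g = "\<lambda>w. 1 / (w - of_real a)"
      and f = "\<lambda>w. \<integral>y. complex_of_real (indicator {1..} y * (y powr a / y)) * exp (w * lg y) \<partial>lborel"])
  have "(\<lambda>w. \<integral>y. complex_of_real (indicator {1..} y * (y powr a / y)) * exp (w * lg y) \<partial>lborel) holomorphic_on {w. Re w \<in> {a<..}}"
  proof (rule laplace_holomorphic)
    fix \<sigma> :: real assume "\<sigma> \<in> {a<..}"
    then have "integrable lborel (\<lambda>y. indicator {1..} y * (y powr a / y) * exp (\<sigma> * lg y))"
      using integrable_powr_lg[of a \<sigma>] by (simp add: has_bochner_integral_iff)
    moreover have "norm (complex_of_real (indicator {1..} y * (y powr a / y))) = indicator {1..} y * (y powr a / y)" for y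
      by (auto simp: indicator_def norm_divide)
    ultimately show "integrable lborel (\<lambda>x. norm (complex_of_real (indicator {1..} x * (x powr a / x))) * exp (\<sigma> * lg x))"
      by (simp only:)
  qed auto
  then show "(\<lambda>w. \<integral>y. complex_of_real (indicator {1..} y * (y powr a / y)) * exp (w * lg y) \<partial>lborel) holomorphic_on {w. Re w > a}"
    by simp
  show "(\<lambda>w. 1 / (w - complex_of_real a)) holomorphic_on {w. Re w > a}"
    by (intro holomorphic_intros) auto
  show "connected {w. Re w > a}" by (intro convex_connected convex_halfspace_Re_gt)
  fix x :: real assume x: "a < x" "x < a + 1"
  have "(\<integral>y. indicator {1..} y * (y powr a / y) * exp (x * lg y) \<partial>lborel) = 1 / (x - a)"
    using integrable_powr_lg[OF x(1)] by (simp add: has_bochner_integral_iff)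
  then show "complex_of_real x \<in> {w. a < Re w} \<and>
     (\<integral>y. complex_of_real (indicator {1..} y * (y powr a / y)) * exp (complex_of_real x * lg y) \<partial>lborel) = 1 / (of_real x - of_real a)"
    unfolding laplace_of_real using x by simp
qed (use assms in \<open>auto intro: open_halfspace_Re_gt\<close>)

text \<open>The contribution of one integer n to the Riesz mean, with the 1/y of the measure dy/y
  included. The cutoff at y = n makes sums over n finite for each y.\<close>

definition rkern :: "real \<Rightarrow> nat \<Rightarrow> real \<Rightarrow> real" where
  "rkern \<delta> n y = indicator {real n..} y * ((1 - real n / y) powr \<delta> / y)"

lemma rkern_measurable [measurable]: "rkern \<delta> n \<in> borel_measurable borel"
  unfolding rkern_def by measurable

lemma rkern_nonneg: "rkern \<delta> n y \<ge> 0"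
  by (auto simp: rkern_def indicator_def intro!: divide_nonneg_nonneg)

text \<open>The substitution t = 1/y in Euler's Beta integral.\<close>

lemma integral_rkern_1:
  assumes "\<delta> > 0" "\<sigma> > 0"
  shows "has_bochner_integral lborel (\<lambda>y. rkern \<delta> 1 y * exp (\<sigma> * lg y)) (Beta \<sigma> (1 + \<delta>))"
proof -
  let ?f = "\<lambda>t::real. t powr (\<sigma> - 1) * (1 - t) powr (1 + \<delta> - 1)"
  let ?g = "\<lambda>y::real. inverse y" and ?g' = "\<lambda>y::real. - inverse (y ^ 2)"
  have B: "(?f has_integral Beta \<sigma> (1 + \<delta>)) {0<..<1}"
    using has_integral_Beta_real[of \<sigma> "1 + \<delta>"] assms by (simp add: has_integral_Icc_iff_Ioo)
  have inj: "inj_on ?g {1<..}" by (auto simp: inj_on_def)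
  have img: "?g ` {1<..} = {0<..<1}"
  proof safe
    fix t :: real assume t: "t \<in> {0<..<1}"
    then show "t \<in> ?g ` {1<..}" by (intro image_eqI[of _ _ "inverse t"]) (auto simp: one_less_inverse_iff)
  qed (auto simp: inverse_less_1_iff)
  have "?f absolutely_integrable_on {0<..<1}"
    by (rule nonnegative_absolutely_integrable_1) (use B in auto)
  then have fi: "?f absolutely_integrable_on ?g ` {1<..} \<and> integral (?g ` {1<..}) ?f = Beta \<sigma> (1 + \<delta>)"
    unfolding img using integral_unique[OF B] by blast
  have der: "(?g has_field_derivative ?g' y) (at y within {1<..})" if "y \<in> {1<..}" for y
    using that by (auto intro!: derivative_eq_intros simp: power2_eq_square field_simps)
  have "(\<lambda>y. \<bar>?g' y\<bar> * ?f (?g y)) absolutely_integrable_on {1<..} \<and>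
      integral {1<..} (\<lambda>y. \<bar>?g' y\<bar> * ?f (?g y)) = Beta \<sigma> (1 + \<delta>)"
    by (rule has_absolute_integral_change_of_variables_1'[THEN iffD2, OF _ der inj fi]) auto
  then have 1: "((\<lambda>y. \<bar>?g' y\<bar> * ?f (?g y)) has_integral Beta \<sigma> (1 + \<delta>)) {1<..}"
    by (simp add: has_integral_iff absolutely_integrable_on_def)
  have "has_bochner_integral lborel (\<lambda>y. indicator {1<..} y * (\<bar>?g' y\<bar> * ?f (?g y))) (Beta \<sigma> (1 + \<delta>))"
    by (rule has_bochner_integral_nonneg_has_integral[OF _ _ _ 1]) auto
  moreover have "indicator {1<..} y * (\<bar>?g' y\<bar> * ?f (?g y)) = rkern \<delta> 1 y * exp (\<sigma> * lg y)" for y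
  proof (cases "y > 1")
    case True
    have 1: "\<bar>?g' y\<bar> * ?f (?g y) = (1 - 1 / y) powr \<delta> * (inverse y powr (\<sigma> - 1) * inverse (y\<^sup>2))"
      by (simp add: inverse_eq_divide)
    have "inverse y powr (\<sigma> - 1) = 1 / y powr (\<sigma> - 1)" by (simp add: inverse_eq_divide powr_divide)
    also have "\<dots> = y powr (- (\<sigma> - 1))" by (rule powr_minus_divide[symmetric])
    finally have 2: "inverse y powr (\<sigma> - 1) = y powr (1 - \<sigma>)" by simp
    have 3: "inverse (y\<^sup>2) = y powr (- 2)" using True by (simp add: powr_minus powr_numeral)
    have 4: "y powr (1 - \<sigma>) * y powr (- 2) = exp (\<sigma> * lg y) / y"
      using True by (simp add: powr_add[symmetric] exp_lg minus_diff_commute)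
    have *: "\<bar>?g' y\<bar> * ?f (?g y) = (1 - 1 / y) powr \<delta> * (exp (\<sigma> * lg y) / y)"
      unfolding 1 unfolding 2 3 4 ..
    show ?thesis unfolding * using True by (simp add: rkern_def)
  next
    case False
    then show ?thesis using assms by (cases "y = 1") (auto simp: rkern_def)
  qed
  ultimately show ?thesis by (simp only:)
qed

lemma integral_rkern_1_complex:
  assumes "\<delta> > 0" "Re w > 0"
  shows "integrable lborel (\<lambda>y. complex_of_real (rkern \<delta> 1 y) * exp (w * lg y))"
    and "(\<integral>y. complex_of_real (rkern \<delta> 1 y) * exp (w * lg y) \<partial>lborel) = Beta w (of_real (1 + \<delta>))"
proof -
  have nk: "norm (complex_of_real (rkern \<delta> 1 y)) = rkern \<delta> 1 y" for y
    using rkern_nonneg by simp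
  have int: "integrable lborel (\<lambda>y. norm (complex_of_real (rkern \<delta> 1 y)) * exp (\<sigma> * lg y))" if "\<sigma> > 0" for \<sigma>
    unfolding nk using integral_rkern_1[OF assms(1) that] by (simp add: has_bochner_integral_iff)
  show "integrable lborel (\<lambda>y. complex_of_real (rkern \<delta> 1 y) * exp (w * lg y))"
    by (rule laplace_power_series(3)[where a = w and r = "Re w / 2", OF _ _ int int]) (use assms in auto)
  show "(\<integral>y. complex_of_real (rkern \<delta> 1 y) * exp (w * lg y) \<partial>lborel) = Beta w (of_real (1 + \<delta>))"
  proof (rule analytic_continuation_real[where S = "{w. Re w > 0}" and a = 0 and b = 1
      and g = "\<lambda>w. Beta w (of_real (1 + \<delta>))"
      and f = "\<lambda>w. \<integral>y. complex_of_real (rkern \<delta> 1 y) * exp (w * lg y) \<partial>lborel"])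
    have "(\<lambda>w. \<integral>y. complex_of_real (rkern \<delta> 1 y) * exp (w * lg y) \<partial>lborel) holomorphic_on {w. Re w \<in> {0<..}}"
      by (rule laplace_holomorphic) (use int in auto)
    then show "(\<lambda>w. \<integral>y. complex_of_real (rkern \<delta> 1 y) * exp (w * lg y) \<partial>lborel) holomorphic_on {w. Re w > 0}"
      by simp
    show "(\<lambda>w. Beta w (complex_of_real (1 + \<delta>))) holomorphic_on {w. Re w > 0}"
      unfolding Beta_altdef using assms
      by (intro holomorphic_intros holomorphic_on_compose[OF _ holomorphic_rGamma, unfolded o_def])
         (auto intro!: not_nonpos_Int_Re_pos)
    show "connected {w. Re w > 0}" by (intro convex_connected convex_halfspace_Re_gt)
    fix x :: real assume x: "0 < x" "x < 1"
    have "(\<integral>y. rkern \<delta> 1 y * exp (x * lg y) \<partial>lborel) = Beta x (1 + \<delta>)"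
      using integral_rkern_1[OF assms(1) x(1)] by (simp add: has_bochner_integral_iff)
    then show "complex_of_real x \<in> {w. 0 < Re w} \<and>
       (\<integral>y. complex_of_real (rkern \<delta> 1 y) * exp (complex_of_real x * lg y) \<partial>lborel) = Beta (of_real x) (of_real (1 + \<delta>))"
      unfolding laplace_of_real Beta_complex_of_real using x by simp
  qed (use assms in \<open>auto intro: open_halfspace_Re_gt\<close>)
qed

text \<open>Rescaling by y = n x. Although \<open>lg\<close> is truncated at 1, it obeys the
  logarithm law wherever the kernel is nonzero, since there x \<ge> 1 and n x \<ge> 1.\<close>

lemma integral_rkern:
  assumes "\<delta> > 0" "Re w > 0" "n > 0"
  shows "integrable lborel (\<lambda>y. complex_of_real (rkern \<delta> n y) * exp (w * lg y))" (is ?A)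
    and "(\<integral>y. complex_of_real (rkern \<delta> n y) * exp (w * lg y) \<partial>lborel) = of_nat n powr (- w) * Beta w (of_real (1 + \<delta>))" (is ?B)
proof -
  let ?F = "\<lambda>y. complex_of_real (rkern \<delta> n y) * exp (w * lg y)"
  have e: "?F (0 + real n * x) = of_nat n powr (- w) / of_nat n * (complex_of_real (rkern \<delta> 1 x) * exp (w * lg x))" for x
  proof (cases "x \<ge> 1")
    case True
    have nx: "real n * x \<ge> 1" using mult_mono[of 1 "real n" 1 x] True assms by simp
    have "lg (real n * x) = - ln (real n) + lg x"
      using nx True assms by (simp add: lg_eq ln_mult)
    then have "exp (w * lg (real n * x)) = of_nat n powr (- w) * exp (w * lg x)"
      using assms by (simp add: powr_def right_diff_distrib exp_diff exp_minus divide_inverse Ln_of_nat mult.commute)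
    moreover have "rkern \<delta> n (real n * x) = rkern \<delta> 1 x / real n"
      using True assms by (simp add: rkern_def field_simps)
    ultimately show ?thesis by simp
  next
    case False
    then have "rkern \<delta> n (real n * x) = 0" "rkern \<delta> 1 x = 0" using assms by (auto simp: rkern_def indicator_def)
    then show ?thesis by simp
  qed
  have "integrable lborel (\<lambda>x. ?F (0 + real n * x))"
    unfolding e by (intro integrable_mult_right integral_rkern_1_complex assms)
  then show ?A
    using lborel_integrable_real_affine_iff[of "real n" ?F 0] assms by simp
  have "(\<integral>y. ?F y \<partial>lborel) = \<bar>real n\<bar> *\<^sub>R (\<integral>x. ?F (0 + real n * x) \<partial>lborel)"
    by (rule lborel_integral_real_affine) (use assms in simp)
  also have "\<dots> = of_nat n powr (- w) * Beta w (of_real (1 + \<delta>))"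
    unfolding e using assms by (simp add: integral_rkern_1_complex[OF assms(1,2), simplified] scaleR_conv_of_real)
  finally show ?B .
qed

definition Mo :: "real \<Rightarrow> real \<Rightarrow> real" where
  "Mo \<delta> y = (\<Sum>n | 1 \<le> n \<and> real n \<le> y. moebius_mu n * (1 - real n / y) powr \<delta>)"

lemma finite_nat_le: "finite {n. 1 \<le> n \<and> real n \<le> y}"
  by (rule finite_subset[of _ "{..nat \<lfloor>y\<rfloor>}"]) (auto simp: le_nat_floor)

lemma Mo_sums: "(\<lambda>n. moebius_mu (Suc n) * rkern \<delta> (Suc n) y) sums (Mo \<delta> y / y)"
proof -
  let ?N = "{n. real (Suc n) \<le> y}"
  have img: "Suc ` ?N = {n. 1 \<le> n \<and> real n \<le> y}"
    by (force simp: image_iff dest: Suc_le_D)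
  have "finite (Suc ` ?N)" unfolding img by (rule finite_nat_le)
  then have fin: "finite ?N" by (rule finite_imageD) simp
  have "(\<lambda>n. moebius_mu (Suc n) * rkern \<delta> (Suc n) y) sums (\<Sum>n\<in>?N. moebius_mu (Suc n) * rkern \<delta> (Suc n) y)"
    by (rule sums_finite[OF fin]) (auto simp: rkern_def)
  also have "(\<Sum>n\<in>?N. moebius_mu (Suc n) * rkern \<delta> (Suc n) y) = (\<Sum>n\<in>Suc ` ?N. moebius_mu n * (1 - real n / y) powr \<delta> / y)"
    by (subst sum.reindex) (auto simp: rkern_def intro!: sum.cong)
  also have "\<dots> = Mo \<delta> y / y" unfolding img Mo_def by (simp add: sum_divide_distrib)
  finally show ?thesis .
qed

lemma Mo_measurable [measurable]: "Mo \<delta> \<in> borel_measurable borel"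
proof -
  have "(\<lambda>y. y * (\<Sum>n. moebius_mu (Suc n) * rkern \<delta> (Suc n) y)) \<in> borel_measurable borel"
    by measurable
  moreover have "y * (\<Sum>n. moebius_mu (Suc n) * rkern \<delta> (Suc n) y) = Mo \<delta> y" for y
  proof (cases "y = 0")
    case True
    then have *: "{n. 1 \<le> n \<and> real n \<le> y} = {}" by auto
    have "Mo \<delta> y = 0" unfolding Mo_def * by simp
    then show ?thesis using True by simp
  next
    case False
    then show ?thesis using sums_unique[OF Mo_sums[of \<delta> y]] by (metis nonzero_mult_div_cancel_left times_divide_eq_right)
  qed
  ultimately show ?thesis by simp
qed

text \<open>For Re w > 1 the integrals of the absolute values are at most a multiple of n^(- Re w),
  so the sum over n may be taken outside and yields the Dirichlet series of 1/\<zeta> times one Beta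
  factor.\<close>

lemma mellin_Mo:
  assumes d: "\<delta> > 0" and w: "Re w > 1"
  shows "integrable lborel (\<lambda>y. complex_of_real (Mo \<delta> y / y) * exp (w * lg y))"
    and "(\<integral>y. complex_of_real (Mo \<delta> y / y) * exp (w * lg y) \<partial>lborel) = Beta w (of_real (1 + \<delta>)) / zeta w"
proof -
  define g where "g = (\<lambda>n y. complex_of_real (moebius_mu (Suc n)) * (complex_of_real (rkern \<delta> (Suc n) y) * exp (w * lg y)))"
  have w0: "Re w > 0" using w by simp
  have gi: "integrable lborel (g n)" for n
    unfolding g_def by (intro integrable_mult_right integral_rkern d w0) simp
  have gs: "(\<lambda>n. g n y) sums (complex_of_real (Mo \<delta> y / y) * exp (w * lg y))" for y
  proof -
    have "(\<lambda>n. complex_of_real (moebius_mu (Suc n) * rkern \<delta> (Suc n) y) * exp (w * lg y)) sums (complex_of_real (Mo \<delta> y / y) * exp (w * lg y))"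
      by (intro sums_mult2 sums_of_real Mo_sums)
    then show ?thesis by (simp add: g_def mult.assoc)
  qed
  have ns: "summable (\<lambda>n. norm (g n y))" for y
  proof (rule summable_finite[of "{n. real n \<le> y}"])
    show "finite {n. real n \<le> y}"
      by (rule finite_subset[of _ "{..nat \<lfloor>y\<rfloor>}"]) (auto simp: le_nat_floor)
  qed (auto simp: g_def rkern_def indicator_def)
  define B where "B = (\<integral>y. rkern \<delta> 1 y * exp (Re w * lg y) \<partial>lborel)"
  have nle: "norm (g n y) \<le> rkern \<delta> (Suc n) y * exp (Re w * lg y)" for n y
  proof -
    have "norm (g n y) = \<bar>moebius_mu (Suc n)\<bar> * (rkern \<delta> (Suc n) y * exp (Re w * lg y))"
      using rkern_nonneg by (simp add: g_def norm_mult)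
    also have "\<dots> \<le> 1 * (rkern \<delta> (Suc n) y * exp (Re w * lg y))"
      using rkern_nonneg by (intro mult_right_mono abs_moebius_mu_le mult_nonneg_nonneg) auto
    finally show ?thesis by simp
  qed
  have ri: "has_bochner_integral lborel (\<lambda>y. rkern \<delta> (Suc n) y * exp (Re w * lg y)) (real (Suc n) powr (- Re w) * Beta (Re w) (1 + \<delta>))" for n
  proof -
    note I = integral_rkern[of \<delta> "complex_of_real (Re w)" "Suc n"]
    have "complex_of_real (\<integral>y. rkern \<delta> (Suc n) y * exp (Re w * lg y) \<partial>lborel)
        = of_nat (Suc n) powr (- complex_of_real (Re w)) * Beta (complex_of_real (Re w)) (of_real (1 + \<delta>))"
      unfolding laplace_of_real[symmetric] by (rule I(2)) (use d w0 in auto)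
    also have "\<dots> = of_real (real (Suc n) powr (- Re w) * Beta (Re w) (1 + \<delta>))"
      unfolding Beta_complex_of_real using powr_of_real[of "real (Suc n)" "- Re w"] by simp
    finally have "(\<integral>y. rkern \<delta> (Suc n) y * exp (Re w * lg y) \<partial>lborel) = real (Suc n) powr (- Re w) * Beta (Re w) (1 + \<delta>)"
      by (simp only: of_real_eq_iff)
    moreover have "complex_integrable lborel (\<lambda>y. complex_of_real (rkern \<delta> (Suc n) y * exp (Re w * lg y)))"
      using I(1) d w0 by (simp add: exp_of_real[symmetric])
    ultimately show ?thesis by (simp only: has_bochner_integral_iff complex_of_real_integrable_eq)
  qed
  have sm: "summable (\<lambda>n. \<integral>y. norm (g n y) \<partial>lborel)"
  proof (rule summable_comparison_test')
    show "summable (\<lambda>n. real (Suc n) powr (- Re w) * Beta (Re w) (1 + \<delta>))"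
      by (intro summable_mult2 summable_shift_powr) (use w in simp)
    fix n
    have "(\<integral>y. norm (g n y) \<partial>lborel) \<le> (\<integral>y. rkern \<delta> (Suc n) y * exp (Re w * lg y) \<partial>lborel)"
      by (intro integral_mono integrable_norm gi nle) (use ri[of n] in \<open>simp add: has_bochner_integral_iff\<close>)
    then show "norm (\<integral>y. norm (g n y) \<partial>lborel) \<le> real (Suc n) powr (- Re w) * Beta (Re w) (1 + \<delta>)"
      using ri[of n] by (simp add: has_bochner_integral_iff)
  qed
  have tot: "(\<Sum>n. g n y) = complex_of_real (Mo \<delta> y / y) * exp (w * lg y)" for y
    using sums_unique[OF gs] by simp
  show "integrable lborel (\<lambda>y. complex_of_real (Mo \<delta> y / y) * exp (w * lg y))"
    using integrable_suminf[OF gi AE_I2[OF ns] sm] unfolding tot .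
  have "(\<integral>y. complex_of_real (Mo \<delta> y / y) * exp (w * lg y) \<partial>lborel) = (\<Sum>n. \<integral>y. g n y \<partial>lborel)"
    using integral_suminf[OF gi AE_I2[OF ns] sm] unfolding tot .
  also have "\<dots> = (\<Sum>n. complex_of_real (moebius_mu (Suc n)) * of_nat (Suc n) powr (- w) * Beta w (of_real (1 + \<delta>)))"
    unfolding g_def by (simp add: integral_rkern(2)[OF d w0] mult.assoc del: of_nat_Suc)
  also have "\<dots> = moebius_series w * Beta w (of_real (1 + \<delta>))"
    unfolding moebius_series_def
    by (rule suminf_mult2[symmetric]) (rule summable_norm_cancel[OF moebius_series_abs_summable[OF w]])
  also have "\<dots> = Beta w (of_real (1 + \<delta>)) / zeta w" by (simp add: moebius_series_eq[OF w])
  finally show "(\<integral>y. complex_of_real (Mo \<delta> y / y) * exp (w * lg y) \<partial>lborel) = Beta w (of_real (1 + \<delta>)) / zeta w" .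
qed

text \<open>The trivial bound absorbs the bounded range of y on which an eventual inequality gives
  no information.\<close>

lemma abs_Mo_le:
  assumes "y \<ge> 1" "\<delta> \<ge> 0" shows "\<bar>Mo \<delta> y\<bar> \<le> y"
proof -
  have "\<bar>Mo \<delta> y\<bar> \<le> (\<Sum>n | 1 \<le> n \<and> real n \<le> y. 1)"
    unfolding Mo_def
  proof (rule order_trans[OF sum_abs], rule sum_mono)
    fix n assume n: "n \<in> {n. 1 \<le> n \<and> real n \<le> y}"
    have "\<bar>moebius_mu n\<bar> * (1 - real n / y) powr \<delta> \<le> 1 * 1 powr \<delta>"
      using n assms abs_moebius_mu_le by (intro mult_mono powr_mono2) auto
    then show "\<bar>moebius_mu n * (1 - real n / y) powr \<delta>\<bar> \<le> 1" by (simp add: abs_mult)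
  qed
  also have "\<dots> = real (card {n. 1 \<le> n \<and> real n \<le> y})" by simp
  also have "card {n. 1 \<le> n \<and> real n \<le> y} \<le> card {1..nat \<lfloor>y\<rfloor>}"
    by (intro card_mono) (auto simp: le_nat_floor)
  also have "real (card {1..nat \<lfloor>y\<rfloor>}) \<le> y" using assms by simp
  finally show ?thesis by simp
qed


section \<open>One-sided bounds\<close>

text \<open>On the critical line this is the residue of \<open>1/\<zeta>\<close>, which is \<open>0\<close> where \<open>\<zeta>\<close> does not vanish.\<close>

definition zeta_inv_res :: "complex \<Rightarrow> complex" where
  "zeta_inv_res \<rho> = (if zeta \<rho> = 0 then 1 / deriv zeta \<rho> else 0)"

lemma zeta_nonzero_exists: "\<exists>w\<in>-{1}. zeta w \<noteq> 0"
  using zeta_nonzero[of 2] by (intro bexI[of _ 2]) auto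

text \<open>Near \<rho>, \<open>zeta\<close> is g(w) (w - \<rho>) with g(\<rho>) nonzero, and
  g(\<rho>) is the derivative. This links simplicity, stated as an order, to residues, stated with
  derivatives.\<close>

lemma zorder_1_deriv_nonzero:
  assumes "\<rho> \<noteq> 1" "zeta \<rho> = 0" "zorder zeta \<rho> = 1"
  shows "deriv zeta \<rho> \<noteq> 0"
proof -
  have conn: "connected (-{1::complex})" by (rule connected_punctured_universe) simp
  have "\<exists>r. 0 < r \<and> cball \<rho> r \<subseteq> -{1} \<and> zor_poly zeta \<rho> holomorphic_on cball \<rho> r \<and>
      (\<forall>w\<in>cball \<rho> r. zeta w = zor_poly zeta \<rho> w * (w - \<rho>) ^ nat (zorder zeta \<rho>) \<and> zor_poly zeta \<rho> w \<noteq> 0)"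
    using zorder_exist_zero[OF zeta_holomorphic _ conn _ zeta_nonzero_exists, of \<rho>] assms by auto
  then obtain r where r: "r > 0" "zor_poly zeta \<rho> holomorphic_on cball \<rho> r"
      "\<And>w. w \<in> cball \<rho> r \<Longrightarrow> zeta w = zor_poly zeta \<rho> w * (w - \<rho>)" "zor_poly zeta \<rho> \<rho> \<noteq> 0"
    using assms(3) by auto
  let ?g = "zor_poly zeta \<rho>"
  have "?g field_differentiable at \<rho>"
    using r(1,2) by (intro holomorphic_on_imp_differentiable_at[of _ "ball \<rho> r"]) (auto intro: holomorphic_on_subset)
  then obtain g' where g': "(?g has_field_derivative g') (at \<rho>)" by (auto simp: field_differentiable_def)
  have "((\<lambda>w. ?g w * (w - \<rho>)) has_field_derivative (g' * (\<rho> - \<rho>) + 1 * ?g \<rho>)) (at \<rho>)"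
    by (rule DERIV_mult[OF g']) (auto intro!: derivative_eq_intros)
  then have "(zeta has_field_derivative (g' * (\<rho> - \<rho>) + 1 * ?g \<rho>)) (at \<rho>)"
    by (rule has_field_derivative_transform_within_open[of _ _ _ "ball \<rho> r"]) (use r in auto)
  then show ?thesis using r(4) DERIV_imp_deriv by fastforce
qed

lemma zeta_field_derivative:
  "\<rho> \<noteq> 1 \<Longrightarrow> (zeta has_field_derivative deriv zeta \<rho>) (at \<rho>)"
  using zeta_holomorphic by (intro holomorphic_derivI[of _ "-{1}"]) auto

lemma zeta_inv_res_tendsto:
  assumes "Simple_Zeros" "Re \<rho> = 1/2"
  shows "((\<lambda>w. (w - \<rho>) / zeta w) \<longlongrightarrow> zeta_inv_res \<rho>) (at \<rho>)"
proof -
  have ne: "\<rho> \<noteq> 1" using assms by auto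
  note d = zeta_field_derivative[OF ne]
  show ?thesis
  proof (cases "zeta \<rho> = 0")
    case True
    then have "zorder zeta \<rho> = 1" using assms by (auto simp: Simple_Zeros_def nontrivial_zeros_def)
    then have nz: "deriv zeta \<rho> \<noteq> 0" using zorder_1_deriv_nonzero[OF ne True] by simp
    have "((\<lambda>w. (zeta w - zeta \<rho>) / (w - \<rho>)) \<longlongrightarrow> deriv zeta \<rho>) (at \<rho>)"
      using d by (simp add: has_field_derivative_iff)
    from tendsto_inverse[OF this nz] show ?thesis using True by (simp add: zeta_inv_res_def inverse_eq_divide)
  next
    case False
    have "(zeta \<longlongrightarrow> zeta \<rho>) (at \<rho>)"
      using d DERIV_isCont isCont_def by blast
    then have "((\<lambda>w. (w - \<rho>) / zeta w) \<longlongrightarrow> (\<rho> - \<rho>) / zeta \<rho>) (at \<rho>)"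
      by (intro tendsto_intros False)
    then show ?thesis using False by (simp add: zeta_inv_res_def)
  qed
qed

lemma holomorphic_Beta1:
  assumes "\<delta> > 0"
  shows "(\<lambda>w. Beta w (complex_of_real (1 + \<delta>))) holomorphic_on {w. Re w > 0}"
  unfolding Beta_altdef using assms
  by (intro holomorphic_intros holomorphic_on_compose[OF _ holomorphic_rGamma, unfolded o_def])
     (auto intro!: not_nonpos_Int_Re_pos)

lemma Mo_less_1: "y < 1 \<Longrightarrow> Mo \<delta> y = 0"
proof -
  assume "y < 1"
  then have *: "{n. 1 \<le> n \<and> real n \<le> y} = {}" by auto
  show ?thesis unfolding Mo_def * by simp
qed

lemma norm_add_diff_le: "norm (x + y - z) \<le> norm x + norm y + norm (z :: 'a :: real_normed_vector)"
  using norm_triangle_ineq4[of "x + y" z] norm_triangle_ineq[of x y] by linarith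

lemma three_fractions:
  fixes w h Z :: "'a :: field"
  assumes "w \<noteq> 0" "h \<noteq> 0" "Z \<noteq> 0"
  shows "(C / h + B / w - g * (n / Z)) * (Z * h * w) = (C * w + B * h) * Z - g * n * h * w"
  using assms by (simp add: field_simps)

lemma scale_three_terms:
  fixes h :: "'a :: field"
  shows "h \<noteq> 0 \<Longrightarrow> h * (C / h + B / w - g * q) = C + B * (h / w) - g * (h * q)"
  by (simp add: field_simps)

text \<open>The sign \<open>\<sigma>g\<close> treats upper and lower bounds at once, and the
  constant B turns an eventual bound into one for all y \<ge> 1. The aim is a lower bound for C in
  which B no longer occurs.\<close>

locale one_sided_bound =
  fixes \<delta> \<sigma>g C B :: real
  assumes RH: Riemann_Hypothesis and SZ: Simple_Zeros and \<delta>: "0 < \<delta>" "\<delta> \<le> 1"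
    and sg: "\<sigma>g = 1 \<or> \<sigma>g = -1" and C0: "C \<ge> 0" and B0: "B \<ge> 0"
    and bound: "\<And>y. y \<ge> 1 \<Longrightarrow> \<sigma>g * Mo \<delta> y \<le> C * sqrt y + B"
begin

definition f :: "real \<Rightarrow> real" where
  "f y = indicator {1..} y * ((C * sqrt y + B - \<sigma>g * Mo \<delta> y) / y)"

definition L :: "complex \<Rightarrow> complex" where
  "L w = (\<integral>y. complex_of_real (f y) * exp (w * lg y) \<partial>lborel)"

definition Lr :: "real \<Rightarrow> real" where
  "Lr \<sigma> = (\<integral>y. f y * exp (\<sigma> * lg y) \<partial>lborel)"

text \<open>The Mellin transform B(w, 1 + \<delta>) / \<zeta>(w) of the Riesz mean; written with
  \<open>zeta_reg\<close> it has its correct value 0 at w = 1.\<close>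

definition Q :: "complex \<Rightarrow> complex" where
  "Q w = Beta w (of_real (1 + \<delta>)) * (w - 1) / zeta_reg w"

lemma f_measurable [measurable]: "f \<in> borel_measurable borel"
  unfolding f_def by measurable

lemma f_nonneg: "f y \<ge> 0"
  using bound[of y] by (auto simp: f_def indicator_def)

lemma f_decomp:
  "f y = C * (indicator {1..} y * (y powr (1/2) / y)) + B * (indicator {1..} y * (y powr 0 / y)) - \<sigma>g * (Mo \<delta> y / y)"
  using Mo_less_1[of y] by (cases "y \<ge> 1") (auto simp: f_def powr_half_sqrt field_simps)

lemma L_gt_1:
  assumes "Re w > 1"
  shows "L w = of_real C / (w - 1/2) + of_real B / w - of_real \<sigma>g * (Beta w (of_real (1 + \<delta>)) / zeta w)"
    and "integrable lborel (\<lambda>y. complex_of_real (f y) * exp (w * lg y))"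
proof -
  have ip: "integrable lborel (\<lambda>y. complex_of_real (indicator {1..} y * (y powr a / y)) * exp (w * lg y))" if "Re w > a" for a
  proof (rule laplace_power_series(3)[where a = w and r = "(Re w - a) / 2"])
    have "integrable lborel (\<lambda>y. indicator {1..} y * (y powr a / y) * exp (\<sigma> * lg y))" if "\<sigma> > a" for \<sigma>
      using integrable_powr_lg[OF that] by (simp add: has_bochner_integral_iff)
    moreover have "norm (complex_of_real (indicator {1..} y * (y powr a / y))) = indicator {1..} y * (y powr a / y)" for y
      by (auto simp: indicator_def norm_divide)
    ultimately have *: "integrable lborel (\<lambda>y. norm (complex_of_real (indicator {1..} y * (y powr a / y))) * exp (\<sigma> * lg y))" if "\<sigma> > a" for \<sigma>
      using that by (simp only:)
    show "integrable lborel (\<lambda>y. norm (complex_of_real (indicator {1..} y * (y powr a / y))) * exp ((Re w + (Re w - a) / 2) * lg y))"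
      "integrable lborel (\<lambda>y. norm (complex_of_real (indicator {1..} y * (y powr a / y))) * exp ((Re w - (Re w - a) / 2) * lg y))"
      by (rule *; use that in \<open>simp add: field_simps\<close>)+
  qed (use that in auto)
  let ?p = "\<lambda>a y. complex_of_real (indicator {1..} y * (y powr a / y)) * exp (w * lg y)"
  let ?m = "\<lambda>y. complex_of_real (Mo \<delta> y / y) * exp (w * lg y)"
  have i1: "integrable lborel (?p (1/2))" and i2: "integrable lborel (?p 0)" by (rule ip; use assms in simp)+
  have i3: "integrable lborel ?m" by (rule mellin_Mo(1)[OF \<delta>(1) assms])
  have e: "complex_of_real (f y) * exp (w * lg y) = (of_real C * ?p (1/2) y + of_real B * ?p 0 y) - of_real \<sigma>g * ?m y" for y
    unfolding f_decomp by (simp add: algebra_simps)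
  show "integrable lborel (\<lambda>y. complex_of_real (f y) * exp (w * lg y))"
    unfolding e by (intro Bochner_Integration.integrable_diff Bochner_Integration.integrable_add integrable_mult_right i1 i2 i3)
  have "L w = of_real C * (\<integral>y. ?p (1/2) y \<partial>lborel) + of_real B * (\<integral>y. ?p 0 y \<partial>lborel) - of_real \<sigma>g * (\<integral>y. ?m y \<partial>lborel)"
    unfolding L_def e
    by (subst Bochner_Integration.integral_diff Bochner_Integration.integral_add,
        (intro Bochner_Integration.integrable_diff Bochner_Integration.integrable_add integrable_mult_right i1 i2 i3)+)+
       (simp only: integral_mult_right_zero)
  also have "(\<integral>y. ?p (1/2) y \<partial>lborel) = 1 / (w - of_real (1/2))" by (rule mellin_powr) (use assms in simp)
  also have "(\<integral>y. ?p 0 y \<partial>lborel) = 1 / (w - of_real 0)" by (rule mellin_powr) (use assms in simp)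
  also have "(\<integral>y. ?m y \<partial>lborel) = Beta w (of_real (1 + \<delta>)) / zeta w" by (rule mellin_Mo(2)[OF \<delta>(1) assms])
  finally show "L w = of_real C / (w - 1/2) + of_real B / w - of_real \<sigma>g * (Beta w (of_real (1 + \<delta>)) / zeta w)"
    by simp
qed

lemma zeta_reg_real_nonzero:
  assumes "x > 1/2" shows "zeta_reg (of_real x) \<noteq> 0"
proof (cases "x > 1")
  case True
  then show ?thesis using zeta_nonzero[of "of_real x"] by (auto simp: zeta_reg_def)
next
  case False
  show ?thesis
  proof (cases "x = 1")
    case False
    then have x: "1/2 < x" "x < 1" using assms \<open>\<not> x > 1\<close> by auto
    have "zeta (of_real x) \<noteq> 0"
    proof
      assume "zeta (of_real x) = 0"
      then have "complex_of_real x \<in> nontrivial_zeros" using x by (simp add: nontrivial_zeros_def)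
      then show False using RH x by (force simp: Riemann_Hypothesis_def)
    qed
    then show ?thesis using x by (auto simp: zeta_reg_def)
  qed (simp add: zeta_reg_def)
qed

lemma landau_applied:
  shows "\<And>\<sigma>. \<sigma> > 1/2 \<Longrightarrow> integrable lborel (\<lambda>y. f y * exp (\<sigma> * lg y))"
    and "\<And>w. Re w > 1/2 \<Longrightarrow> L w * (zeta_reg w * (w - 1/2) * w) =
        (of_real C * w + of_real B * (w - 1/2)) * zeta_reg w
          - of_real \<sigma>g * Beta w (of_real (1 + \<delta>)) * (w - 1) * (w - 1/2) * w"
proof -
  \<comment> \<open>All denominators are cleared: w - 1/2 and w come from the transforms of C
    \<surd>y and B. None of the three factors vanishes at real points right of 1/2, which is all
    that Landau's theorem asks of D.\<close>
  let ?D = "\<lambda>w. zeta_reg w * (w - 1/2) * w"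
  let ?N = "\<lambda>w. (of_real C * w + of_real B * (w - 1/2)) * zeta_reg w
          - of_real \<sigma>g * Beta w (of_real (1 + \<delta>)) * (w - 1) * (w - 1/2) * w"
  have i: "integrable lborel (\<lambda>y. f y * exp (\<sigma> * lg y))" if "\<sigma> > 1" for \<sigma>
  proof -
    have "complex_integrable lborel (\<lambda>y. complex_of_real (f y * exp (\<sigma> * lg y)))"
      using L_gt_1(2)[of "of_real \<sigma>"] that by (simp add: exp_of_real[symmetric])
    then show ?thesis by (simp only: complex_of_real_integrable_eq)
  qed
  have D: "?D holomorphic_on {s. Re s > 1/2}"
    by (intro holomorphic_intros zeta_reg_holomorphic)
  have N: "?N holomorphic_on {s. Re s > 1/2}"
    by (intro holomorphic_intros zeta_reg_holomorphic holomorphic_on_subset[OF holomorphic_Beta1[OF \<delta>(1)]]) auto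
  have D0: "?D (of_real x) \<noteq> 0" if "x > 1/2" for x
    using zeta_reg_real_nonzero[OF that] that
    by (auto simp: complex_eq_iff)
  have eq: "(\<integral>y. of_real (f y) * exp (s * lg y) \<partial>lborel) * ?D s = ?N s" if "Re s > 1" for s
  proof -
    have s: "s \<noteq> 1" "s \<noteq> 0" "s - 1/2 \<noteq> 0" using that by (auto simp: complex_eq_iff)
    have z: "zeta_reg s \<noteq> 0" using zeta_nonzero[OF that] s by (simp add: zeta_reg_def)
    have "Beta s (of_real (1 + \<delta>)) / zeta s = Beta s (of_real (1 + \<delta>)) * (s - 1) / zeta_reg s"
      using s by (simp add: zeta_reg_def)
    then show ?thesis
      using three_fractions[OF s(2,3) z] L_gt_1(1)[OF that] unfolding L_def by (simp add: mult.assoc)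
  qed
  have fm: "f \<in> borel_measurable lborel" "lg \<in> borel_measurable lborel" by measurable
  note A = landau_laplace[OF fm f_nonneg lg_le_0 i D N D0 eq]
  show "\<And>\<sigma>. \<sigma> > 1/2 \<Longrightarrow> integrable lborel (\<lambda>y. f y * exp (\<sigma> * lg y))" by (rule A(1))
  show "\<And>w. Re w > 1/2 \<Longrightarrow> L w * ?D w = ?N w" unfolding L_def by (rule A(2))
qed

text \<open>At a zero the identity of \<open>landau_applied\<close> would leave only the Beta term,
  which does not vanish. The conclusion includes the line Re w = 1.\<close>

lemma zeta_reg_right_nonzero:
  assumes "Re w > 1/2" shows "zeta_reg w \<noteq> 0"
proof
  assume z: "zeta_reg w = 0"
  have w: "w \<noteq> 0" "w - 1/2 \<noteq> 0" using assms by (auto simp: complex_eq_iff)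
  have "w \<noteq> 1" using z by (auto simp: zeta_reg_def)
  moreover have "Beta w (of_real (1 + \<delta>)) \<noteq> 0"
  proof -
    have "w \<notin> \<int>\<^sub>\<le>\<^sub>0" "w + of_real (1 + \<delta>) \<notin> \<int>\<^sub>\<le>\<^sub>0" "complex_of_real (1 + \<delta>) \<notin> \<int>\<^sub>\<le>\<^sub>0"
      by (rule not_nonpos_Int_Re_pos; use assms \<delta> in simp)+
    then show ?thesis by (simp add: Beta_def Gamma_eq_zero_iff del: of_real_add)
  qed
  moreover have "\<sigma>g \<noteq> 0" using sg by auto
  ultimately show False using landau_applied(2)[OF assms] z w by simp
qed

lemma zeta_right_nonzero: "Re w > 1/2 \<Longrightarrow> w \<noteq> 1 \<Longrightarrow> zeta w \<noteq> 0"
  using zeta_reg_right_nonzero[of w] by (auto simp: zeta_reg_def)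

lemma L_eq:
  assumes "Re w > 1/2"
  shows "L w = of_real C / (w - 1/2) + of_real B / w - of_real \<sigma>g * Q w"
proof -
  have w: "w \<noteq> 0" "w - 1/2 \<noteq> 0" using assms by (auto simp: complex_eq_iff)
  have nz: "zeta_reg w * (w - 1/2) * w \<noteq> 0" using w zeta_reg_right_nonzero[OF assms] by simp
  have "(of_real C / (w - 1/2) + of_real B / w - of_real \<sigma>g * Q w) * (zeta_reg w * (w - 1/2) * w)
      = L w * (zeta_reg w * (w - 1/2) * w)"
    unfolding landau_applied(2)[OF assms] Q_def three_fractions[OF w zeta_reg_right_nonzero[OF assms]]
    by (simp add: mult.assoc)
  then show ?thesis using mult_right_cancel[OF nz] by metis
qed

section \<open>Growth of 1/\<zeta> from positivity\<close>

lemma norm_L_le: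
  assumes "Re w > 1/2"
  shows "norm (L w) \<le> Lr (Re w)"
proof -
  have "norm (L w) \<le> (\<integral>y. norm (complex_of_real (f y) * exp (w * lg y)) \<partial>lborel)"
    unfolding L_def by (rule integral_norm_bound)
  also have "\<dots> = Lr (Re w)" unfolding Lr_def
    using f_nonneg by (intro Bochner_Integration.integral_cong) (auto simp: norm_mult)
  finally show ?thesis .
qed

lemma L_of_real: "L (of_real \<sigma>) = of_real (Lr \<sigma>)"
  unfolding L_def Lr_def by (rule laplace_of_real)

text \<open>The residue at \<open>1/2 + \<i>\<omega>\<close> of the Mellin transform \<open>Q\<close> of the weighted Moebius sum.\<close>

definition a :: "real \<Rightarrow> complex" where
  "a \<omega> = Beta (Complex (1/2) \<omega>) (of_real (1 + \<delta>)) * zeta_inv_res (Complex (1/2) \<omega>)"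

lemma Q_tendsto: "((\<lambda>w. (w - Complex (1/2) \<omega>) * Q w) \<longlongrightarrow> a \<omega>) (at (Complex (1/2) \<omega>))"
proof -
  let ?\<rho> = "Complex (1/2) \<omega>"
  have "isCont (\<lambda>w. Beta w (complex_of_real (1 + \<delta>))) ?\<rho>"
    using holomorphic_on_imp_continuous_on[OF holomorphic_Beta1[OF \<delta>(1)]]
    by (rule continuous_on_interior) (simp add: interior_open open_halfspace_Re_gt)
  then have "((\<lambda>w. Beta w (complex_of_real (1 + \<delta>))) \<longlongrightarrow> Beta ?\<rho> (complex_of_real (1 + \<delta>))) (at ?\<rho>)"
    by (simp only: isCont_def)
  from tendsto_mult[OF this zeta_inv_res_tendsto[OF SZ, of ?\<rho>]]
  have "((\<lambda>w. Beta w (complex_of_real (1 + \<delta>)) * ((w - ?\<rho>) / zeta w)) \<longlongrightarrow> a \<omega>) (at ?\<rho>)"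
    by (simp add: a_def)
  moreover have "\<forall>\<^sub>F w in at ?\<rho>. Beta w (complex_of_real (1 + \<delta>)) * ((w - ?\<rho>) / zeta w) = (w - ?\<rho>) * Q w"
  proof -
    have "?\<rho> \<noteq> 1" by (simp add: complex_eq_iff)
    then have "\<forall>\<^sub>F w in at ?\<rho>. w \<noteq> 1" by (rule tendsto_imp_eventually_ne[OF tendsto_ident_at])
    then show ?thesis
      by eventually_elim (simp add: Q_def zeta_reg_def)
  qed
  ultimately show ?thesis by (rule Lim_transform_eventually)
qed

text \<open>Because \<open>f\<close> is nonnegative, its transform is largest at the real point of
  each vertical line. There (\<sigma> - 1/2) Q(\<sigma>) stays bounded: near 1/2 because Q has at
  most a simple pole, further right by compactness. Passing from Q to L and back costs only the
  explicit terms with C and B.\<close>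

lemma norm_Q_bound:
  obtains K where "K > 0" "\<And>w. 1/2 < Re w \<Longrightarrow> Re w \<le> 4 \<Longrightarrow> norm (Q w) \<le> K / (Re w - 1/2)"
proof -
  let ?h = "\<lambda>w. (w - Complex (1/2) 0) * Q w"
  have "\<forall>\<^sub>F w in at (Complex (1/2) 0). norm (?h w) < norm (a 0) + 1"
    using tendsto_norm[OF Q_tendsto[of 0]] by (rule order_tendstoD) simp
  then obtain e where e: "e > 0" "\<And>w. w \<noteq> Complex (1/2) 0 \<Longrightarrow> dist w (Complex (1/2) 0) < e \<Longrightarrow> norm (?h w) < norm (a 0) + 1"
    unfolding eventually_at by auto
  have half: "Complex (1/2) 0 = of_real (1/2)" by (simp add: complex_eq_iff)
  have Qh: "?h holomorphic_on {w. Re w > 1/2}"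
    unfolding Q_def using zeta_reg_right_nonzero
    by (intro holomorphic_intros zeta_reg_holomorphic holomorphic_on_subset[OF holomorphic_Beta1[OF \<delta>(1)]]) auto
  have "compact (?h ` (of_real ` {1/2 + e/2..4}))"
    by (intro compact_continuous_image continuous_on_subset[OF holomorphic_on_imp_continuous_on[OF Qh]] continuous_intros)
       (use e in auto)
  then have "bounded (?h ` (of_real ` {1/2 + e/2..4}))" by (rule compact_imp_bounded)
  then obtain M where "\<forall>x\<in>?h ` (of_real ` {1/2 + e/2..4}). norm x \<le> M" unfolding bounded_iff by blast
  then have M: "\<And>\<sigma>. \<sigma> \<in> {1/2 + e/2..4} \<Longrightarrow> norm (?h (of_real \<sigma>)) \<le> M" by blast
  define M' where "M' = max M (norm (a 0) + 1)"
  have hM: "norm (?h (of_real \<sigma>)) \<le> M'" if "1/2 < \<sigma>" "\<sigma> \<le> 4" for \<sigma>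
  proof (cases "\<sigma> < 1/2 + e")
    case True
    have "norm (?h (of_real \<sigma>)) < norm (a 0) + 1"
      by (rule e(2)) (unfold half dist_of_real of_real_eq_iff, use True that in \<open>auto simp: dist_real_def\<close>)
    then show ?thesis by (simp add: M'_def)
  next
    case False
    then show ?thesis using M[of \<sigma>] that e by (simp add: M'_def)
  qed
  have M'0: "M' \<ge> 1" using norm_ge_zero[of "a 0"] unfolding M'_def by linarith
  define K1 where "K1 = C + 7 * B + M'"
  have L1: "(\<sigma> - 1/2) * Lr \<sigma> \<le> K1" if s: "1/2 < \<sigma>" "\<sigma> \<le> 4" for \<sigma>
  proof -
    have Re: "Re (of_real \<sigma>) > 1/2" using s by simp
    have "complex_of_real ((\<sigma> - 1/2) * Lr \<sigma>) = of_real C + of_real (B * ((\<sigma> - 1/2) / \<sigma>)) - of_real \<sigma>g * ?h (of_real \<sigma>)"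
    proof -
      have h: "of_real \<sigma> - 1/2 = complex_of_real (\<sigma> - 1/2)" "complex_of_real (\<sigma> - 1/2) \<noteq> 0"
        unfolding of_real_eq_0_iff using s by simp_all
      have "complex_of_real (\<sigma> - 1/2) * L (of_real \<sigma>)
          = of_real C + of_real B * (of_real (\<sigma> - 1/2) / of_real \<sigma>) - of_real \<sigma>g * (of_real (\<sigma> - 1/2) * Q (of_real \<sigma>))"
        unfolding L_eq[OF Re] h(1) by (rule scale_three_terms[OF h(2)])
      then show ?thesis unfolding L_of_real half by simp
    qed
    then have "norm (complex_of_real ((\<sigma> - 1/2) * Lr \<sigma>)) \<le> norm (complex_of_real C) + norm (complex_of_real (B * ((\<sigma> - 1/2) / \<sigma>))) + norm (of_real \<sigma>g * ?h (of_real \<sigma>))"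
      by (simp only: norm_add_diff_le)
    also have "norm (of_real \<sigma>g * ?h (of_real \<sigma>)) \<le> M'" using hM[OF s] sg by (auto simp: norm_mult)
    also have "norm (complex_of_real (B * ((\<sigma> - 1/2) / \<sigma>))) \<le> B * 1"
      unfolding norm_of_real abs_mult using B0 s by (intro mult_mono) (auto simp: field_simps)
    finally have "norm (complex_of_real ((\<sigma> - 1/2) * Lr \<sigma>)) \<le> C + B * 1 + M'" using C0 by simp
    then show ?thesis unfolding norm_of_real K1_def using C0 B0 by linarith
  qed
  define K where "K = K1 + C + 7 * B + 1"
  have "K > 0" using C0 B0 M'0 by (simp add: K_def K1_def)
  moreover have "norm (Q w) \<le> K / (Re w - 1/2)" if w: "1/2 < Re w" "Re w \<le> 4" for w
  proof -
    have "of_real \<sigma>g * Q w = of_real C / (w - 1/2) + of_real B / w - L w"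
      using L_eq[OF w(1)] by simp
    then have "norm (of_real \<sigma>g * Q w) \<le> norm (of_real C / (w - 1/2)) + norm (of_real B / w) + norm (L w)"
      by (simp only: norm_add_diff_le)
    also have "norm (of_real \<sigma>g * Q w) = norm (Q w)" using sg by (auto simp: norm_mult)
    also have "norm (of_real C / (w - 1/2)) \<le> C / (Re w - 1/2)"
      unfolding norm_divide using C0 w complex_Re_le_cmod[of "w - 1/2"] by (intro frac_le) auto
    \<comment> \<open>For Re w \<le> 4 the denominator is at most 7/2, so 2 B \<le> 7 B / (Re w -
      1/2).\<close>
    also have "norm (of_real B / w) \<le> 7 * B / (Re w - 1/2)"
    proof -
      have "norm (of_real B / w) \<le> B / (1/2)"
        unfolding norm_divide using B0 w complex_Re_le_cmod[of w] by (intro frac_le) auto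
      also have "\<dots> \<le> 7 * B / (Re w - 1/2)"
        using B0 w mult_left_mono[of "Re w" 4 B] by (simp add: field_simps)
      finally show ?thesis .
    qed
    also have "norm (L w) \<le> K1 / (Re w - 1/2)"
    proof -
      have "Lr (Re w) \<le> K1 / (Re w - 1/2)"
        using L1[OF w] w by (simp add: pos_le_divide_eq mult.commute)
      then show ?thesis using norm_L_le[OF w(1)] by linarith
    qed
    finally have "norm (Q w) \<le> (C + 7 * B + K1) / (Re w - 1/2)" by (simp add: add_divide_distrib)
    also have "\<dots> \<le> K / (Re w - 1/2)" using w by (intro divide_right_mono) (auto simp: K_def)
    finally show ?thesis .
  qed
  ultimately show ?thesis using that by blast
qed

text \<open>Divide the bound for Q by the Beta factor, whose lower bound from
  \<open>cmod_Beta_ge\<close> loses at most a quadratic factor as \<delta> \<le> 1.\<close>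

lemma inverse_zeta_right_bound:
  obtains K where "K > 0"
    "\<And>w. 1/2 < Re w \<Longrightarrow> Re w \<le> 4 \<Longrightarrow> w \<noteq> 1 \<Longrightarrow> norm (1 / zeta w) \<le> K * (norm w + 1)\<^sup>2 / (Re w - 1/2)"
proof -
  obtain K where K: "K > 0" "\<And>w. 1/2 < Re w \<Longrightarrow> Re w \<le> 4 \<Longrightarrow> norm (Q w) \<le> K / (Re w - 1/2)"
    using norm_Q_bound by blast
  have G: "Gamma (1 + \<delta>) > 0" using \<delta> by (intro Gamma_real_pos) auto
  have "norm (1 / zeta w) \<le> (K * 2 / Gamma (1 + \<delta>)) * (norm w + 1)\<^sup>2 / (Re w - 1/2)"
    if w: "1/2 < Re w" "Re w \<le> 4" "w \<noteq> 1" for w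
  proof -
    define b where "b = norm (Beta w (of_real (1 + \<delta>)))"
    have "Q w = Beta w (of_real (1 + \<delta>)) * (1 / zeta w)" using w(3) by (simp add: Q_def zeta_reg_def)
    then have Qb: "norm (Q w) = b * norm (1 / zeta w)" unfolding b_def by (simp only: norm_mult)
    have "norm (w + 1) \<ge> 1" using complex_Re_le_cmod[of "w + 1"] w by simp
    then have "norm (w + 1) powr \<delta> \<le> norm (w + 1) powr 1" using \<delta> by (intro powr_mono) auto
    also have "\<dots> \<le> norm w + 1" using norm_triangle_ineq[of w 1] by simp
    finally have p: "norm (w + 1) powr \<delta> \<le> norm w + 1" .
    have w0: "norm w > 0" "norm (w + 1) > 0" using w complex_Re_le_cmod[of w] complex_Re_le_cmod[of "w + 1"] by (auto simp: complex_eq_iff)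
    have "Gamma (1 + \<delta>) / (2 * (norm w + 1)\<^sup>2) \<le> Gamma (1 + \<delta>) / (2 * norm w * norm (w + 1) powr \<delta>)"
    proof (rule divide_left_mono)
      have "norm w * norm (w + 1) powr \<delta> \<le> (norm w + 1) * (norm w + 1)" by (intro mult_mono p) auto
      then show "2 * norm w * norm (w + 1) powr \<delta> \<le> 2 * (norm w + 1)\<^sup>2" by (simp add: power2_eq_square)
    next
      have p2: "0 < (norm w + 1)\<^sup>2" by (rule zero_less_power) (use w0 in linarith)
      have p3: "0 < norm (w + 1) powr \<delta>" using w0 by simp
      show "0 < 2 * (norm w + 1)\<^sup>2 * (2 * norm w * norm (w + 1) powr \<delta>)"
        by (rule mult_pos_pos[OF mult_pos_pos[OF zero_less_numeral p2] mult_pos_pos[OF mult_pos_pos[OF zero_less_numeral w0(1)] p3]])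
    qed (use G in simp)
    also have "\<dots> \<le> b" unfolding b_def by (rule cmod_Beta_ge) (use \<delta> w in auto)
    finally have b: "Gamma (1 + \<delta>) / (2 * (norm w + 1)\<^sup>2) \<le> b" .
    have "Gamma (1 + \<delta>) / (2 * (norm w + 1)\<^sup>2) * norm (1 / zeta w) \<le> b * norm (1 / zeta w)"
      by (intro mult_right_mono b) simp
    also have "\<dots> \<le> K / (Re w - 1/2)" unfolding Qb[symmetric] by (rule K(2)) (use w in auto)
    finally have *: "Gamma (1 + \<delta>) / (2 * (norm w + 1)\<^sup>2) * norm (1 / zeta w) \<le> K / (Re w - 1/2)" .
    have "norm (1 / zeta w) = (2 * (norm w + 1)\<^sup>2 / Gamma (1 + \<delta>)) * (Gamma (1 + \<delta>) / (2 * (norm w + 1)\<^sup>2) * norm (1 / zeta w))"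
    proof -
      have "norm w + 1 \<noteq> 0" using norm_ge_zero[of w] by linarith
      then show ?thesis using G by simp
    qed
    also have "\<dots> \<le> (2 * (norm w + 1)\<^sup>2 / Gamma (1 + \<delta>)) * (K / (Re w - 1/2))"
      using G by (intro mult_left_mono *) auto
    finally show ?thesis by (simp add: mult_ac)
  qed
  moreover have "K * 2 / Gamma (1 + \<delta>) > 0" using K G by simp
  ultimately show ?thesis using that by blast
qed

text \<open>The limit is the residue of L at 1/2 + \<i>\<omega>. It acts as a logarithmic mean of
  \<open>f y * sqrt y\<close> against the oscillation with frequency \<omega> in ln y; the pole of C
  / (w - 1/2) is seen only at \<omega> = 0.\<close>

lemma L_mean:
  "((\<lambda>\<sigma>. of_real \<sigma> * L (Complex (1/2 + \<sigma>) \<omega>)) \<longlongrightarrow> (if \<omega> = 0 then of_real C else 0) - of_real \<sigma>g * a \<omega>) (at_right 0)"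
proof -
  let ?w = "\<lambda>\<sigma>. Complex (1/2 + \<sigma>) \<omega>"
  let ?\<rho> = "Complex (1/2) \<omega>"
  have w_eq: "?w \<sigma> = ?\<rho> + of_real \<sigma>" for \<sigma> by (simp add: complex_eq_iff)
  have lim_id: "((\<lambda>\<sigma>. complex_of_real \<sigma>) \<longlongrightarrow> 0) (at_right 0)"
    using tendsto_of_real[OF tendsto_ident_at[of 0 "{0<..}"]] by simp
  have wl: "(?w \<longlongrightarrow> ?\<rho>) (at_right 0)"
    unfolding w_eq using tendsto_add[OF tendsto_const lim_id] by simp
  have "filterlim ?w (at ?\<rho>) (at_right 0)"
    using wl by (rule filterlim_atI) (auto simp: w_eq eventually_at intro!: exI[of _ 1])
  from filterlim_compose[OF Q_tendsto this]
  have l3: "((\<lambda>\<sigma>. of_real \<sigma> * Q (?w \<sigma>)) \<longlongrightarrow> a \<omega>) (at_right 0)"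
    by (simp add: w_eq)
  have l2: "((\<lambda>\<sigma>. of_real \<sigma> * (of_real B / ?w \<sigma>)) \<longlongrightarrow> 0 * (of_real B / ?\<rho>)) (at_right 0)"
    by (intro tendsto_intros lim_id wl) (simp add: complex_eq_iff)
  have l1: "((\<lambda>\<sigma>. of_real \<sigma> * (of_real C / (?w \<sigma> - 1/2))) \<longlongrightarrow> (if \<omega> = 0 then of_real C else 0)) (at_right 0)"
  proof (cases "\<omega> = 0")
    case True
    have "\<forall>\<^sub>F \<sigma> in at_right 0. of_real C = of_real \<sigma> * (of_real C / (?w \<sigma> - 1/2))"
    proof (rule eventually_at_rightI[of 0 1])
      fix \<sigma> :: real assume "\<sigma> \<in> {0<..<1}"
      moreover have "?w \<sigma> - 1/2 = of_real \<sigma>" using True by (simp add: complex_eq_iff)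
      ultimately show "of_real C = of_real \<sigma> * (of_real C / (?w \<sigma> - 1/2))" by simp
    qed simp
    then show ?thesis using True Lim_transform_eventually[OF tendsto_const] by simp
  next
    case False
    have "((\<lambda>\<sigma>. of_real \<sigma> * (of_real C / (?w \<sigma> - 1/2))) \<longlongrightarrow> 0 * (of_real C / (?\<rho> - 1/2))) (at_right 0)"
      by (intro tendsto_intros lim_id wl) (use False in \<open>simp add: complex_eq_iff\<close>)
    then show ?thesis using False by simp
  qed
  have "((\<lambda>\<sigma>. of_real \<sigma> * (of_real C / (?w \<sigma> - 1/2)) + of_real \<sigma> * (of_real B / ?w \<sigma>) - of_real \<sigma>g * (of_real \<sigma> * Q (?w \<sigma>)))
     \<longlongrightarrow> (if \<omega> = 0 then of_real C else 0) + 0 * (of_real B / ?\<rho>) - of_real \<sigma>g * a \<omega>) (at_right 0)"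
    by (intro tendsto_intros l1 l2 l3)
  moreover have "\<forall>\<^sub>F \<sigma> in at_right 0. of_real \<sigma> * (of_real C / (?w \<sigma> - 1/2)) + of_real \<sigma> * (of_real B / ?w \<sigma>) - of_real \<sigma>g * (of_real \<sigma> * Q (?w \<sigma>))
      = of_real \<sigma> * L (?w \<sigma>)"
  proof (rule eventually_at_rightI[of 0 1])
    fix \<sigma> :: real assume "\<sigma> \<in> {0<..<1}"
    then have "Re (?w \<sigma>) > 1/2" by simp
    from L_eq[OF this] show "of_real \<sigma> * (of_real C / (?w \<sigma> - 1/2)) + of_real \<sigma> * (of_real B / ?w \<sigma>) - of_real \<sigma>g * (of_real \<sigma> * Q (?w \<sigma>))
      = of_real \<sigma> * L (?w \<sigma>)" by (simp only: distrib_left right_diff_distrib mult.left_commute)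
  qed simp
  ultimately have "((\<lambda>\<sigma>. of_real \<sigma> * L (?w \<sigma>)) \<longlongrightarrow> (if \<omega> = 0 then of_real C else 0) + 0 * (of_real B / ?\<rho>) - of_real \<sigma>g * a \<omega>) (at_right 0)"
    by (rule Lim_transform_eventually)
  then show ?thesis by simp
qed

end


section \<open>Riesz products\<close>

definition ordinates :: "real set" where
  "ordinates = Im ` nontrivial_zeros \<inter> {0<..}"

lemma LI_combination_zero:
  assumes "Linear_Independence_Conjecture" "finite T" "T \<subseteq> ordinates"
    and "(\<Sum>g\<in>T. of_int (u g) * g) = 0" "g \<in> T"
  shows "u g = (0::int)"
proof -
  interpret vs: vector_space "\<lambda>(q::rat) (x::real). of_rat q * x"
    by (rule vector_space_real_over_rat)
  have "vs.independent ordinates"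
    using assms(1) by (simp add: Linear_Independence_Conjecture_def ordinates_def)
  moreover have "(\<Sum>g\<in>T. of_rat (of_int (u g)) * g) = (0::real)" using assms(4) by simp
  ultimately have "(of_int (u g) :: rat) = 0"
    using vs.independentD[of ordinates T "\<lambda>g. of_int (u g)" g] assms by blast
  then show ?thesis by simp
qed

text \<open>Moving s h to the left side gives a vanishing integer combination over S together with
  h, so all its coefficients are 0. This decides which frequencies of a Riesz product can hit an
  ordinate.\<close>

lemma LI_combination_single:
  assumes LI: "Linear_Independence_Conjecture" and S: "finite S" "S \<subseteq> ordinates" and h: "h \<in> ordinates"
    and eq: "(\<Sum>g\<in>S. of_int (k g) * g) = of_int s * h" and s: "s \<noteq> (0::int)"
  shows "h \<in> S" "\<And>g. g \<in> S \<Longrightarrow> k g = (if g = h then s else 0)"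
proof -
  define u where "u = (\<lambda>g. (if g \<in> S then k g else 0) - (if g = h then s else 0))"
  have "(\<Sum>g\<in>insert h S. of_int (u g) * g) = (\<Sum>g\<in>insert h S. of_int (if g \<in> S then k g else 0) * g) - (\<Sum>g\<in>insert h S. of_int (if g = h then s else 0) * g)"
    unfolding sum_subtractf[symmetric] by (intro sum.cong refl) (simp add: u_def algebra_simps)
  also have "(\<Sum>g\<in>insert h S. of_int (if g \<in> S then k g else 0) * g) = (\<Sum>g\<in>S. of_int (k g) * g)"
    using S by (intro sum.mono_neutral_cong_right) auto
  also have "(\<Sum>g\<in>insert h S. of_int (if g = h then s else 0) * g) = (\<Sum>g\<in>{h}. of_int s * g)"
    using S by (intro sum.mono_neutral_cong_right) auto
  finally have "(\<Sum>g\<in>insert h S. of_int (u g) * g) = 0" using eq by simp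
  then have u0: "u g = 0" if "g \<in> insert h S" for g
    using LI_combination_zero[OF LI, of "insert h S" u g] S h that by auto
  show "h \<in> S" using u0[of h] s by (auto simp: u_def split: if_splits)
  show "k g = (if g = h then s else 0)" if "g \<in> S" for g
    using u0[of g] that by (auto simp: u_def)
qed

section \<open>The transform tested against a Riesz product\<close>

context one_sided_bound
begin

lemma L_cnj: "L (cnj w) = cnj (L w)"
proof -
  have "complex_of_real (f y) * exp (cnj w * lg y) = cnj (complex_of_real (f y) * exp (w * lg y))" for y
    by (simp add: exp_cnj)
  then show ?thesis unfolding L_def by (simp only: Bochner_Integration.integral_cnj)
qed

text \<open>\<open>f\<close> is real, so L commutes with conjugation; the symmetry of the residues
  follows by uniqueness of the limit in \<open>L_mean\<close>.\<close>

lemma a_minus: "a (- \<omega>) = cnj (a \<omega>)"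
proof -
  have e: "cnj (of_real \<sigma> * L (Complex (1/2 + \<sigma>) \<omega>)) = of_real \<sigma> * L (Complex (1/2 + \<sigma>) (- \<omega>))" for \<sigma>
    using L_cnj[of "Complex (1/2 + \<sigma>) \<omega>"] by (simp add: complex_cnj)
  have "((\<lambda>\<sigma>. of_real \<sigma> * L (Complex (1/2 + \<sigma>) (- \<omega>))) \<longlongrightarrow> cnj ((if \<omega> = 0 then of_real C else 0) - of_real \<sigma>g * a \<omega>)) (at_right 0)"
    using tendsto_cnj[OF L_mean[of \<omega>]] unfolding e .
  from tendsto_unique[OF trivial_limit_at_right_real L_mean[of "- \<omega>"] this]
  have "(if - \<omega> = 0 then of_real C else 0) - of_real \<sigma>g * a (- \<omega>) = cnj ((if \<omega> = 0 then of_real C else 0) - of_real \<sigma>g * a \<omega>)" .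
  moreover have "\<sigma>g \<noteq> 0" using sg by auto
  ultimately show ?thesis by (cases "\<omega> = 0") auto
qed

lemma a_nonzero_ordinate:
  assumes "a \<omega> \<noteq> 0" "\<omega> > 0" shows "\<omega> \<in> ordinates"
proof -
  have "zeta (Complex (1/2) \<omega>) = 0" using assms by (auto simp: a_def zeta_inv_res_def split: if_splits)
  then have "Complex (1/2) \<omega> \<in> nontrivial_zeros" by (simp add: nontrivial_zeros_def)
  then have "Im (Complex (1/2) \<omega>) \<in> Im ` nontrivial_zeros" by (rule imageI)
  then show ?thesis using assms by (simp add: ordinates_def)
qed

text \<open>The mean of \<open>f\<close> against a nonnegative product is nonnegative. Expanding the
  product gives frequencies \<Sum> k(g) g with k(g) in {-1, 0, 1}; by \<open>L_mean\<close> such a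
  frequency contributes only if it is 0 or plus or minus an ordinate, and linear independence leaves
  the zero choice and the single ordinates of S. The zero choice gives C minus the signed residue at
  1/2; each h in S gives minus the modulus of its residue.\<close>

theorem riesz_product_bound:
  assumes LI: "Linear_Independence_Conjecture" and S: "finite S" "S \<subseteq> ordinates"
  shows "\<sigma>g * Re (a 0) + (\<Sum>g\<in>S. norm (a g)) \<le> C"
proof -
  \<comment> \<open>These phases align each residue with its cosine, so that h and -h together
    contribute a full negative modulus.\<close>
  define \<phi> where "\<phi> = (\<lambda>g. Arg (of_real \<sigma>g * a g))"
  define K where "K = {-1, 0, 1::int}"
  define cf where "cf = (\<lambda>g (j::int). if j = 0 then 1 else if j = 1 then cis (\<phi> g) / 2 else cis (- \<phi> g) / 2)"
  define P where "P = (\<lambda>u. \<Prod>g\<in>S. 1 + cos (g * u + \<phi> g))"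
  define fr where "fr = (\<lambda>k. \<Sum>g\<in>S. of_int (k g) * g :: real)"
  define c where "c = (\<lambda>k. \<Prod>g\<in>S. cf g (k g))"
  define PE where "PE = PiE S (\<lambda>_. K)"
  have finPE: "finite PE" unfolding PE_def K_def by (intro finite_PiE S) auto
  have P0: "P u \<ge> 0" for u unfolding P_def
    by (intro prod_nonneg) (metis add.commute cos_ge_minus_one diff_ge_0_iff_ge diff_minus_eq_add)
  have Pexp: "of_real (P u) = (\<Sum>k\<in>PE. c k * cis (fr k * u))" for u
  proof -
    have "of_real (1 + cos (g * u + \<phi> g)) = (\<Sum>j\<in>K. cf g j * cis (of_int j * g * u))" for g
    proof -
      have "(\<Sum>j\<in>K. cf g j * cis (of_int j * g * u)) = cis (- \<phi> g - g * u) / 2 + 1 + cis (\<phi> g + g * u) / 2"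
        by (simp add: K_def cf_def cis_mult)
      also have "\<dots> = of_real (1 + cos (g * u + \<phi> g))"
        by (simp add: complex_eq_iff add.commute cos_diff cos_add sin_diff sin_add) (simp add: field_simps)
      finally show ?thesis by simp
    qed
    then have "complex_of_real (P u) = (\<Prod>g\<in>S. \<Sum>j\<in>K. cf g j * cis (of_int j * g * u))"
      by (simp add: P_def)
    also have "\<dots> = (\<Sum>k\<in>PE. \<Prod>g\<in>S. cf g (k g) * cis (of_int (k g) * g * u))"
      unfolding PE_def by (rule prod_sum_PiE) (use S in \<open>auto simp: K_def\<close>)
    also have "\<dots> = (\<Sum>k\<in>PE. c k * cis (fr k * u))"
    proof (intro sum.cong refl)
      fix k
      have "(\<Prod>g\<in>S. cis (of_int (k g) * g * u)) = cis (fr k * u)"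
        unfolding fr_def using S(1)
        by (induction S) (auto simp: cis_mult algebra_simps)
      then show "(\<Prod>g\<in>S. cf g (k g) * cis (of_int (k g) * g * u)) = c k * cis (fr k * u)"
        by (simp add: c_def prod.distrib)
    qed
    finally show ?thesis .
  qed
  \<comment> \<open>The frequency \<open>fr k\<close> in ln y belongs to the imaginary part -
    \<open>fr k\<close> of w, because the kernel is y to the power -w.\<close>
  define X where "X = (\<lambda>k. (if fr k = 0 then of_real C else 0) - of_real \<sigma>g * a (- fr k))"
  have lim: "((\<lambda>\<sigma>. \<Sum>k\<in>PE. c k * (of_real \<sigma> * L (Complex (1/2 + \<sigma>) (- fr k)))) \<longlongrightarrow> (\<Sum>k\<in>PE. c k * X k)) (at_right 0)"
  proof (intro tendsto_sum tendsto_mult tendsto_const)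
    fix k show "((\<lambda>\<sigma>. of_real \<sigma> * L (Complex (1/2 + \<sigma>) (- fr k))) \<longlongrightarrow> X k) (at_right 0)"
      using L_mean[of "- fr k"] by (simp add: X_def)
  qed
  have pos: "Re (\<Sum>k\<in>PE. c k * (of_real \<sigma> * L (Complex (1/2 + \<sigma>) (- fr k)))) \<ge> 0" if s: "\<sigma> > 0" for \<sigma>
  proof -
    let ?w = "\<lambda>k. Complex (1/2 + \<sigma>) (- fr k)"
    have int: "integrable lborel (\<lambda>y. complex_of_real (f y) * exp (?w k * lg y))" for k
    proof (rule laplace_power_series(3)[where a = "?w k" and r = "\<sigma> / 2"])
      have *: "integrable lborel (\<lambda>y. norm (complex_of_real (f y)) * exp (\<tau> * lg y))" if "\<tau> > 1/2" for \<tau>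
        using landau_applied(1)[OF that] f_nonneg by simp
      show "integrable lborel (\<lambda>y. norm (complex_of_real (f y)) * exp ((Re (?w k) + \<sigma> / 2) * lg y))"
        "integrable lborel (\<lambda>y. norm (complex_of_real (f y)) * exp ((Re (?w k) - \<sigma> / 2) * lg y))"
        by (rule *; use s in simp)+
    qed (use s in auto)
    have "(\<Sum>k\<in>PE. c k * L (?w k)) = (\<integral>y. (\<Sum>k\<in>PE. c k * (complex_of_real (f y) * exp (?w k * lg y))) \<partial>lborel)"
      unfolding L_def by (subst Bochner_Integration.integral_sum) (auto intro: int)
    also have "\<dots> = (\<integral>y. complex_of_real (f y * P (- lg y) * exp ((1/2 + \<sigma>) * lg y)) \<partial>lborel)"
    proof (intro Bochner_Integration.integral_cong refl)
      fix y
      have "exp (?w k * lg y) = of_real (exp ((1/2 + \<sigma>) * lg y)) * cis (fr k * (- lg y))" for k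
      proof -
        have "?w k * lg y = of_real ((1/2 + \<sigma>) * lg y) + \<i> * of_real (fr k * (- lg y))"
          by (simp add: complex_eq_iff)
        then show ?thesis by (simp only: exp_add exp_of_real cis_conv_exp)
      qed
      then have "(\<Sum>k\<in>PE. c k * (complex_of_real (f y) * exp (?w k * lg y)))
          = (\<Sum>k\<in>PE. (of_real (f y) * of_real (exp ((1/2 + \<sigma>) * lg y))) * (c k * cis (fr k * (- lg y))))"
        by (intro sum.cong refl) (simp add: mult_ac)
      also have "\<dots> = (of_real (f y) * of_real (exp ((1/2 + \<sigma>) * lg y))) * of_real (P (- lg y))"
        unfolding Pexp by (rule sum_distrib_left[symmetric])
      finally show "(\<Sum>k\<in>PE. c k * (complex_of_real (f y) * exp (?w k * lg y)))
          = complex_of_real (f y * P (- lg y) * exp ((1/2 + \<sigma>) * lg y))"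
        by (simp add: mult_ac)
    qed
    also have "\<dots> = of_real (\<integral>y. f y * P (- lg y) * exp ((1/2 + \<sigma>) * lg y) \<partial>lborel)"
      by (rule integral_complex_of_real)
    finally have e: "(\<Sum>k\<in>PE. c k * L (?w k)) = of_real (\<integral>y. f y * P (- lg y) * exp ((1/2 + \<sigma>) * lg y) \<partial>lborel)" .
    have "(\<Sum>k\<in>PE. c k * (of_real \<sigma> * L (?w k))) = of_real \<sigma> * (\<Sum>k\<in>PE. c k * L (?w k))"
      by (simp add: sum_distrib_left mult_ac)
    then have "Re (\<Sum>k\<in>PE. c k * (of_real \<sigma> * L (?w k))) = \<sigma> * (\<integral>y. f y * P (- lg y) * exp ((1/2 + \<sigma>) * lg y) \<partial>lborel)"
      unfolding e by simp
    also have "\<dots> \<ge> 0"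
      using s f_nonneg P0 by (intro mult_nonneg_nonneg Bochner_Integration.integral_nonneg) auto
    finally show ?thesis .
  qed
  have "Re (\<Sum>k\<in>PE. c k * X k) \<ge> 0"
  proof (rule tendsto_lowerbound[OF tendsto_Re[OF lim]])
    show "\<forall>\<^sub>F \<sigma> in at_right 0. 0 \<le> Re (\<Sum>k\<in>PE. c k * (of_real \<sigma> * L (Complex (1/2 + \<sigma>) (- fr k))))"
      by (rule eventually_at_rightI[of 0 1], rule pos) auto
  qed simp
  moreover have "(\<Sum>k\<in>PE. c k * X k) = of_real C - of_real \<sigma>g * a 0 - (\<Sum>h\<in>S. of_real (norm (a h)))"
  proof -
    \<comment> \<open>Choice functions in \<open>PiE\<close> must be \<open>undefined\<close> off S;
      hence neither the zero choice nor the single-ordinate choices may be plainly zero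
      there.\<close>
    define k0 where "k0 = (\<lambda>g. if g \<in> S then 0 else undefined :: int)"
    define e where "e = (\<lambda>(h, s) g. if g \<in> S then (if g = h then s else 0) else undefined :: int)"
    let ?T = "S \<times> {1, -1}"
    have gpos: "g > 0" if "g \<in> S" for g using S that by (auto simp: ordinates_def)
    have sub: "insert k0 (e ` ?T) \<subseteq> PE"
      by (auto simp: PE_def k0_def e_def K_def PiE_def extensional_def split: if_splits)
    have fr0: "fr k0 = 0" by (simp add: fr_def k0_def)
    have fre: "fr (e (h, s)) = of_int s * h" if "h \<in> S" for h s
    proof -
      have "fr (e (h, s)) = (\<Sum>g\<in>S. if g = h then of_int s * h else 0)"
        unfolding fr_def e_def by (intro sum.cong refl) auto
      then show ?thesis using that S by simp
    qed
    have "(\<Sum>k\<in>PE. c k * X k) = (\<Sum>k\<in>insert k0 (e ` ?T). c k * X k)"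
    proof (rule sum.mono_neutral_right[OF finPE sub], intro ballI, rule ccontr)
      fix k assume k: "k \<in> PE - insert k0 (e ` ?T)" and nz: "c k * X k \<noteq> 0"
      have ext: "k g = undefined" if "g \<notin> S" for g
        using k that by (auto simp: PE_def PiE_def extensional_def)
      show False
      proof (cases "fr k = 0")
        case True
        then have "k g = 0" if "g \<in> S" for g
          using LI_combination_zero[OF LI S, of k g] that by (simp add: fr_def)
        then have "k = k0" using ext by (auto simp: k0_def fun_eq_iff)
        then show False using k by simp
      next
        case False
        then have "a (- fr k) \<noteq> 0" using nz by (auto simp: X_def)
        then have "a (fr k) \<noteq> 0" using a_minus[of "fr k"] by simp
        \<comment> \<open>A nonzero residue at a nonzero frequency forces the frequency, up to sign,
          to be an ordinate. That this ordinate belongs to S is part of what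
          \<open>LI_combination_single\<close> yields.\<close>
        obtain h s where hs: "h \<in> ordinates" "s \<in> {1, -1::int}" "fr k = of_int s * h"
        proof (cases "fr k > 0")
          case True
          then show ?thesis using that[of "fr k" 1] a_nonzero_ordinate[OF \<open>a (fr k) \<noteq> 0\<close>] by simp
        next
          case False
          then show ?thesis
            using that[of "- fr k" "-1"] a_nonzero_ordinate[OF \<open>a (- fr k) \<noteq> 0\<close>] \<open>fr k \<noteq> 0\<close> by simp
        qed
        have s0: "s \<noteq> 0" using hs(2) by auto
        have eq: "(\<Sum>g\<in>S. of_int (k g) * g) = of_int s * h" using hs(3) by (simp add: fr_def)
        note sing = LI_combination_single[OF LI S hs(1) eq s0]
        have "k = e (h, s)" using sing(2) ext by (auto simp: e_def fun_eq_iff)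
        then show False using k sing(1) hs(2) by blast
      qed
    qed
    also have "\<dots> = c k0 * X k0 + (\<Sum>k\<in>e ` ?T. c k * X k)"
    proof (rule sum.insert)
      show "k0 \<notin> e ` ?T"
      proof
        assume "k0 \<in> e ` ?T"
        then obtain h s where "h \<in> S" "s \<in> {1, -1}" "k0 = e (h, s)" by auto
        then have "fr k0 \<noteq> 0" using fre[of h s] gpos[of h] by auto
        then show False using fr0 by simp
      qed
    qed (use S in auto)
    also have "(\<Sum>k\<in>e ` ?T. c k * X k) = (\<Sum>p\<in>?T. c (e p) * X (e p))"
    proof (subst sum.reindex)
      show "inj_on e ?T"
      proof (rule inj_onI)
        fix p q assume pq: "p \<in> ?T" "q \<in> ?T" "e p = e q"
        obtain h s h' s' where hs: "p = (h, s)" "q = (h', s')" by (cases p, cases q)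
        have "e p h = s" using pq(1) hs by (auto simp: e_def)
        moreover have "e q h = (if h = h' then s' else 0)" using pq(1,2) hs by (auto simp: e_def)
        ultimately have "s = (if h = h' then s' else 0)" using pq(3) by simp
        moreover have "s \<noteq> 0" using pq(1) hs by auto
        ultimately show "p = q" using hs by (auto split: if_splits)
      qed
    qed simp
    also have "\<dots> = (\<Sum>h\<in>S. \<Sum>s\<in>{1,-1}. c (e (h, s)) * X (e (h, s)))"
      by (subst sum.cartesian_product) (intro sum.cong refl, auto)
    also have "\<dots> = (\<Sum>h\<in>S. - of_real (norm (a h)))"
    proof (intro sum.cong refl)
      fix h assume h: "h \<in> S"
      have ce: "c (e (h, s)) = cf h s" for s
      proof -
        have "c (e (h, s)) = (\<Prod>g\<in>S. if g = h then cf h s else 1)"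
          unfolding c_def by (intro prod.cong refl) (auto simp: e_def cf_def)
        then show ?thesis using h S by simp
      qed
      have Xe: "X (e (h, s)) = - (of_real \<sigma>g * a (- (of_int s * h)))" if "s \<in> {1, -1}" for s
        using fre[OF h, of s] gpos[OF h] that by (auto simp: X_def)
      have z: "of_real \<sigma>g * a h = of_real (norm (a h)) * cis (\<phi> h)"
      proof -
        have "of_real \<sigma>g * a h = rcis (norm (of_real \<sigma>g * a h)) (\<phi> h)"
          unfolding \<phi>_def by (rule rcis_cmod_Arg[symmetric])
        moreover have "norm (of_real \<sigma>g * a h) = norm (a h)" using sg by (auto simp: norm_mult)
        ultimately show ?thesis by (simp add: rcis_def)
      qed
      have zc: "of_real \<sigma>g * a (- h) = of_real (norm (a h)) * cis (- \<phi> h)"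
      proof -
        have "of_real \<sigma>g * a (- h) = cnj (of_real \<sigma>g * a h)" by (simp add: a_minus)
        then show ?thesis unfolding z by (simp add: cis_cnj)
      qed
      have "(\<Sum>s\<in>{1,-1}. c (e (h, s)) * X (e (h, s)))
          = cis (\<phi> h) / 2 * (- (of_real \<sigma>g * a (- h))) + cis (- \<phi> h) / 2 * (- (of_real \<sigma>g * a h))"
        unfolding ce using Xe[of 1] Xe[of "-1"] by (simp add: cf_def)
      also have "\<dots> = - of_real (norm (a h)) * (cis (\<phi> h) * cis (- \<phi> h))"
        unfolding z zc by (simp add: algebra_simps)
      also have "cis (\<phi> h) * cis (- \<phi> h) = 1" by (simp add: cis_mult)
      finally show "(\<Sum>s\<in>{1,-1}. c (e (h, s)) * X (e (h, s))) = - of_real (norm (a h))" by simp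
    qed
    also have "c k0 * X k0 = of_real C - of_real \<sigma>g * a 0"
    proof -
      have "c k0 = 1" unfolding c_def k0_def by (intro prod.neutral) (auto simp: cf_def)
      then show ?thesis by (simp add: X_def fr0)
    qed
    finally show ?thesis by (simp add: sum_negf)
  qed
  ultimately show ?thesis by (simp add: Re_sum)
qed

end


section \<open>A lower bound for the residues\<close>

lemma zeta_not_constant: "\<not> zeta constant_on -{1}"
proof
  assume "zeta constant_on -{1}"
  then obtain c where c: "\<And>s. s \<noteq> 1 \<Longrightarrow> zeta s = c" by (auto simp: constant_on_def)
  have "isCont zeta_reg 1"
    using holomorphic_on_imp_continuous_on[OF zeta_reg_holomorphic[of UNIV]] by (simp add: continuous_on_eq_continuous_at)
  then have "(zeta_reg \<longlongrightarrow> 1) (at 1)" by (simp add: isCont_def zeta_reg_def)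
  moreover have "((\<lambda>s. (s - 1) * c) \<longlongrightarrow> (1 - 1) * c) (at 1)" by (intro tendsto_intros)
  moreover have "\<forall>\<^sub>F s in at 1. (s - 1) * c = zeta_reg s"
    unfolding eventually_at by (intro exI[of _ 1]) (auto simp: zeta_reg_def c)
  ultimately have "(zeta_reg \<longlongrightarrow> (1 - 1) * c) (at 1)" using Lim_transform_eventually by blast
  then have "1 = (1 - 1) * c" using \<open>(zeta_reg \<longlongrightarrow> 1) (at 1)\<close> tendsto_unique by (metis trivial_limit_at)
  then show False by simp
qed

lemma finite_zeta_zeros_cbox:
  assumes "Im a > 0"
  shows "finite {z \<in> cbox a b. zeta z = 0}"
proof (rule holomorphic_compact_finite_zeros[OF zeta_holomorphic])
  show "connected (-{1::complex})" by (rule connected_punctured_universe) simp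
  show "cbox a b \<subseteq> -{1}" using assms by (auto simp: in_cbox_complex_iff)
qed (auto simp: zeta_not_constant)

text \<open>These constants depend on \<zeta> alone and are fixed before any one-sided bound is
  assumed; this is what makes the final constant absolute. The height avoids the finitely many zeros
  in a box of unit height, and starting above 4 C turns the decay C / t on the left line into
  1/4.\<close>

lemma contour_constants:
  obtains t\<^sub>0 C\<^sub>b :: real where "t\<^sub>0 \<ge> 2" "C\<^sub>b > 0"
    "\<And>x. -1/2 \<le> x \<Longrightarrow> x \<le> 4 \<Longrightarrow> zeta (Complex x t\<^sub>0) \<noteq> 0"
    "\<And>x. -1/2 \<le> x \<Longrightarrow> x \<le> 4 \<Longrightarrow> norm (1 / zeta (Complex x t\<^sub>0)) \<le> C\<^sub>b"
    "\<And>t. t \<ge> t\<^sub>0 \<Longrightarrow> norm (1 / zeta (Complex (-1/2) t)) \<le> 1/4"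
proof -
  obtain C where C: "C > 0" "\<And>y. y > 0 \<Longrightarrow> norm (1 / zeta (Complex (-1/2) y)) \<le> C / y"
    using inverse_zeta_left_line by blast
  define t1 where "t1 = max 2 (4 * C)"
  have t1: "t1 \<ge> 2" "t1 \<ge> 4 * C" by (auto simp: t1_def)
  let ?Z = "{z \<in> cbox (Complex (-1/2) t1) (Complex 4 (t1 + 1)). zeta z = 0}"
  have fin: "finite (Im ` ?Z)" using t1 by (intro finite_imageI finite_zeta_zeros_cbox) simp
  have "infinite {t1..t1 + 1}" by simp
  then have "\<not> {t1..t1 + 1} \<subseteq> Im ` ?Z" using fin finite_subset by blast
  then obtain t0 where "t0 \<in> {t1..t1 + 1}" "t0 \<notin> Im ` ?Z" by blast
  then have t0: "t1 \<le> t0" "t0 \<le> t1 + 1" "t0 \<notin> Im ` ?Z" by simp_all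
  have nz: "zeta (Complex x t0) \<noteq> 0" if "-1/2 \<le> x" "x \<le> 4" for x
  proof
    assume "zeta (Complex x t0) = 0"
    then have "Complex x t0 \<in> ?Z" using that t0 by (simp add: in_cbox_complex_iff)
    then have "Im (Complex x t0) \<in> Im ` ?Z" by (rule imageI)
    then show False using t0 by simp
  qed
  have "compact ((\<lambda>x. 1 / zeta (Complex x t0)) ` {-1/2..4})"
  proof (rule compact_continuous_image)
    have "continuous_on ((\<lambda>x. Complex x t0) ` {-1/2..4}) zeta"
      by (rule continuous_on_subset[OF holomorphic_on_imp_continuous_on[OF zeta_holomorphic]])
         (use t0 t1 in \<open>auto simp: complex_eq_iff\<close>)
    moreover have "continuous_on {-1/2..4} (\<lambda>x. Complex x t0)" unfolding Complex_eq by (intro continuous_intros)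
    ultimately have "continuous_on {-1/2..4} (zeta \<circ> (\<lambda>x. Complex x t0))" by (intro continuous_on_compose)
    then show "continuous_on {-1/2..4} (\<lambda>x. 1 / zeta (Complex x t0))"
      using nz by (intro continuous_intros) (auto simp: o_def)
  qed simp
  then have "bounded ((\<lambda>x. 1 / zeta (Complex x t0)) ` {-1/2..4})" by (rule compact_imp_bounded)
  then obtain M where "\<forall>z\<in>(\<lambda>x. 1 / zeta (Complex x t0)) ` {-1/2..4}. norm z \<le> M" unfolding bounded_iff by blast
  then have M: "norm (1 / zeta (Complex x t0)) \<le> M" if "-1/2 \<le> x" "x \<le> 4" for x using that by auto
  show ?thesis
  proof (rule that[of t0 "max M 1"])
    show "norm (1 / zeta (Complex (-1/2) t)) \<le> 1/4" if "t \<ge> t0" for t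
    proof -
      have t: "t > 0" "4 * C \<le> t" using that t0 t1 by auto
      have "norm (1 / zeta (Complex (-1/2) t)) \<le> C / t" using C(2) t by blast
      also have "\<dots> \<le> 1/4" using t by (simp add: field_simps)
      finally show ?thesis .
    qed
    show "norm (1 / zeta (Complex x t0)) \<le> max M 1" if "-1/2 \<le> x" "x \<le> 4" for x
      using M[OF that] by simp
  qed (use t0 t1 nz in auto)
qed

text \<open>The linear factor vanishes at \<open>1/2 + \<i>T\<close>, where the top edge of the contour crosses the
  critical line. It compensates for the factor \<open>1 / \<bar>Re s - 1/2\<bar>\<close> in the available bound for
  \<open>1/\<zeta>\<close>, so that no well-spaced heights \<open>T\<close> are needed.\<close>

definition contour_fun :: "real \<Rightarrow> real \<Rightarrow> complex \<Rightarrow> complex" where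
  "contour_fun \<epsilon> T s = exp (\<i> * of_real \<epsilon> * s) * (1 + \<i> * (s - 1/2) / of_real T) / zeta s"

lemma norm_contour_fun:
  "norm (contour_fun \<epsilon> T s) = exp (- \<epsilon> * Im s) * norm (1 + \<i> * (s - 1/2) / of_real T) * norm (1 / zeta s)"
  by (simp add: contour_fun_def norm_mult norm_divide)

lemma integral_exp_linear:
  fixes \<epsilon> \<alpha> \<beta> :: real
  assumes "\<epsilon> > 0" "a \<le> b"
  shows "((\<lambda>t. exp (- \<epsilon> * t) * (\<alpha> - \<beta> * t)) has_integral
     (exp (- \<epsilon> * a) * ((\<alpha> - \<beta> * a) / \<epsilon> - \<beta> / \<epsilon>\<^sup>2) - exp (- \<epsilon> * b) * ((\<alpha> - \<beta> * b) / \<epsilon> - \<beta> / \<epsilon>\<^sup>2))) {a..b}"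
proof -
  let ?H = "\<lambda>t. - exp (- \<epsilon> * t) * ((\<alpha> - \<beta> * t) / \<epsilon> - \<beta> / \<epsilon>\<^sup>2)"
  have "((\<lambda>t. exp (- \<epsilon> * t) * (\<alpha> - \<beta> * t)) has_integral (?H b - ?H a)) {a..b}"
  proof (rule fundamental_theorem_of_calculus[OF assms(2)])
    fix t
    have "(?H has_real_derivative exp (- \<epsilon> * t) * (\<alpha> - \<beta> * t)) (at t within {a..b})"
      using assms(1) by (auto intro!: derivative_eq_intros simp: field_simps power2_eq_square)
    then show "(?H has_vector_derivative exp (- \<epsilon> * t) * (\<alpha> - \<beta> * t)) (at t within {a..b})"
      by (simp add: has_real_derivative_iff_has_vector_derivative)
  qed
  moreover have "?H b - ?H a = exp (- \<epsilon> * a) * ((\<alpha> - \<beta> * a) / \<epsilon> - \<beta> / \<epsilon>\<^sup>2) - exp (- \<epsilon> * b) * ((\<alpha> - \<beta> * b) / \<epsilon> - \<beta> / \<epsilon>\<^sup>2)"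
    by simp
  ultimately show ?thesis by (simp only:)
qed

section \<open>The contour integral under a one-sided bound\<close>

context one_sided_bound
begin

text \<open>Right of the critical line \<open>norm w + 1\<close> is at most six times the height,
  whence the factor 36; left of it the reflection bound applies. K depends on \<delta>, C and B,
  which is harmless because it will be multiplied by T exp (- \<epsilon>T).\<close>

lemma top_edge_bound:
  obtains K where "K > 0"
    "\<And>x t. -1/2 \<le> x \<Longrightarrow> x \<le> 4 \<Longrightarrow> x \<noteq> 1/2 \<Longrightarrow> t \<ge> 1 \<Longrightarrow> norm (1 / zeta (Complex x t)) \<le> K * t\<^sup>2 / \<bar>x - 1/2\<bar>"
proof -
  obtain K1 where K1: "K1 > 0"
    "\<And>w. 1/2 < Re w \<Longrightarrow> Re w \<le> 4 \<Longrightarrow> w \<noteq> 1 \<Longrightarrow> norm (1 / zeta w) \<le> K1 * (norm w + 1)\<^sup>2 / (Re w - 1/2)"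
    using inverse_zeta_right_bound by blast
  obtain K2 where K2: "K2 > 0"
    "\<And>s. -1/2 \<le> Re s \<Longrightarrow> Re s \<le> 1/2 \<Longrightarrow> Im s \<ge> 1 \<Longrightarrow> norm (1 / zeta s) \<le> K2 * norm (1 / zeta (1 - s))"
    using inverse_zeta_reflect_bound by blast
  have K1': "norm (1 / zeta (Complex x y)) \<le> K1 * (36 * y\<^sup>2) / (x - 1/2)" if "1/2 < x" "x \<le> 4" "\<bar>y\<bar> \<ge> 1" for x y
  proof -
    have "norm (Complex x y) + 1 \<le> 6 * \<bar>y\<bar>" using cmod_le[of "Complex x y"] that by simp
    then have "(norm (Complex x y) + 1)\<^sup>2 \<le> (6 * \<bar>y\<bar>)\<^sup>2" by (intro power_mono) auto
    then have "(norm (Complex x y) + 1)\<^sup>2 \<le> 36 * y\<^sup>2" by (simp add: power_mult_distrib)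
    then have "K1 * (norm (Complex x y) + 1)\<^sup>2 / (Re (Complex x y) - 1/2) \<le> K1 * (36 * y\<^sup>2) / (Re (Complex x y) - 1/2)"
      using that K1(1) by (intro divide_right_mono mult_left_mono) auto
    moreover have "Complex x y \<noteq> 1" using that by (auto simp: complex_eq_iff)
    ultimately show ?thesis using K1(2)[of "Complex x y"] that by simp
  qed
  define K where "K = 36 * K1 * (1 + K2)"
  have "norm (1 / zeta (Complex x t)) \<le> K * t\<^sup>2 / \<bar>x - 1/2\<bar>" if x: "-1/2 \<le> x" "x \<le> 4" "x \<noteq> 1/2" "t \<ge> 1" for x t
  proof (cases "x > 1/2")
    case True
    have "norm (1 / zeta (Complex x t)) \<le> K1 * (36 * t\<^sup>2) / (x - 1/2)" by (rule K1') (use True x in auto)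
    also have "\<dots> \<le> K * t\<^sup>2 / (x - 1/2)"
      using True K1 K2 by (intro divide_right_mono) (auto simp: K_def algebra_simps)
    finally show ?thesis using True by simp
  next
    case False
    have e: "1 - Complex x t = Complex (1 - x) (- t)" by (simp add: complex_eq_iff)
    have "norm (1 / zeta (Complex x t)) \<le> K2 * norm (1 / zeta (1 - Complex x t))"
      by (rule K2(2)) (use False x in auto)
    also have "\<dots> \<le> K2 * (K1 * (36 * (- t)\<^sup>2) / (1 - x - 1/2))"
      unfolding e by (rule mult_left_mono[OF K1']) (use False x K2 in auto)
    also have "\<dots> = K2 * K1 * 36 * t\<^sup>2 / \<bar>x - 1/2\<bar>" using False x by (simp add: abs_if)
    also have "\<dots> \<le> K * t\<^sup>2 / \<bar>x - 1/2\<bar>"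
      using K1 K2 by (intro divide_right_mono) (auto simp: K_def algebra_simps)
    finally show ?thesis .
  qed
  moreover have "K > 0" using K1 K2 by (simp add: K_def)
  ultimately show ?thesis using that by blast
qed

text \<open>The contour reaches beyond the open critical strip on both sides, so zeros there are
  excluded too: on the right by \<open>zeta_right_nonzero\<close>, on the left by
  reflection.\<close>

lemma zeta_zero_on_critical_line:
  assumes "zeta z = 0" "Im z > 0"
  shows "Re z = 1/2"
proof (rule ccontr)
  assume "Re z \<noteq> 1/2"
  moreover have ne: "z \<noteq> 1" "1 - z \<noteq> 1" using assms(2) by auto
  ultimately consider "Re z > 1/2" | "Re (1 - z) > 1/2" by fastforce
  then show False
  proof cases
    case 1
    then show False using zeta_right_nonzero[of z] ne assms by blast
  next
    case 2
    then show False using zeta_right_nonzero[of "1 - z"] zeta_zero_reflect[OF assms(2)] ne assms by blast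
  qed
qed

lemma zeros_in_box:
  assumes "t\<^sub>0 > 0"
  shows "{z \<in> box (Complex (-1/2) t\<^sub>0) (Complex 4 T). zeta z = 0} = (\<lambda>g. Complex (1/2) g) ` (ordinates \<inter> {t\<^sub>0<..<T})"
proof safe
  fix z assume z: "z \<in> box (Complex (-1/2) t\<^sub>0) (Complex 4 T)" "zeta z = 0"
  then have i: "t\<^sub>0 < Im z" "Im z < T" by (auto simp: in_box_complex_iff)
  then have "Re z = 1/2" using zeta_zero_on_critical_line z assms by auto
  then have "z \<in> nontrivial_zeros" "z = Complex (1/2) (Im z)" using z by (auto simp: nontrivial_zeros_def complex_eq_iff)
  then show "z \<in> (\<lambda>g. Complex (1/2) g) ` (ordinates \<inter> {t\<^sub>0<..<T})"
    using i assms by (intro image_eqI[of _ _ "Im z"]) (auto simp: ordinates_def)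
next
  fix g assume g: "g \<in> ordinates" "g \<in> {t\<^sub>0<..<T}"
  then obtain \<rho> where r: "\<rho> \<in> nontrivial_zeros" "g = Im \<rho>" by (auto simp: ordinates_def)
  then have "Re \<rho> = 1/2" using RH by (auto simp: Riemann_Hypothesis_def)
  then have "\<rho> = Complex (1/2) g" using r by (simp add: complex_eq_iff)
  then show "zeta (Complex (1/2) g) = 0" using r by (simp add: nontrivial_zeros_def)
  show "Complex (1/2) g \<in> box (Complex (-1/2) t\<^sub>0) (Complex 4 T)" using g by (simp add: in_box_complex_iff)
qed

lemma ordinates_zeta_zero: "g \<in> ordinates \<Longrightarrow> zeta (Complex (1/2) g) = 0"
  using zeros_in_box[of "g / 2" "g + 1"] by (auto simp: ordinates_def)

lemma finite_ordinates: "finite (ordinates \<inter> {t..T})"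
proof (rule finite_subset)
  show "finite (Im ` {\<rho> \<in> nontrivial_zeros. \<bar>Im \<rho>\<bar> \<le> max T (- t)})"
    by (intro finite_imageI finite_nontrivial_zeros)
qed (auto simp: ordinates_def)

lemma contour_fun_residue:
  assumes "g \<in> ordinates" "T \<noteq> 0"
  shows "residue (contour_fun \<epsilon> T) (Complex (1/2) g)
    = exp (\<i> * of_real \<epsilon> * Complex (1/2) g) * (1 + \<i> * (Complex (1/2) g - 1/2) / of_real T) / deriv zeta (Complex (1/2) g)"
proof -
  let ?\<rho> = "Complex (1/2) g"
  let ?num = "\<lambda>s. exp (\<i> * of_real \<epsilon> * s) * (1 + \<i> * (s - 1/2) / of_real T)"
  have z: "zeta ?\<rho> = 0" by (rule ordinates_zeta_zero[OF assms(1)])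
  have g0: "g > 0" using assms by (simp add: ordinates_def)
  have "((\<lambda>w. ?num w * ((w - ?\<rho>) / zeta w)) \<longlongrightarrow> ?num ?\<rho> * zeta_inv_res ?\<rho>) (at ?\<rho>)"
  proof (rule tendsto_mult[OF _ zeta_inv_res_tendsto[OF SZ]])
    have "isCont ?num ?\<rho>" unfolding divide_inverse by (intro continuous_intros)
    then show "(?num \<longlongrightarrow> ?num ?\<rho>) (at ?\<rho>)" by (simp only: isCont_def)
  qed simp
  then have lim: "((\<lambda>w. contour_fun \<epsilon> T w * (w - ?\<rho>)) \<longlongrightarrow> ?num ?\<rho> / deriv zeta ?\<rho>) (at ?\<rho>)"
    using z by (simp add: contour_fun_def zeta_inv_res_def)
  let ?b = "box (Complex 0 (g/2)) (Complex 1 (g + 1))"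
  have fin: "finite {z \<in> ?b. zeta z = 0}"
    by (rule finite_subset[OF _ finite_zeta_zeros_cbox[of "Complex 0 (g/2)" "Complex 1 (g + 1)"]])
       (use g0 in \<open>auto simp: in_box_complex_iff in_cbox_complex_iff\<close>)
  define S where "S = ?b - ({z \<in> ?b. zeta z = 0} - {?\<rho>})"
  have "open S" unfolding S_def by (intro open_Diff open_box finite_imp_closed) (use fin in auto)
  moreover have "?\<rho> \<in> S" using g0 by (auto simp: S_def in_box_complex_iff)
  moreover have "contour_fun \<epsilon> T holomorphic_on (S - {?\<rho>})"
    unfolding contour_fun_def
  proof (intro holomorphic_intros)
    show "1 \<notin> S - {?\<rho>}" using g0 by (auto simp: S_def in_box_complex_iff)
  qed (use g0 assms(2) in \<open>auto simp: S_def\<close>)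
  ultimately show ?thesis by (rule residue_simple'[OF _ _ _ lim])
qed

text \<open>The right edge is bounded below and the other three edges above, so the residues must
  make up the difference. For small \<epsilon> and large T the right edge contributes about 3 /
  (4\<epsilon>) and the left edge at most about 1 / (4\<epsilon>); bottom and top have length 9/2,
  with integrands at most \<open>2 * C\<^sub>b\<close> and K T exp (- \<epsilon>T).\<close>

theorem contour_lower_bound:
  assumes t0: "t\<^sub>0 \<ge> 2" "C\<^sub>b > 0"
    and b1: "\<And>x. -1/2 \<le> x \<Longrightarrow> x \<le> 4 \<Longrightarrow> zeta (Complex x t\<^sub>0) \<noteq> 0"
    and b2: "\<And>x. -1/2 \<le> x \<Longrightarrow> x \<le> 4 \<Longrightarrow> norm (1 / zeta (Complex x t\<^sub>0)) \<le> C\<^sub>b"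
    and b3: "\<And>t. t \<ge> t\<^sub>0 \<Longrightarrow> norm (1 / zeta (Complex (-1/2) t)) \<le> 1/4"
    and K: "K > 0" "\<And>x t. -1/2 \<le> x \<Longrightarrow> x \<le> 4 \<Longrightarrow> x \<noteq> 1/2 \<Longrightarrow> t \<ge> 1 \<Longrightarrow> norm (1 / zeta (Complex x t)) \<le> K * t\<^sup>2 / \<bar>x - 1/2\<bar>"
    and \<epsilon>: "\<epsilon> > 0" and T: "T \<ge> t\<^sub>0 + 4" "T \<notin> ordinates"
  shows "exp (- \<epsilon> * t\<^sub>0) * ((3/4 - 1/T - 3/(4*T) * t\<^sub>0) / \<epsilon> - 3/(4*T) / \<epsilon>\<^sup>2) - (1 + 1/T) / (4 * \<epsilon>) - 9 * C\<^sub>b - 9/2 * (K * T * exp (- \<epsilon> * T))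
    \<le> 2 * pi * (\<Sum>g\<in>ordinates \<inter> {t\<^sub>0<..<T}. exp (- \<epsilon> * g) / norm (deriv zeta (Complex (1/2) g)))"
proof -
  define \<Phi> where "\<Phi> = contour_fun \<epsilon> T"
  define a1 a2 a3 a4 where "a1 = Complex (-1/2) t\<^sub>0" and "a2 = Complex 4 t\<^sub>0" and "a3 = Complex 4 T" and "a4 = Complex (-1/2) T"
  note adefs = a1_def a2_def a3_def a4_def
  have T0: "T > t\<^sub>0" "T > 0" "T \<ge> 6" using T t0 by auto
  define S where "S = box (Complex (-1) (t\<^sub>0 / 2)) (Complex 5 (T + 1))"
  define pts where "pts = {z \<in> S. zeta z = 0}"
  have finpts: "finite pts"
    by (rule finite_subset[OF _ finite_zeta_zeros_cbox[of "Complex (-1) (t\<^sub>0 / 2)" "Complex 5 (T + 1)"]])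
       (use t0 in \<open>auto simp: pts_def S_def in_box_complex_iff in_cbox_complex_iff\<close>)
  have one: "1 \<notin> S" using t0 by (auto simp: S_def in_box_complex_iff)
  have hol: "\<Phi> holomorphic_on S - pts"
    unfolding \<Phi>_def contour_fun_def
  proof (intro holomorphic_intros)
    show "1 \<notin> S - pts" using one by simp
  qed (use T0 in \<open>auto simp: pts_def\<close>)
  have imgS: "path_image (rectpath a1 a3) \<subseteq> S - pts"
  proof
    fix z assume "z \<in> path_image (rectpath a1 a3)"
    then have "z \<in> cbox a1 a3 - box a1 a3"
      using path_image_rectpath_cbox_minus_box[of a1 a3] T0 by (simp add: adefs)
    then have z: "-1/2 \<le> Re z" "Re z \<le> 4" "t\<^sub>0 \<le> Im z" "Im z \<le> T"
        "\<not> (-1/2 < Re z \<and> Re z < 4 \<and> t\<^sub>0 < Im z \<and> Im z < T)"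
      by (auto simp: adefs in_box_complex_iff in_cbox_complex_iff)
    have "zeta z \<noteq> 0"
    proof
      assume zz: "zeta z = 0"
      have "Re z = 1/2" using zeta_zero_on_critical_line[OF zz] z t0 by auto
      then have zc: "z = Complex (1/2) (Im z)" "Im z = t\<^sub>0 \<or> Im z = T" using z by (auto simp: complex_eq_iff)
      have "z \<in> nontrivial_zeros" using zz \<open>Re z = 1/2\<close> by (simp add: nontrivial_zeros_def)
      then have "Im z \<in> ordinates" using z t0 by (auto simp: ordinates_def)
      then have "Im z = t\<^sub>0" using zc T by auto
      then show False using b1[of "1/2"] zz zc(1) by simp
    qed
    then show "z \<in> S - pts" using z t0 by (auto simp: S_def pts_def in_box_complex_iff)
  qed
  have S: "open S" "connected S" unfolding S_def by (auto intro: convex_connected)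
  have wn: "\<forall>z. z \<notin> S \<longrightarrow> winding_number (rectpath a1 a3) z = 0"
  proof (intro allI impI)
    fix z assume "z \<notin> S"
    then have "z \<notin> cbox a1 a3" using t0 by (auto simp: S_def adefs in_box_complex_iff in_cbox_complex_iff)
    then show "winding_number (rectpath a1 a3) z = 0"
      using T0 by (intro winding_number_rectpath_outside) (auto simp: adefs)
  qed
  have "contour_integral (rectpath a1 a3) \<Phi> = 2 * pi * \<i> * (\<Sum>p\<in>pts. winding_number (rectpath a1 a3) p * residue \<Phi> p)"
    by (rule Residue_theorem[OF S finpts hol _ _ imgS wn]) auto
  also have "(\<Sum>p\<in>pts. winding_number (rectpath a1 a3) p * residue \<Phi> p)
      = (\<Sum>p\<in>{z \<in> box a1 a3. zeta z = 0}. residue \<Phi> p)"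
  proof (rule sum.mono_neutral_cong_right[OF finpts])
    show "{z \<in> box a1 a3. zeta z = 0} \<subseteq> pts"
      using t0 by (auto simp: pts_def S_def adefs in_box_complex_iff)
    show "\<forall>i\<in>pts - {z \<in> box a1 a3. zeta z = 0}. winding_number (rectpath a1 a3) i * residue \<Phi> i = 0"
    proof
      fix i assume i: "i \<in> pts - {z \<in> box a1 a3. zeta z = 0}"
      then have "i \<notin> path_image (rectpath a1 a3)" "i \<notin> box a1 a3" using imgS by (auto simp: pts_def)
      then have "i \<notin> cbox a1 a3"
        using path_image_rectpath_cbox_minus_box[of a1 a3] T0 by (auto simp: adefs)
      then have "winding_number (rectpath a1 a3) i = 0"
        using T0 by (intro winding_number_rectpath_outside) (auto simp: adefs)
      then show "winding_number (rectpath a1 a3) i * residue \<Phi> i = 0" by simp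
    qed
    fix i assume "i \<in> {z \<in> box a1 a3. zeta z = 0}"
    then show "winding_number (rectpath a1 a3) i * residue \<Phi> i = residue \<Phi> i"
      using winding_number_rectpath[of i a1 a3] by simp
  qed
  also have "{z \<in> box a1 a3. zeta z = 0} = (\<lambda>g. Complex (1/2) g) ` (ordinates \<inter> {t\<^sub>0<..<T})"
    unfolding adefs by (rule zeros_in_box) (use t0 in simp)
  also have "(\<Sum>p\<in>(\<lambda>g. Complex (1/2) g) ` (ordinates \<inter> {t\<^sub>0<..<T}). residue \<Phi> p)
      = (\<Sum>g\<in>ordinates \<inter> {t\<^sub>0<..<T}. residue \<Phi> (Complex (1/2) g))"
    by (subst sum.reindex) (auto simp: inj_on_def)
  finally have res: "contour_integral (rectpath a1 a3) \<Phi> = 2 * pi * \<i> * (\<Sum>g\<in>ordinates \<inter> {t\<^sub>0<..<T}. residue \<Phi> (Complex (1/2) g))" .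
  have "norm (\<Sum>g\<in>ordinates \<inter> {t\<^sub>0<..<T}. residue \<Phi> (Complex (1/2) g))
      \<le> (\<Sum>g\<in>ordinates \<inter> {t\<^sub>0<..<T}. exp (- \<epsilon> * g) / norm (deriv zeta (Complex (1/2) g)))"
  proof (rule sum_norm_le)
    fix g assume g: "g \<in> ordinates \<inter> {t\<^sub>0<..<T}"
    \<comment> \<open>On the critical line the linear factor is real, between 0 and 1 for the
      ordinates inside the contour, so it only shrinks the residues.\<close>
    have "1 + \<i> * (Complex (1/2) g - 1/2) / of_real T = of_real (1 - g / T)"
      by (simp add: complex_eq_iff)
    moreover have "\<bar>1 - g / T\<bar> \<le> 1" using g T0 t0 by (auto simp: field_simps abs_if)
    ultimately have q: "norm (1 + \<i> * (Complex (1/2) g - 1/2) / of_real T) \<le> 1" by (simp only: norm_of_real)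
    have "norm (residue \<Phi> (Complex (1/2) g)) = exp (- \<epsilon> * g) * norm (1 + \<i> * (Complex (1/2) g - 1/2) / of_real T) / norm (deriv zeta (Complex (1/2) g))"
      unfolding \<Phi>_def using g T0 by (simp add: contour_fun_residue norm_mult norm_divide)
    also have "\<dots> \<le> exp (- \<epsilon> * g) * 1 / norm (deriv zeta (Complex (1/2) g))"
      by (intro divide_right_mono mult_left_mono q) auto
    finally show "norm (residue \<Phi> (Complex (1/2) g)) \<le> exp (- \<epsilon> * g) / norm (deriv zeta (Complex (1/2) g))" by simp
  qed
  then have up: "norm (contour_integral (rectpath a1 a3) \<Phi>) \<le> 2 * pi * (\<Sum>g\<in>ordinates \<inter> {t\<^sub>0<..<T}. exp (- \<epsilon> * g) / norm (deriv zeta (Complex (1/2) g)))"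
    unfolding res norm_mult by simp
  have contR: "continuous_on (path_image (rectpath a1 a3)) \<Phi>"
    using holomorphic_on_imp_continuous_on[OF hol] imgS continuous_on_subset by blast
  have pimg: "path_image (rectpath a1 a3) = closed_segment a1 a2 \<union> closed_segment a2 a3 \<union> closed_segment a3 a4 \<union> closed_segment a4 a1"
    by (simp add: rectpath_def Let_def path_image_join adefs Un_assoc)
  have cont: "continuous_on (closed_segment a1 a2) \<Phi>" "continuous_on (closed_segment a2 a3) \<Phi>"
      "continuous_on (closed_segment a3 a4) \<Phi>" "continuous_on (closed_segment a4 a1) \<Phi>"
    by (rule continuous_on_subset[OF contR], unfold pimg, blast)+
  note cint = cont[THEN contour_integrable_continuous_linepath]
  have split: "contour_integral (rectpath a1 a3) \<Phi> = contour_integral (linepath a1 a2) \<Phi> + (contour_integral (linepath a2 a3) \<Phi>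
      + (contour_integral (linepath a3 a4) \<Phi> + contour_integral (linepath a4 a1) \<Phi>))"
    using cint unfolding rectpath_def Let_def by (simp add: adefs)
  have bottom: "norm (contour_integral (linepath a1 a2) \<Phi>) \<le> 9 * C\<^sub>b"
  proof -
    have "norm (contour_integral (linepath a1 a2) \<Phi>) \<le> 2 * C\<^sub>b * norm (a2 - a1)"
    proof (rule contour_integral_bound_linepath[OF cint(1)])
      fix z assume "z \<in> closed_segment a1 a2"
      then have z: "-1/2 \<le> Re z" "Re z \<le> 4" "Im z = t\<^sub>0"
        unfolding adefs by (auto simp: closed_segment_same_Im closed_segment_eq_real_ivl)
      have zc: "z = Complex (Re z) t\<^sub>0" using z by (simp add: complex_eq_iff)
      have "norm (1 + \<i> * (z - 1/2) / of_real T) \<le> 1 + norm (z - 1/2) / T"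
        using norm_triangle_ineq[of 1 "\<i> * (z - 1/2) / of_real T"] T0 by (simp add: norm_mult norm_divide)
      also have "norm (z - 1/2) \<le> T"
        using cmod_le[of "z - 1/2"] z T t0 by auto
      finally have q: "norm (1 + \<i> * (z - 1/2) / of_real T) \<le> 2" using T0 by (simp add: divide_right_mono)
      have "norm (\<Phi> z) \<le> 1 * 2 * C\<^sub>b"
        unfolding \<Phi>_def norm_contour_fun using q b2[of "Re z"] z zc \<epsilon> t0
        by (intro mult_mono) (auto simp: mult_nonneg_nonneg)
      then show "norm (\<Phi> z) \<le> 2 * C\<^sub>b" by simp
    qed (use t0 in simp)
    also have "norm (a2 - a1) = 9/2"
    proof -
      have "a2 - a1 = of_real (9/2)" by (simp add: adefs complex_eq_iff)
      then show ?thesis by (simp only: norm_of_real)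
    qed
    finally show ?thesis by simp
  qed
  have top: "norm (contour_integral (linepath a3 a4) \<Phi>) \<le> 9/2 * (K * T * exp (- \<epsilon> * T))"
  proof -
    have "norm (contour_integral (linepath a3 a4) \<Phi>) \<le> (K * T * exp (- \<epsilon> * T)) * norm (a4 - a3)"
    proof (rule contour_integral_bound_linepath[OF cint(3)])
      fix z assume "z \<in> closed_segment a3 a4"
      then have z: "-1/2 \<le> Re z" "Re z \<le> 4" "Im z = T"
        unfolding adefs by (auto simp: closed_segment_same_Im closed_segment_eq_real_ivl)
      have zc: "z = Complex (Re z) T" using z by (simp add: complex_eq_iff)
      have "1 + \<i> * (z - 1/2) / of_real T = \<i> * of_real ((Re z - 1/2) / T)"
        by (subst zc, use T0 in \<open>simp add: complex_eq_iff\<close>)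
      then have q: "norm (1 + \<i> * (z - 1/2) / of_real T) = \<bar>Re z - 1/2\<bar> / T"
        using T0 by (simp only: norm_mult norm_of_real abs_divide) simp
      show "norm (\<Phi> z) \<le> K * T * exp (- \<epsilon> * T)"
      proof (cases "Re z = 1/2")
        case True
        have z0: "\<bar>Re z - 1/2\<bar> / T = 0" unfolding True by simp
        show ?thesis unfolding \<Phi>_def norm_contour_fun q z0 using K T0 by simp
      next
        case False
        have "\<bar>Re z - 1/2\<bar> / T * norm (1 / zeta z) \<le> \<bar>Re z - 1/2\<bar> / T * (K * T\<^sup>2 / \<bar>Re z - 1/2\<bar>)"
          using K(2)[of "Re z" T] z zc False T0 by (intro mult_left_mono) auto
        also have "\<dots> = K * T" using False T0 by (simp add: power2_eq_square)
        finally have "exp (- \<epsilon> * T) * (\<bar>Re z - 1/2\<bar> / T * norm (1 / zeta z)) \<le> exp (- \<epsilon> * T) * (K * T)"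
          by (intro mult_left_mono) auto
        then show ?thesis unfolding \<Phi>_def norm_contour_fun q using z by (simp add: mult_ac)
      qed
    qed (use K T0 in simp)
    also have "norm (a4 - a3) = 9/2"
    proof -
      have "a4 - a3 = of_real (-9/2)" by (simp add: adefs complex_eq_iff)
      then show ?thesis by (simp only: norm_of_real)
    qed
    finally show ?thesis by simp
  qed
  have ci: "(\<lambda>t. \<Phi> (Complex c t)) integrable_on {t\<^sub>0..T}" if "c = 4 \<or> c = -1/2" for c
  proof (rule integrable_continuous_real)
    have "continuous_on {t\<^sub>0..T} (\<lambda>t. Complex c t)" unfolding Complex_eq by (intro continuous_intros)
    moreover have "(\<lambda>t. Complex c t) ` {t\<^sub>0..T} \<subseteq> path_image (rectpath a1 a3)"
    proof -
      have "path_image (rectpath a1 a3) = {z. Re z \<in> {Re a1, Re a3} \<and> Im z \<in> {Im a1..Im a3}} \<union>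
          {z. Im z \<in> {Im a1, Im a3} \<and> Re z \<in> {Re a1..Re a3}}"
        by (rule path_image_rectpath) (use T0 in \<open>auto simp: adefs\<close>)
      moreover have "Re (Complex c t) \<in> {Re a1, Re a3} \<and> Im (Complex c t) \<in> {Im a1..Im a3}" if "t \<in> {t\<^sub>0..T}" for t
        using \<open>c = 4 \<or> c = -1/2\<close> that by (auto simp: adefs)
      ultimately show ?thesis by blast
    qed
    ultimately show "continuous_on {t\<^sub>0..T} (\<lambda>t. \<Phi> (Complex c t))"
      using continuous_on_compose2[OF contR] by blast
  qed
  have left: "norm (contour_integral (linepath a4 a1) \<Phi>) \<le> (1 + 1/T) / (4 * \<epsilon>)"
  proof -
    have "closed_segment a1 a4 = closed_segment a4 a1" by (rule closed_segment_commute)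
    then have "contour_integral (linepath a4 a1) \<Phi> = - contour_integral (linepath a1 a4) \<Phi>"
      using cont(4) contour_integral_reverse_linepath by blast
    also have "contour_integral (linepath a1 a4) \<Phi> = \<i> * integral {t\<^sub>0..T} (\<lambda>t. \<Phi> (Complex (-1/2) t))"
      by (rule contour_integral_linepath_same_Re) (use T0 in \<open>auto simp: adefs\<close>)
    finally have e: "norm (contour_integral (linepath a4 a1) \<Phi>) = norm (integral {t\<^sub>0..T} (\<lambda>t. \<Phi> (Complex (-1/2) t)))"
      by (simp add: norm_mult)
    have hi: "((\<lambda>t. exp (- \<epsilon> * t) * ((1 + 1/T) / 4 - 0 * t)) has_integral
       (exp (- \<epsilon> * t\<^sub>0) * (((1 + 1/T) / 4 - 0 * t\<^sub>0) / \<epsilon> - 0 / \<epsilon>\<^sup>2) - exp (- \<epsilon> * T) * (((1 + 1/T) / 4 - 0 * T) / \<epsilon> - 0 / \<epsilon>\<^sup>2))) {t\<^sub>0..T}"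
      by (rule integral_exp_linear) (use \<epsilon> T0 in auto)
    have "norm (integral {t\<^sub>0..T} (\<lambda>t. \<Phi> (Complex (-1/2) t))) \<le> integral {t\<^sub>0..T} (\<lambda>t. exp (- \<epsilon> * t) * ((1 + 1/T) / 4 - 0 * t))"
    proof (rule integral_norm_bound_integral)
      show "(\<lambda>t. exp (- \<epsilon> * t) * ((1 + 1/T) / 4 - 0 * t)) integrable_on {t\<^sub>0..T}" using hi by blast
      fix t assume t: "t \<in> {t\<^sub>0..T}"
      have q1: "1 + \<i> * (Complex (-1/2) t - 1/2) / of_real T = Complex (1 - t / T) (- (1 / T))"
        by (simp add: complex_eq_iff)
      have "norm (Complex (1 - t / T) (- (1 / T))) \<le> \<bar>1 - t / T\<bar> + \<bar>- (1 / T)\<bar>"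
        using cmod_le[of "Complex (1 - t / T) (- (1 / T))"] by simp
      moreover have "\<bar>1 - t / T\<bar> \<le> 1" "\<bar>- (1 / T)\<bar> = 1 / T" using t T0 t0 by (auto simp: field_simps abs_if)
      ultimately have q: "norm (1 + \<i> * (Complex (-1/2) t - 1/2) / of_real T) \<le> 1 + 1 / T"
        unfolding q1 by linarith
      have "norm (\<Phi> (Complex (-1/2) t)) \<le> exp (- \<epsilon> * t) * (1 + 1/T) * (1/4)"
        unfolding \<Phi>_def norm_contour_fun using q b3[of t] t T0
        by (intro mult_mono) auto
      then show "norm (\<Phi> (Complex (-1/2) t)) \<le> exp (- \<epsilon> * t) * ((1 + 1/T) / 4 - 0 * t)" by simp
    qed (rule ci, simp)
    also have "\<dots> = (1 + 1/T) / (4 * \<epsilon>) * (exp (- \<epsilon> * t\<^sub>0) - exp (- \<epsilon> * T))"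
      unfolding integral_unique[OF hi] using \<epsilon> by (simp add: field_simps)
    also have "\<dots> \<le> (1 + 1/T) / (4 * \<epsilon>) * 1"
    proof (rule mult_left_mono)
      have "exp (- \<epsilon> * t\<^sub>0) \<le> 1" using \<epsilon> t0 by simp
      then show "exp (- \<epsilon> * t\<^sub>0) - exp (- \<epsilon> * T) \<le> 1" using exp_ge_zero[of "- \<epsilon> * T"] by linarith
    qed (use \<epsilon> T0 in auto)
    finally show ?thesis unfolding e by simp
  qed
  have right: "norm (contour_integral (linepath a2 a3) \<Phi>) \<ge> exp (- \<epsilon> * t\<^sub>0) * ((3/4 - 1/T - 3/(4*T) * t\<^sub>0) / \<epsilon> - 3/(4*T) / \<epsilon>\<^sup>2)"
  proof -
    define I where "I = integral {t\<^sub>0..T} (\<lambda>t. \<Phi> (Complex 4 t))"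
    have "contour_integral (linepath a2 a3) \<Phi> = \<i> * I"
      unfolding I_def by (rule contour_integral_linepath_same_Re) (use T0 in \<open>auto simp: adefs\<close>)
    then have e: "norm (contour_integral (linepath a2 a3) \<Phi>) = norm I" by (simp add: norm_mult)
    \<comment> \<open>The oscillating factor on Re s = 4 is the constant phase exp (4 \<i>
      \<epsilon>). Once it is removed, the real part of the integrand can be bounded below
      pointwise.\<close>
    define c where "c = cis (- 4 * \<epsilon>)"
    have "((\<lambda>t. \<Phi> (Complex 4 t)) has_integral I) {t\<^sub>0..T}" unfolding I_def by (rule integrable_integral[OF ci]) simp
    then have "((\<lambda>t. c * \<Phi> (Complex 4 t)) has_integral c * I) {t\<^sub>0..T}" by (rule has_integral_mult_right)
    from has_integral_linear[OF this bounded_linear_Re]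
    have hR: "((\<lambda>t. Re (c * \<Phi> (Complex 4 t))) has_integral Re (c * I)) {t\<^sub>0..T}" by (simp only: o_def)
    let ?\<alpha> = "3/4 - 1/T" and ?\<beta> = "3/(4*T)"
    have hG: "((\<lambda>t. exp (- \<epsilon> * t) * (?\<alpha> - ?\<beta> * t)) has_integral
       (exp (- \<epsilon> * t\<^sub>0) * ((?\<alpha> - ?\<beta> * t\<^sub>0) / \<epsilon> - ?\<beta> / \<epsilon>\<^sup>2) - exp (- \<epsilon> * T) * ((?\<alpha> - ?\<beta> * T) / \<epsilon> - ?\<beta> / \<epsilon>\<^sup>2))) {t\<^sub>0..T}"
      by (rule integral_exp_linear) (use \<epsilon> T0 in auto)
    have "exp (- \<epsilon> * t\<^sub>0) * ((?\<alpha> - ?\<beta> * t\<^sub>0) / \<epsilon> - ?\<beta> / \<epsilon>\<^sup>2) - exp (- \<epsilon> * T) * ((?\<alpha> - ?\<beta> * T) / \<epsilon> - ?\<beta> / \<epsilon>\<^sup>2) \<le> Re (c * I)"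
    proof (rule has_integral_le[OF hG hR])
      fix t assume t: "t \<in> {t\<^sub>0..T}"
      let ?s = "Complex 4 t"
      define q where "q = 1 + \<i> * (?s - 1/2) / of_real T"
      define \<eta> where "\<eta> = 1 / zeta ?s - 1"
      have eta: "norm \<eta> \<le> 1/4" unfolding \<eta>_def by (rule zeta_Re_4) simp
      have qc: "q = Complex (1 - t / T) (7 / (2 * T))" by (simp add: q_def complex_eq_iff)
      have tT: "0 \<le> 1 - t / T" using t T0 by (simp add: field_simps)
      have nq: "norm q \<le> (1 - t / T) + 7 / (2 * T)"
        unfolding qc using cmod_le[of "Complex (1 - t / T) (7 / (2 * T))"] tT T0 by simp
      have "norm (q * \<eta>) \<le> ((1 - t / T) + 7 / (2 * T)) * (1/4)"
        unfolding norm_mult using nq eta tT T0 by (intro mult_mono) auto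
      then have "Re (q * \<eta>) \<ge> - (((1 - t / T) + 7 / (2 * T)) * (1/4))"
        using abs_Re_le_cmod[of "q * \<eta>"] by linarith
      then have "Re (q + q * \<eta>) \<ge> (1 - t / T) - ((1 - t / T) + 7 / (2 * T)) * (1/4)"
        by (simp add: qc)
      \<comment> \<open>Uses 7/8 \<le> 1: the imaginary part 7 / (2T) of q, times 1/4, costs at most
        1/T.\<close>
      also have "(1 - t / T) - ((1 - t / T) + 7 / (2 * T)) * (1/4) \<ge> ?\<alpha> - ?\<beta> * t"
        using T0 by (simp add: field_simps)
      finally have Rq: "Re (q + q * \<eta>) \<ge> ?\<alpha> - ?\<beta> * t" .
      have ex: "c * exp (\<i> * of_real \<epsilon> * ?s) = of_real (exp (- \<epsilon> * t))"
      proof -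
        have "\<i> * of_real (- 4 * \<epsilon>) + \<i> * of_real \<epsilon> * ?s = of_real (- \<epsilon> * t)"
          by (simp add: complex_eq_iff)
        then show ?thesis unfolding c_def cis_conv_exp by (simp only: exp_add[symmetric] exp_of_real)
      qed
      have "c * \<Phi> ?s = c * exp (\<i> * of_real \<epsilon> * ?s) * (q + q * \<eta>)"
      proof -
        have 1: "\<Phi> ?s = exp (\<i> * of_real \<epsilon> * ?s) * q / zeta ?s" unfolding \<Phi>_def contour_fun_def q_def ..
        have 2: "q + q * \<eta> = q / zeta ?s" unfolding \<eta>_def by (simp add: right_diff_distrib)
        show ?thesis unfolding 1 2 by simp
      qed
      then have "Re (c * \<Phi> ?s) = exp (- \<epsilon> * t) * Re (q + q * \<eta>)" unfolding ex by simp
      then show "exp (- \<epsilon> * t) * (?\<alpha> - ?\<beta> * t) \<le> Re (c * \<Phi> ?s)"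
        using Rq by (simp only: mult_left_mono exp_ge_zero)
    qed
    moreover have "exp (- \<epsilon> * T) * ((?\<alpha> - ?\<beta> * T) / \<epsilon> - ?\<beta> / \<epsilon>\<^sup>2) \<le> 0"
    proof (rule mult_nonneg_nonpos)
      have eq: "?\<alpha> - ?\<beta> * T = - (1/T)" using T0 by simp
      have "- (1/T) / \<epsilon> \<le> 0" "0 \<le> ?\<beta> / \<epsilon>\<^sup>2" using T0 \<epsilon> by auto
      then show "(?\<alpha> - ?\<beta> * T) / \<epsilon> - ?\<beta> / \<epsilon>\<^sup>2 \<le> 0" unfolding eq by linarith
    qed simp
    moreover have "Re (c * I) \<le> norm I"
      using complex_Re_le_cmod[of "c * I"] by (simp add: norm_mult c_def)
    ultimately show ?thesis unfolding e by linarith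
  qed
  have "norm (contour_integral (linepath a2 a3) \<Phi>) \<le> norm (contour_integral (rectpath a1 a3) \<Phi>)
      + norm (contour_integral (linepath a1 a2) \<Phi>) + norm (contour_integral (linepath a3 a4) \<Phi>) + norm (contour_integral (linepath a4 a1) \<Phi>)"
  proof -
    have eq: "contour_integral (linepath a2 a3) \<Phi> = contour_integral (rectpath a1 a3) \<Phi> - contour_integral (linepath a1 a2) \<Phi>
        - contour_integral (linepath a3 a4) \<Phi> - contour_integral (linepath a4 a1) \<Phi>" unfolding split by simp
    show ?thesis unfolding eq
      using norm_triangle_ineq4[of "contour_integral (rectpath a1 a3) \<Phi>" "contour_integral (linepath a1 a2) \<Phi>"]
        norm_triangle_ineq4[of "contour_integral (rectpath a1 a3) \<Phi> - contour_integral (linepath a1 a2) \<Phi>" "contour_integral (linepath a3 a4) \<Phi>"]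
        norm_triangle_ineq4[of "contour_integral (rectpath a1 a3) \<Phi> - contour_integral (linepath a1 a2) \<Phi> - contour_integral (linepath a3 a4) \<Phi>" "contour_integral (linepath a4 a1) \<Phi>"]
      by linarith
  qed
  then show ?thesis using up bottom top left right by linarith
qed

end


section \<open>Summation over the zeros\<close>

text \<open>The sum telescopes because \<open>exp (- x) * x * (1 + x) \<le> 8 * (exp (- x / 2) - exp (- x))\<close>,
  where \<open>x / 2\<close> is the next dyadic point.\<close>

lemma dyadic_weight_sum_le:
  fixes x \<delta> :: real
  assumes "x > 0" "0 < \<delta>" "\<delta> \<le> 1"
  shows "(\<Sum>j\<le>J. (x / 2 ^ j) powr (1 + \<delta>) * exp (- (x / 2 ^ j))) \<le> 8"
proof -
  have key: "z powr (1 + \<delta>) * exp (- z) \<le> 8 * (exp (- (z / 2)) - exp (- z))" if z: "z > 0" for z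
  proof -
    have "z powr (1 + \<delta>) \<le> z + z\<^sup>2"
    proof (cases "z \<le> 1")
      case True
      have "z powr (1 + \<delta>) \<le> z powr 1" using True z assms by (intro powr_mono') auto
      then show ?thesis using z by (simp add: add_increasing2)
    next
      case False
      have "z powr (1 + \<delta>) \<le> z powr 2" using False assms by (intro powr_mono) auto
      then show ?thesis using z by (simp add: powr_numeral)
    qed
    also have "z + z\<^sup>2 \<le> 8 * (exp (z / 2) - 1)"
    proof -
      have "1 + z / 2 + (z / 2)\<^sup>2 / 2 \<le> exp (z / 2)" using z by (intro exp_lower_Taylor_quadratic) simp
      then show ?thesis using z by (simp add: power_divide)
    qed
    finally have "z powr (1 + \<delta>) * exp (- z) \<le> 8 * (exp (z / 2) - 1) * exp (- z)"
      by (intro mult_right_mono) auto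
    also have "\<dots> = 8 * (exp (- (z / 2)) - exp (- z))"
      by (simp add: algebra_simps flip: exp_add)
    finally show ?thesis .
  qed
  have "(\<Sum>j\<le>J. (x / 2 ^ j) powr (1 + \<delta>) * exp (- (x / 2 ^ j)))
      \<le> (\<Sum>j\<le>J. 8 * (exp (- (x / 2 ^ Suc j)) - exp (- (x / 2 ^ j))))"
  proof (rule sum_mono)
    fix j
    have "x / 2 ^ j / 2 = x / 2 ^ Suc j" by simp
    then show "(x / 2 ^ j) powr (1 + \<delta>) * exp (- (x / 2 ^ j)) \<le> 8 * (exp (- (x / 2 ^ Suc j)) - exp (- (x / 2 ^ j)))"
      using key[of "x / 2 ^ j"] assms by (simp add: mult.commute)
  qed
  also have "\<dots> = 8 * (exp (- (x / 2 ^ Suc J)) - exp (- (x / 2 ^ 0)))"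
    unfolding sum_distrib_left[symmetric] lessThan_Suc_atMost[symmetric]
    by (subst sum_lessThan_telescope) simp
  also have "\<dots> \<le> 8 * (1 - 0)" using assms by (intro mult_left_mono diff_mono) auto
  finally show ?thesis by simp
qed

definition residue_weight :: "real \<Rightarrow> real" where
  "residue_weight g = 1 / norm (deriv zeta (Complex (1/2) g))"

lemma residue_weight_nonneg: "residue_weight g \<ge> 0"
  by (simp add: residue_weight_def)

context one_sided_bound
begin

text \<open>As T tends to infinity the K term vanishes. The conditions on \<epsilon> make the
  exponential at least 7/8 and the bottom edge at most 1 / (8\<epsilon>), so at least (21/32 - 1/4 -
  1/8) / \<epsilon> = 9 / (32\<epsilon>) remains.\<close>

lemma eventually_exp_weight_sum_ge:
  assumes t0: "t\<^sub>0 \<ge> 2" "C\<^sub>b > 0"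
    and b1: "\<And>x. -1/2 \<le> x \<Longrightarrow> x \<le> 4 \<Longrightarrow> zeta (Complex x t\<^sub>0) \<noteq> 0"
    and b2: "\<And>x. -1/2 \<le> x \<Longrightarrow> x \<le> 4 \<Longrightarrow> norm (1 / zeta (Complex x t\<^sub>0)) \<le> C\<^sub>b"
    and b3: "\<And>t. t \<ge> t\<^sub>0 \<Longrightarrow> norm (1 / zeta (Complex (-1/2) t)) \<le> 1/4"
    and \<epsilon>: "\<epsilon> > 0" "\<epsilon> * t\<^sub>0 \<le> 1/8" "\<epsilon> * C\<^sub>b \<le> 1/72"
  shows "\<forall>\<^sub>F T in at_top. T \<notin> ordinates \<longrightarrow>
    1 / (8 * \<epsilon>) \<le> 2 * pi * (\<Sum>g\<in>ordinates \<inter> {t\<^sub>0<..<T}. residue_weight g * exp (- \<epsilon> * g))"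
proof -
  obtain K where K: "K > 0" "\<And>x t. -1/2 \<le> x \<Longrightarrow> x \<le> 4 \<Longrightarrow> x \<noteq> 1/2 \<Longrightarrow> t \<ge> 1 \<Longrightarrow> norm (1 / zeta (Complex x t)) \<le> K * t\<^sup>2 / \<bar>x - 1/2\<bar>"
    using top_edge_bound by blast
  define LB where "LB = (\<lambda>T. exp (- \<epsilon> * t\<^sub>0) * ((3/4 - 1/T - 3/(4*T) * t\<^sub>0) / \<epsilon> - 3/(4*T) / \<epsilon>\<^sup>2)
      - (1 + 1/T) / (4 * \<epsilon>) - 9 * C\<^sub>b - 9/2 * (K * T * exp (- \<epsilon> * T)))"
  have 1: "(LB \<longlongrightarrow> exp (- \<epsilon> * t\<^sub>0) * ((3/4 - 0 - 0 * t\<^sub>0) / \<epsilon> - 0 / \<epsilon>\<^sup>2) - (1 + 0) / (4 * \<epsilon>) - 9 * C\<^sub>b - 9/2 * 0) at_top"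
    unfolding LB_def
  proof (intro tendsto_intros)
    show "((\<lambda>T::real. 1 / T) \<longlongrightarrow> 0) at_top" "((\<lambda>T::real. 1 / T) \<longlongrightarrow> 0) at_top" by real_asymp+
    show "((\<lambda>T::real. 3 / (4 * T)) \<longlongrightarrow> 0) at_top" "((\<lambda>T::real. 3 / (4 * T)) \<longlongrightarrow> 0) at_top" by real_asymp+
    show "((\<lambda>T. K * T * exp (- \<epsilon> * T)) \<longlongrightarrow> 0) at_top" using \<epsilon>(1) K(1) by real_asymp
  qed (use \<epsilon> in auto)
  have "1 / (8 * \<epsilon>) < exp (- \<epsilon> * t\<^sub>0) * ((3/4 - 0 - 0 * t\<^sub>0) / \<epsilon> - 0 / \<epsilon>\<^sup>2) - (1 + 0) / (4 * \<epsilon>) - 9 * C\<^sub>b - 9/2 * 0"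
  proof -
    have "7/8 \<le> exp (- \<epsilon> * t\<^sub>0)" using exp_ge_add_one_self[of "- \<epsilon> * t\<^sub>0"] \<epsilon>(2) by simp
    then have "7/8 * (3/4 / \<epsilon>) \<le> exp (- \<epsilon> * t\<^sub>0) * (3/4 / \<epsilon>)" using \<epsilon>(1) by (intro mult_right_mono) auto
    moreover have "9 * C\<^sub>b \<le> 1 / (8 * \<epsilon>)" using \<epsilon> by (simp add: field_simps)
    moreover have "1 / (8 * \<epsilon>) < 7/8 * (3/4 / \<epsilon>) - 1 / (4 * \<epsilon>) - 1 / (8 * \<epsilon>)" using \<epsilon>(1) by (simp add: field_simps)
    ultimately show ?thesis by simp
  qed
  from order_tendstoD(1)[OF 1 this] have "\<forall>\<^sub>F T in at_top. 1 / (8 * \<epsilon>) < LB T" .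
  then show ?thesis using eventually_ge_at_top[of "t\<^sub>0 + 4"]
  proof eventually_elim
    case (elim T)
    show ?case
    proof
      assume "T \<notin> ordinates"
      have "LB T \<le> 2 * pi * (\<Sum>g\<in>ordinates \<inter> {t\<^sub>0<..<T}. exp (- \<epsilon> * g) / norm (deriv zeta (Complex (1/2) g)))"
        unfolding LB_def by (rule contour_lower_bound) (use t0 b1 b2 b3 K \<epsilon>(1) elim(2) \<open>T \<notin> ordinates\<close> in auto)
      then show "1 / (8 * \<epsilon>) \<le> 2 * pi * (\<Sum>g\<in>ordinates \<inter> {t\<^sub>0<..<T}. residue_weight g * exp (- \<epsilon> * g))"
        using elim(1) by (simp add: residue_weight_def)
    qed
  qed
qed

text \<open>The bounds at the scales \<open>e j\<close> are added with weights
  \<open>e j powr (1 + \<delta>)\<close>. Each contributes at least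
  \<open>\<epsilon>\<^sub>0 / 16\<close>, and after exchanging the sums
  \<open>dyadic_weight_sum_le\<close> leaves 8 g^(- 1 - \<delta>) for every ordinate. The constant
  is 1024 = 16 * 64, where 64 bounds 16 pi.\<close>

theorem sum_residue_weight_ge:
  assumes t0: "t\<^sub>0 \<ge> 2" "C\<^sub>b > 0"
    and b1: "\<And>x. -1/2 \<le> x \<Longrightarrow> x \<le> 4 \<Longrightarrow> zeta (Complex x t\<^sub>0) \<noteq> 0"
    and b2: "\<And>x. -1/2 \<le> x \<Longrightarrow> x \<le> 4 \<Longrightarrow> norm (1 / zeta (Complex x t\<^sub>0)) \<le> C\<^sub>b"
    and b3: "\<And>t. t \<ge> t\<^sub>0 \<Longrightarrow> norm (1 / zeta (Complex (-1/2) t)) \<le> 1/4"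
    and \<epsilon>0: "\<epsilon>\<^sub>0 > 0" "\<epsilon>\<^sub>0 \<le> 1" "\<epsilon>\<^sub>0 * t\<^sub>0 \<le> 1/8" "\<epsilon>\<^sub>0 * C\<^sub>b \<le> 1/72"
  obtains T where "\<epsilon>\<^sub>0 / (1024 * \<delta>) \<le> (\<Sum>g\<in>ordinates \<inter> {t\<^sub>0<..<T}. residue_weight g * g powr (- 1 - \<delta>))"
proof -
  \<comment> \<open>For j \<le> 1/\<delta> the factor 2^(- j \<delta>) is at least 1/2, and there
    are at least 1/\<delta> such j, counting j = 0.\<close>
  define J where "J = nat \<lfloor>1 / \<delta>\<rfloor>"
  define e where "e = (\<lambda>j::nat. \<epsilon>\<^sub>0 / 2 ^ j)"
  have e: "e j > 0" "e j \<le> \<epsilon>\<^sub>0" for j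
  proof -
    show "e j > 0" using \<epsilon>0 by (simp add: e_def)
    have "\<epsilon>\<^sub>0 / 2 ^ j \<le> \<epsilon>\<^sub>0 / 1" using \<epsilon>0 by (intro divide_left_mono) auto
    then show "e j \<le> \<epsilon>\<^sub>0" by (simp add: e_def)
  qed
  have "\<forall>\<^sub>F T in at_top. \<forall>j\<in>{..J}. T \<notin> ordinates \<longrightarrow>
    1 / (8 * e j) \<le> 2 * pi * (\<Sum>g\<in>ordinates \<inter> {t\<^sub>0<..<T}. residue_weight g * exp (- e j * g))"
  proof (rule eventually_ball_finite, simp, intro ballI)
    fix j
    have "e j * t\<^sub>0 \<le> \<epsilon>\<^sub>0 * t\<^sub>0" "e j * C\<^sub>b \<le> \<epsilon>\<^sub>0 * C\<^sub>b" using e[of j] t0 by (auto intro!: mult_right_mono)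
    then show "\<forall>\<^sub>F T in at_top. T \<notin> ordinates \<longrightarrow>
      1 / (8 * e j) \<le> 2 * pi * (\<Sum>g\<in>ordinates \<inter> {t\<^sub>0<..<T}. residue_weight g * exp (- e j * g))"
      using \<epsilon>0 by (intro eventually_exp_weight_sum_ge[OF t0 b1 b2 b3 e(1)]) auto
  qed
  then obtain T1 where T1: "\<And>T j. T \<ge> T1 \<Longrightarrow> j \<le> J \<Longrightarrow> T \<notin> ordinates \<Longrightarrow>
    1 / (8 * e j) \<le> 2 * pi * (\<Sum>g\<in>ordinates \<inter> {t\<^sub>0<..<T}. residue_weight g * exp (- e j * g))"
    unfolding eventually_at_top_linorder by auto
  \<comment> \<open>One T serves all scales j \<le> J at once; it is taken off the locally finite
    set of ordinates, so that the top edge misses the zeros.\<close>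
  have "infinite {T1..T1 + 1}" by simp
  then have "\<not> {T1..T1 + 1} \<subseteq> ordinates \<inter> {T1..T1 + 1}" using finite_ordinates finite_subset by blast
  then obtain T where "T \<in> {T1..T1 + 1}" "T \<notin> ordinates" by blast
  then have T: "T \<ge> T1" "T \<notin> ordinates" by simp_all
  define S where "S = ordinates \<inter> {t\<^sub>0<..<T}"
  have Spos: "g > 0" if "g \<in> S" for g using that by (auto simp: S_def ordinates_def)
  have "\<epsilon>\<^sub>0 / (16 * \<delta>) \<le> (\<Sum>j\<le>J. e j powr (1 + \<delta>) * (1 / (8 * e j)))"
  proof -
    have "\<epsilon>\<^sub>0 / 16 \<le> e j powr (1 + \<delta>) * (1 / (8 * e j))" if j: "j \<le> J" for j
    proof -
      have "real j \<le> 1 / \<delta>" using j \<delta> unfolding J_def by (simp add: le_nat_floor le_nat_iff le_floor_iff)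
      then have jd: "real j * \<delta> \<le> 1" using \<delta> by (simp add: field_simps)
      have "e j powr (1 + \<delta>) * (1 / (8 * e j)) = e j powr \<delta> / 8"
        using e(1)[of j] by (simp add: powr_add)
      also have "e j powr \<delta> = \<epsilon>\<^sub>0 powr \<delta> / (2 ^ j) powr \<delta>"
        unfolding e_def by (rule powr_divide)
      also have "(2 ^ j) powr \<delta> = (2::real) powr (real j * \<delta>)"
        by (simp add: powr_powr flip: powr_realpow)
      finally have eq: "e j powr (1 + \<delta>) * (1 / (8 * e j)) = \<epsilon>\<^sub>0 powr \<delta> / 2 powr (real j * \<delta>) / 8" .
      have "2 powr (real j * \<delta>) \<le> 2 powr 1" by (intro powr_mono jd) auto
      moreover have "\<epsilon>\<^sub>0 powr 1 \<le> \<epsilon>\<^sub>0 powr \<delta>" using \<epsilon>0 \<delta> by (intro powr_mono') auto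
      ultimately have "\<epsilon>\<^sub>0 / 2 \<le> \<epsilon>\<^sub>0 powr \<delta> / 2 powr (real j * \<delta>)" using \<epsilon>0 by (intro frac_le) auto
      from divide_right_mono[OF this, of 8] have "\<epsilon>\<^sub>0 / 2 / 8 \<le> e j powr (1 + \<delta>) * (1 / (8 * e j))" unfolding eq by simp
      then show ?thesis by simp
    qed
    then have "(\<Sum>j\<le>J. \<epsilon>\<^sub>0 / 16) \<le> (\<Sum>j\<le>J. e j powr (1 + \<delta>) * (1 / (8 * e j)))" by (intro sum_mono) auto
    moreover have "\<epsilon>\<^sub>0 / (16 * \<delta>) \<le> (\<Sum>j\<le>J. \<epsilon>\<^sub>0 / 16)"
    proof -
      have "1 / \<delta> \<le> real (Suc J)" unfolding J_def using \<delta> by linarith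
      then have "1 / \<delta> * (\<epsilon>\<^sub>0 / 16) \<le> real (Suc J) * (\<epsilon>\<^sub>0 / 16)" using \<epsilon>0 by (intro mult_right_mono) auto
      then show ?thesis by (simp add: mult.commute)
    qed
    ultimately show ?thesis by linarith
  qed
  also have "\<dots> \<le> (\<Sum>j\<le>J. e j powr (1 + \<delta>) * (2 * pi * (\<Sum>g\<in>S. residue_weight g * exp (- e j * g))))"
    using T1[OF T(1) _ T(2)] unfolding S_def by (intro sum_mono mult_left_mono) auto
  also have "\<dots> = (\<Sum>g\<in>S. 2 * pi * residue_weight g * (\<Sum>j\<le>J. e j powr (1 + \<delta>) * exp (- e j * g)))"
    unfolding sum_distrib_left by (subst sum.swap) (simp add: mult_ac)
  also have "\<dots> \<le> (\<Sum>g\<in>S. 2 * pi * residue_weight g * (8 * g powr (- 1 - \<delta>)))"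
  proof (intro sum_mono mult_left_mono)
    fix g assume g: "g \<in> S"
    have "(\<Sum>j\<le>J. e j powr (1 + \<delta>) * exp (- e j * g)) * g powr (1 + \<delta>)
        = (\<Sum>j\<le>J. (\<epsilon>\<^sub>0 * g / 2 ^ j) powr (1 + \<delta>) * exp (- (\<epsilon>\<^sub>0 * g / 2 ^ j)))"
      unfolding sum_distrib_right
    proof (intro sum.cong refl)
      fix j
      have "\<epsilon>\<^sub>0 * g / 2 ^ j = e j * g" by (simp add: e_def)
      then show "e j powr (1 + \<delta>) * exp (- e j * g) * g powr (1 + \<delta>) = (\<epsilon>\<^sub>0 * g / 2 ^ j) powr (1 + \<delta>) * exp (- (\<epsilon>\<^sub>0 * g / 2 ^ j))"
        by (simp add: powr_mult)
    qed
    also have "\<dots> \<le> 8" by (rule dyadic_weight_sum_le) (use \<epsilon>0 \<delta> Spos[OF g] in auto)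
    finally have "(\<Sum>j\<le>J. e j powr (1 + \<delta>) * exp (- e j * g)) \<le> 8 / g powr (1 + \<delta>)"
      using Spos[OF g] by (simp add: pos_le_divide_eq)
    also have "8 / g powr (1 + \<delta>) = 8 * g powr (- (1 + \<delta>))" by (simp only: powr_minus divide_inverse)
    finally show "(\<Sum>j\<le>J. e j powr (1 + \<delta>) * exp (- e j * g)) \<le> 8 * g powr (- 1 - \<delta>)" by simp
  qed (simp add: residue_weight_nonneg)
  also have "\<dots> = 16 * pi * (\<Sum>g\<in>S. residue_weight g * g powr (- 1 - \<delta>))"
    unfolding sum_distrib_left by (intro sum.cong refl) simp
  also have "\<dots> \<le> 64 * (\<Sum>g\<in>S. residue_weight g * g powr (- 1 - \<delta>))"
    using pi_less_4 by (intro mult_right_mono sum_nonneg mult_nonneg_nonneg residue_weight_nonneg) auto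
  finally have "\<epsilon>\<^sub>0 / (1024 * \<delta>) \<le> (\<Sum>g\<in>S. residue_weight g * g powr (- 1 - \<delta>))" by simp
  then show ?thesis using that unfolding S_def by blast
qed

text \<open>For g \<ge> 2 both norms in \<open>cmod_Beta_ge\<close> are at most 2 g, and 2^\<delta>
  \<le> 2; with the 2 already present there this makes 8, uniformly in \<delta>.\<close>

lemma norm_a_ge:
  assumes "g \<in> ordinates" "g \<ge> 2"
  shows "Gamma (1 + \<delta>) / 8 * (residue_weight g * g powr (- 1 - \<delta>)) \<le> norm (a g)"
proof -
  let ?\<rho> = "Complex (1/2) g"
  have G: "Gamma (1 + \<delta>) > 0" using \<delta> by (intro Gamma_real_pos) auto
  have r1: "norm ?\<rho> \<le> 2 * g" "norm (?\<rho> + 1) \<le> 2 * g"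
    using cmod_le[of ?\<rho>] cmod_le[of "?\<rho> + 1"] assms by auto
  have r0: "norm ?\<rho> > 0" "norm (?\<rho> + 1) > 0" by (auto simp: complex_eq_iff)
  have "norm (?\<rho> + 1) powr \<delta> \<le> (2 * g) powr \<delta>" using r1 \<delta> by (intro powr_mono2) auto
  also have "\<dots> = 2 powr \<delta> * g powr \<delta>" by (rule powr_mult)
  also have "\<dots> \<le> 2 powr 1 * g powr \<delta>" using \<delta> by (intro mult_right_mono powr_mono) auto
  finally have p: "norm (?\<rho> + 1) powr \<delta> \<le> 2 * g powr \<delta>" by simp
  have "2 * norm ?\<rho> * norm (?\<rho> + 1) powr \<delta> \<le> 2 * (2 * g) * (2 * g powr \<delta>)"
    using r1 assms by (intro mult_mono p) auto
  also have "\<dots> = 8 * g powr (1 + \<delta>)" using assms by (simp add: powr_add)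
  finally have "Gamma (1 + \<delta>) / (8 * g powr (1 + \<delta>)) \<le> Gamma (1 + \<delta>) / (2 * norm ?\<rho> * norm (?\<rho> + 1) powr \<delta>)"
    using G r0 by (intro divide_left_mono mult_pos_pos) (use assms in auto)
  also have "\<dots> \<le> norm (Beta ?\<rho> (of_real (1 + \<delta>)))"
    by (rule cmod_Beta_ge) (use \<delta> in auto)
  finally have b: "Gamma (1 + \<delta>) / (8 * g powr (1 + \<delta>)) \<le> norm (Beta ?\<rho> (of_real (1 + \<delta>)))" .
  have "Gamma (1 + \<delta>) / 8 * (residue_weight g * g powr (- 1 - \<delta>)) = Gamma (1 + \<delta>) / (8 * g powr (1 + \<delta>)) * residue_weight g"
  proof -
    have "g powr (- (1 + \<delta>)) = 1 / g powr (1 + \<delta>)" by (rule powr_minus_divide)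
    then show ?thesis by simp
  qed
  also have "\<dots> \<le> norm (Beta ?\<rho> (of_real (1 + \<delta>))) * residue_weight g"
    by (intro mult_right_mono b residue_weight_nonneg)
  also have "\<dots> = norm (a g)"
    using ordinates_zeta_zero[OF assms(1)] by (simp add: a_def zeta_inv_res_def residue_weight_def norm_mult norm_divide)
  finally show ?thesis .
qed

end

section \<open>From residues to the limsup and liminf\<close>

theorem one_sided_bound_ge:
  assumes "Riemann_Hypothesis" "Simple_Zeros" "Linear_Independence_Conjecture"
  obtains c :: real where "c > 0"
    "\<forall>\<^sub>F \<delta> in at_right 0. \<forall>s C. (s = 1 \<or> s = - 1) \<longrightarrow> (\<forall>\<^sub>F y in at_top. s * Mo \<delta> y \<le> C * sqrt y) \<longrightarrow> c / \<delta> \<le> C"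
proof -
  \<comment> \<open>All data entering c are chosen before \<delta>, s and C, so c is absolute; only
    the admissible range of \<delta> depends on the residue at 1/2.\<close>
  obtain t0 Cb :: real where t0: "t0 \<ge> 2" "Cb > 0"
    "\<And>x. -1/2 \<le> x \<Longrightarrow> x \<le> 4 \<Longrightarrow> zeta (Complex x t0) \<noteq> 0"
    "\<And>x. -1/2 \<le> x \<Longrightarrow> x \<le> 4 \<Longrightarrow> norm (1 / zeta (Complex x t0)) \<le> Cb"
    "\<And>t. t \<ge> t0 \<Longrightarrow> norm (1 / zeta (Complex (-1/2) t)) \<le> 1/4"
    using contour_constants by blast
  define e0 where "e0 = min (1 / (8 * t0)) (min (1 / (72 * Cb)) 1)"
  have e0: "e0 > 0" "e0 \<le> 1" using t0 by (auto simp: e0_def)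
  have e01: "e0 * t0 \<le> 1/8"
  proof -
    have "e0 * t0 \<le> 1 / (8 * t0) * t0" using t0 by (intro mult_right_mono) (auto simp: e0_def)
    then show ?thesis using t0 by simp
  qed
  have e02: "e0 * Cb \<le> 1/72"
  proof -
    have "e0 * Cb \<le> 1 / (72 * Cb) * Cb" using t0 by (intro mult_right_mono) (auto simp: e0_def)
    then show ?thesis using t0 by simp
  qed
  \<comment> \<open>32768 = 2 * 2 * 8 * 1024: a 2 from \<open>Gamma (1 + \<delta>) > 1/2\<close>,
    the 8 of \<open>norm_a_ge\<close>, the 1024 of \<open>sum_residue_weight_ge\<close>, and another
    2 because half of the bound is spent on the residue at 1/2.\<close>
  define c where "c = e0 / 32768"
  \<comment> \<open>A zero at 1/2 itself is not excluded, so the term \<open>a 0\<close> has to be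
    bounded: R is its residue factor, and M bounds its Beta factor for all small \<delta>.\<close>
  define R where "R = norm (zeta_inv_res (Complex (1/2) 0))"
  define M where "M = norm (Beta (Complex (1/2) 0) (complex_of_real 1)) + 1"
  have lim1: "((\<lambda>\<delta>::real. 1 + \<delta>) \<longlongrightarrow> 1 + 0) (at_right 0)" by (intro tendsto_intros)
  have "isCont Gamma (1::real)" by (intro continuous_intros) auto
  from isCont_tendsto_compose[OF this, of "\<lambda>\<delta>. 1 + \<delta>" "at_right 0"] lim1
  have "((\<lambda>\<delta>::real. Gamma (1 + \<delta>)) \<longlongrightarrow> 1) (at_right 0)" by simp
  then have ev1: "\<forall>\<^sub>F \<delta> in at_right (0::real). Gamma (1 + \<delta>) > 1/2" by (rule order_tendstoD) simp
  have ev2: "\<forall>\<^sub>F \<delta> in at_right (0::real). norm (Beta (Complex (1/2) 0) (complex_of_real (1 + \<delta>))) < M"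
  proof -
    have "isCont (\<lambda>z. Beta (Complex (1/2) 0) z) (complex_of_real 1)"
      unfolding Beta_def by (intro continuous_intros) (auto intro!: not_nonpos_Int_Re_pos simp: Gamma_eq_zero_iff)
    moreover have "((\<lambda>\<delta>::real. complex_of_real (1 + \<delta>)) \<longlongrightarrow> complex_of_real 1) (at_right 0)"
      using tendsto_of_real[OF lim1] by simp
    ultimately have "((\<lambda>\<delta>::real. Beta (Complex (1/2) 0) (complex_of_real (1 + \<delta>))) \<longlongrightarrow> Beta (Complex (1/2) 0) (complex_of_real 1)) (at_right 0)"
      by (rule isCont_tendsto_compose)
    from tendsto_norm[OF this] show ?thesis by (rule order_tendstoD) (simp add: M_def)
  qed
  define d0 where "d0 = min 1 (c / (M * R + 1))"
  have MR: "M * R \<ge> 0" by (simp add: M_def R_def)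
  have c0: "c > 0" using e0 by (simp add: c_def)
  have d0: "d0 > 0" using MR c0 by (simp add: d0_def)
  have ev3: "\<forall>\<^sub>F \<delta> in at_right (0::real). \<delta> \<in> {0<..<d0}" by (rule eventually_at_right_real[OF d0])
  have "\<forall>\<^sub>F \<delta> in at_right 0. \<forall>s C. (s = 1 \<or> s = - 1) \<longrightarrow> (\<forall>\<^sub>F y in at_top. s * Mo \<delta> y \<le> C * sqrt y) \<longrightarrow> c / \<delta> \<le> C"
    using ev1 ev2 ev3
  proof eventually_elim
    case (elim \<delta>)
    have d: "0 < \<delta>" "\<delta> \<le> 1" "\<delta> \<le> c / (M * R + 1)" using elim(3) by (auto simp: d0_def)
    show ?case
    proof (intro allI impI)
      fix s C :: real
      assume s: "s = 1 \<or> s = - 1" and ev: "\<forall>\<^sub>F y in at_top. s * Mo \<delta> y \<le> C * sqrt y"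
      obtain y0 where y0: "\<And>y. y \<ge> y0 \<Longrightarrow> s * Mo \<delta> y \<le> C * sqrt y"
        using ev unfolding eventually_at_top_linorder by blast
      define B where "B = max y0 0"
      \<comment> \<open>The locale asks for a nonnegative constant. Since the positive number c /
        \<delta> turns out to be at most max C 0, that maximum is C in the end.\<close>
      interpret one_sided_bound \<delta> s "max C 0" B
      proof
        fix y :: real assume y: "y \<ge> 1"
        show "s * Mo \<delta> y \<le> max C 0 * sqrt y + B"
        proof (cases "y \<ge> y0")
          case True
          have "C * sqrt y \<le> max C 0 * sqrt y" using y by (intro mult_right_mono) auto
          moreover have "B \<ge> 0" by (simp add: B_def)
          ultimately show ?thesis using y0[OF True] by linarith
        next
          case False
          have "s * Mo \<delta> y \<le> \<bar>Mo \<delta> y\<bar>" using s by auto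
          also have "\<dots> \<le> y" by (rule abs_Mo_le) (use y d in auto)
          also have "\<dots> \<le> B" using False by (simp add: B_def)
          also have "\<dots> \<le> max C 0 * sqrt y + B" using y by simp
          finally show ?thesis .
        qed
      qed (use assms s d in \<open>auto simp: B_def\<close>)
      obtain T where T: "e0 / (1024 * \<delta>) \<le> (\<Sum>g\<in>ordinates \<inter> {t0<..<T}. residue_weight g * g powr (- 1 - \<delta>))"
        using sum_residue_weight_ge[OF t0 e0 e01 e02] by blast
      define S where "S = ordinates \<inter> {t0<..<T}"
      have S: "finite S" "S \<subseteq> ordinates"
        unfolding S_def by (rule finite_subset[OF _ finite_ordinates[of t0 T]]) auto
      have "1/2 * (e0 / (1024 * \<delta>)) \<le> Gamma (1 + \<delta>) * (e0 / (1024 * \<delta>))"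
        using elim(1) e0 d by (intro mult_right_mono) auto
      also have "\<dots> \<le> Gamma (1 + \<delta>) * (\<Sum>g\<in>S. residue_weight g * g powr (- 1 - \<delta>))"
        using T elim(1) unfolding S_def by (intro mult_left_mono) auto
      also have "\<dots> = 8 * (\<Sum>g\<in>S. Gamma (1 + \<delta>) / 8 * (residue_weight g * g powr (- 1 - \<delta>)))"
        by (simp add: sum_distrib_left)
      also have "\<dots> \<le> 8 * (\<Sum>g\<in>S. norm (a g))"
        by (intro mult_left_mono sum_mono norm_a_ge) (use t0(1) in \<open>auto simp: S_def\<close>)
      finally have A: "e0 / (16384 * \<delta>) \<le> (\<Sum>g\<in>S. norm (a g))" by simp
      have "norm (a 0) \<le> M * R"
        unfolding a_def norm_mult R_def using elim(2) by (intro mult_right_mono) auto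
      moreover have "\<bar>s * Re (a 0)\<bar> \<le> norm (a 0)" using s abs_Re_le_cmod[of "a 0"] by auto
      moreover have "M * R \<le> c / \<delta>"
      proof -
        have "M * R * \<delta> \<le> (M * R + 1) * \<delta>" using d by (simp add: algebra_simps)
        also have "\<dots> \<le> c" using d(3) MR by (simp add: pos_le_divide_eq mult.commute)
        finally show ?thesis using d by (simp add: pos_le_divide_eq)
      qed
      ultimately have "s * Re (a 0) \<ge> - (c / \<delta>)" by linarith
      moreover have "s * Re (a 0) + (\<Sum>g\<in>S. norm (a g)) \<le> max C 0"
        by (rule riesz_product_bound[OF assms(3) S])
      moreover have "e0 / (16384 * \<delta>) = 2 * (c / \<delta>)" by (simp add: c_def)
      ultimately have "c / \<delta> \<le> max C 0" using A by linarith
      moreover have "c / \<delta> > 0" using c0 d by simp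
      ultimately show "c / \<delta> \<le> C" by linarith
    qed
  qed
  then show ?thesis using that c0 by blast
qed

text \<open>If the limsup were below c / \<delta>, a real C strictly between would be an eventual
  one-sided bound, against \<open>one_sided_bound_ge\<close>. The liminf is the same argument with
  the opposite sign.\<close>

theorem theorem8p5:
  assumes "Riemann_Hypothesis"
    and "Simple_Zeros"
    and "Linear_Independence_Conjecture"
    and "\<And>\<epsilon>::real. \<epsilon> > 0 \<Longrightarrow>
      (\<lambda>T::real. \<Sum>\<rho> | \<rho> \<in> nontrivial_zeros \<and> \<bar>Im \<rho>\<bar> \<le> T. 1 / norm (deriv zeta \<rho>))
        \<in> O[at_top](\<lambda>T. T powr (1 + \<epsilon>))"
  shows "\<exists>c::real. c > 0 \<and> (\<forall>\<^sub>F \<delta> in at_right (0::real).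
      Limsup at_top (\<lambda>y::real. ereal (1 / sqrt y *
        (\<Sum>n | 1 \<le> n \<and> real n \<le> y. moebius_mu n * (1 - real n / y) powr \<delta>))) \<ge> ereal (c / \<delta>) \<and>
      Liminf at_top (\<lambda>y::real. ereal (1 / sqrt y *
        (\<Sum>n | 1 \<le> n \<and> real n \<le> y. moebius_mu n * (1 - real n / y) powr \<delta>))) \<le> ereal (- c / \<delta>))"
proof -
  obtain c :: real where c: "c > 0"
    "\<forall>\<^sub>F \<delta> in at_right 0. \<forall>s C. (s = 1 \<or> s = - 1) \<longrightarrow> (\<forall>\<^sub>F y in at_top. s * Mo \<delta> y \<le> C * sqrt y) \<longrightarrow> c / \<delta> \<le> C"
    using one_sided_bound_ge[OF assms(1-3)] by blast
  have "\<forall>\<^sub>F \<delta> in at_right (0::real).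
      Limsup at_top (\<lambda>y. ereal (1 / sqrt y * Mo \<delta> y)) \<ge> ereal (c / \<delta>) \<and>
      Liminf at_top (\<lambda>y. ereal (1 / sqrt y * Mo \<delta> y)) \<le> ereal (- c / \<delta>)"
    using c(2)
  proof eventually_elim
    case (elim \<delta>)
    show ?case
    proof
      show "Limsup at_top (\<lambda>y. ereal (1 / sqrt y * Mo \<delta> y)) \<ge> ereal (c / \<delta>)"
      proof (rule ccontr)
        assume "\<not> ?thesis"
        then have "Limsup at_top (\<lambda>y. ereal (1 / sqrt y * Mo \<delta> y)) < ereal (c / \<delta>)" by (simp only: not_le)
        from ereal_dense2[OF this] obtain C
          where C: "Limsup at_top (\<lambda>y. ereal (1 / sqrt y * Mo \<delta> y)) < ereal C" "ereal C < ereal (c / \<delta>)" by blast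
        from Limsup_lessD[OF C(1)] have "\<forall>\<^sub>F y in at_top. 1 / sqrt y * Mo \<delta> y < C" by simp
        then have "\<forall>\<^sub>F y in at_top. 1 * Mo \<delta> y \<le> C * sqrt y" using eventually_gt_at_top[of 0]
          by eventually_elim (simp add: field_simps)
        then have "c / \<delta> \<le> C" using elim by blast
        then show False using C(2) by simp
      qed
      show "Liminf at_top (\<lambda>y. ereal (1 / sqrt y * Mo \<delta> y)) \<le> ereal (- c / \<delta>)"
      proof (rule ccontr)
        assume "\<not> ?thesis"
        then have "ereal (- c / \<delta>) < Liminf at_top (\<lambda>y. ereal (1 / sqrt y * Mo \<delta> y))" by (simp only: not_le)
        from ereal_dense2[OF this] obtain C
          where C: "ereal (- c / \<delta>) < ereal C" "ereal C < Liminf at_top (\<lambda>y. ereal (1 / sqrt y * Mo \<delta> y))" by blast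
        from less_LiminfD[OF C(2)] have "\<forall>\<^sub>F y in at_top. C < 1 / sqrt y * Mo \<delta> y" by simp
        then have "\<forall>\<^sub>F y in at_top. - 1 * Mo \<delta> y \<le> - C * sqrt y" using eventually_gt_at_top[of 0]
          by eventually_elim (simp add: field_simps)
        then have "c / \<delta> \<le> - C" using elim by blast
        then show False using C(1) by simp
      qed
    qed
  qed
  then show ?thesis unfolding Mo_def using c(1) by blast
qed

end
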